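(* Let $n\ge 1$ be an integer. As $q\to\infty$ through odd prime powers, $$\lim_{q\to\infty}\frac{|\mathrm{U}(n,q)^2|}{|\mathrm{U}(n,q)|}=\sum_{\lambda\vdash n}\frac{1}{2^{\pi(\lambda)}\,|\mathcal Z_{S_n}(\sigma_\lambda)|}=\lim_{q\to\infty}\frac{|\mathrm{GL}(n,q)^2|}{|\mathrm{GL}(n,q)|}.$$
   Context: $\mathrm{GL}(n,q)$ is the general linear group over the field with $q$ elements; $\mathrm{U}(n,q)\subset\mathrm{GL}(n,q^2)$ is the finite unitary group, the group of fixed points of $F\colon (a_{ij})\mapsto {}^t(a_{ij}^q)^{-1}$ on $\mathrm{GL}(n,\overline{\mathbb F_q})$. For a group $H$, $H^2=\{x^2:x\in H\}$ is the set of squares. The sum is over partitions $\lambda$ of $n$; $\pi(\lambda)$ is the number of parts of $\lambda$ (with multiplicity); $\sigma_\lambda\in S_n$ is a permutation of cycle type $\lambda$ and $\mathcal Z_{S_n}(\sigma_\lambda)$ is its centralizer in $S_n$. *)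

theory Defs
  imports
    "HOL-Number_Theory.Number_Theory"
    "HOL-Algebra.Algebraic_Closure"
    "HOL-Algebra.Sym_Groups"
    "HOL-Combinatorics.Orbits"
    "Jordan_Normal_Form.Matrix"
    Complex_Main
begin

text \<open>The type of a finite field with \<open>q\<close> elements cannot depend on \<open>q\<close>, so fields are records of
  HOL-Algebra with explicit carriers.\<close>

text \<open>For a power \<open>q\<close> of a prime \<open>p\<close>, an algebraic closure of the integers mod \<open>p\<close>, hence of
  each of its finite subfields; \<open>aprimedivisor q = p\<close>. The field with \<open>q\<close> elements is the subfield
  fixed by the \<open>q\<close>-power map; see \<open>algebraic_closure_Fbar\<close>, \<open>field_GF\<close> and \<open>card_GF\<close> below.\<close>

definition Fbar :: "nat \<Rightarrow> ((int list \<times> nat) multiset \<Rightarrow> int) ring"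
  where "Fbar q = field.alg_closure (residue_ring (int (aprimedivisor q)))"

definition GF :: "nat \<Rightarrow> ((int list \<times> nat) multiset \<Rightarrow> int) ring"
  where "GF q = (Fbar q)\<lparr>carrier := {x \<in> carrier (Fbar q). x [^]\<^bsub>Fbar q\<^esub> q = x}\<rparr>"

definition mat_monoid :: "nat \<Rightarrow> ('a, 'b) ring_scheme \<Rightarrow> 'a mat monoid"
  where "mat_monoid n R =
    \<lparr>carrier = {A \<in> carrier_mat n n. elements_mat A \<subseteq> carrier R},
     monoid.mult = (\<lambda>A B. mat n n (\<lambda>(i, j). \<Oplus>\<^bsub>R\<^esub>k\<in>{..<n}. A $$ (i, k) \<otimes>\<^bsub>R\<^esub> B $$ (k, j))),
     one = mat n n (\<lambda>(i, j). if i = j then \<one>\<^bsub>R\<^esub> else \<zero>\<^bsub>R\<^esub>)\<rparr>"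

definition GL :: "nat \<Rightarrow> ('a, 'b) ring_scheme \<Rightarrow> 'a mat monoid"
  where "GL n R = units_of (mat_monoid n R)"

definition unitary_frobenius ::
    "nat \<Rightarrow> nat \<Rightarrow> ((int list \<times> nat) multiset \<Rightarrow> int) mat \<Rightarrow> ((int list \<times> nat) multiset \<Rightarrow> int) mat"
  where "unitary_frobenius n q A =
    inv\<^bsub>GL n (Fbar q)\<^esub> (transpose_mat (map_mat (\<lambda>a. a [^]\<^bsub>Fbar q\<^esub> q) A))"

text \<open>\<open>U n q\<close> lives inside the general linear group over the algebraic closure; its elements have
  entries in the field with \<open>q\<^sup>2\<close> elements.\<close>

definition U :: "nat \<Rightarrow> nat \<Rightarrow> ((int list \<times> nat) multiset \<Rightarrow> int) mat monoid"
  where "U n q = (GL n (Fbar q))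
    \<lparr>carrier := {A \<in> carrier (GL n (Fbar q)). unitary_frobenius n q A = A}\<rparr>"

definition squares :: "('a, 'b) monoid_scheme \<Rightarrow> 'a set"
  where "squares G = {x [^]\<^bsub>G\<^esub> (2::nat) | x. x \<in> carrier G}"

definition centralizer :: "('a, 'b) monoid_scheme \<Rightarrow> 'a \<Rightarrow> 'a set"
  where "centralizer G x = {g \<in> carrier G. g \<otimes>\<^bsub>G\<^esub> x = x \<otimes>\<^bsub>G\<^esub> g}"

definition partitions :: "nat \<Rightarrow> nat multiset set"
  where "partitions n = {\<mu>. 0 \<notin># \<mu> \<and> sum_mset \<mu> = n}"

text \<open>The \<open>orbit\<close> of a point under a permutation contains the point itself, so a fixed point
  contributes a part 1.\<close>

definition cycle_type :: "nat \<Rightarrow> (nat \<Rightarrow> nat) \<Rightarrow> nat multiset"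
  where "cycle_type n \<sigma> = image_mset card (mset_set (orbit \<sigma> ` {1..n}))"

lemma (in cring) freshman_prime:
  fixes p :: nat
  assumes p: "Factorial_Ring.prime p" and char: "[p] \<cdot> \<one> = \<zero>" and x: "x \<in> carrier R" and y: "y \<in> carrier R"
  shows "(x \<oplus> y) [^] p = x [^] p \<oplus> y [^] p"
proof -
  have binom: "(x \<oplus> y) [^] n = (\<Oplus>i\<in>{..n}. [(n choose i)] \<cdot> (x [^] i \<otimes> y [^] (n - i)))" for n :: nat
  proof (induction n)
    case 0
    then show ?case by simp
  next
    case (Suc n)
    let ?f = "\<lambda>i. [(n choose i)] \<cdot> (x [^] i \<otimes> y [^] (n - i))"
    let ?g = "\<lambda>i. [(n choose i)] \<cdot> (x [^] i \<otimes> y [^] (Suc n - i))"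
    have f: "?f \<in> A \<rightarrow> carrier R" for A using x y by auto
    have g: "?g \<in> A \<rightarrow> carrier R" for A using x y by auto
    have "(\<Oplus>i\<in>{..n}. ?f i) \<otimes> x = (\<Oplus>i\<in>{..n}. ?f i \<otimes> x)"
      using finsum_ldistr[OF _ x f] by simp
    also have "\<dots> = (\<Oplus>i\<in>{..n}. [(n choose i)] \<cdot> (x [^] Suc i \<otimes> y [^] (n - i)))"
      using x y by (intro finsum_cong') (auto simp: add_pow_ldistr add_pow_rdistr m_ac)
    finally have 1: "(\<Oplus>i\<in>{..n}. ?f i) \<otimes> x = (\<Oplus>i\<in>{..n}. [(n choose i)] \<cdot> (x [^] Suc i \<otimes> y [^] (n - i)))" .
    have "(\<Oplus>i\<in>{..n}. ?f i) \<otimes> y = (\<Oplus>i\<in>{..n}. ?f i \<otimes> y)"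
      using finsum_ldistr[OF _ y f] by simp
    also have "\<dots> = (\<Oplus>i\<in>{..n}. ?g i)"
      using x y by (intro finsum_cong') (auto simp: add_pow_ldistr m_assoc Suc_diff_le)
    also have "\<dots> = (\<Oplus>i\<in>{..Suc n}. ?g i)"
      using finsum_Suc[OF g] x y g by (simp add: binomial_eq_0)
    also have "\<dots> = (\<Oplus>i\<in>{..n}. ?g (Suc i)) \<oplus> ?g 0"
      using finsum_Suc2[OF g] by simp
    finally have 2: "(\<Oplus>i\<in>{..n}. ?f i) \<otimes> y = (\<Oplus>i\<in>{..n}. ?g (Suc i)) \<oplus> ?g 0" .
    let ?h = "\<lambda>i. [(Suc n choose i)] \<cdot> (x [^] i \<otimes> y [^] (Suc n - i))"
    have h: "?h \<in> A \<rightarrow> carrier R" for A using x y by auto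
    have "(x \<oplus> y) [^] Suc n = (\<Oplus>i\<in>{..n}. ?f i) \<otimes> x \<oplus> (\<Oplus>i\<in>{..n}. ?f i) \<otimes> y"
      using Suc x y f by (simp add: r_distr)
    also have "\<dots> = ((\<Oplus>i\<in>{..n}. [(n choose i)] \<cdot> (x [^] Suc i \<otimes> y [^] (n - i))) \<oplus> (\<Oplus>i\<in>{..n}. ?g (Suc i))) \<oplus> ?g 0"
      unfolding 1 2 using x y by (subst a_assoc) (auto intro!: finsum_closed)
    also have "(\<Oplus>i\<in>{..n}. [(n choose i)] \<cdot> (x [^] Suc i \<otimes> y [^] (n - i))) \<oplus> (\<Oplus>i\<in>{..n}. ?g (Suc i))
        = (\<Oplus>i\<in>{..n}. ?h (Suc i))"
      using x y by (subst finsum_addf[symmetric]) (auto intro!: finsum_cong' simp del: nat_pow_Suc simp: add.nat_pow_mult)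
    also have "\<dots> \<oplus> ?g 0 = (\<Oplus>i\<in>{..Suc n}. ?h i)"
      using finsum_Suc2[OF h, of n] by simp
    finally show ?case .
  qed
  have p1: "p > 1" using p prime_gt_1_nat by auto
  then obtain m where m: "p = Suc (Suc m)" using less_imp_Suc_add[OF p1] by auto
  let ?h = "\<lambda>i. [(p choose i)] \<cdot> (x [^] i \<otimes> y [^] (p - i))"
  have h: "?h \<in> A \<rightarrow> carrier R" for A using x y by auto
  have hs: "(\<lambda>i. ?h (Suc i)) \<in> A \<rightarrow> carrier R" for A using x y by auto
  have kill: "[k] \<cdot> z = \<zero>" if k: "p dvd k" and z: "z \<in> carrier R" for k z
  proof -
    obtain l where l: "k = p * l" using k by auto
    have "[p] \<cdot> z = \<zero>"
      using add_pow_ldistr[of \<one> z p] char z by simp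
    then show ?thesis using z by (simp add: l add.nat_pow_pow[symmetric])
  qed
  have "(x \<oplus> y) [^] p = (\<Oplus>i\<in>{..Suc m}. ?h (Suc i)) \<oplus> ?h 0"
    unfolding binom using finsum_Suc2[OF h, of "Suc m"] unfolding m by blast
  also have "(\<Oplus>i\<in>{..Suc m}. ?h (Suc i)) = ?h p \<oplus> (\<Oplus>i\<in>{..m}. ?h (Suc i))"
    using finsum_Suc[OF hs, of m] unfolding m by blast
  also have "(\<Oplus>i\<in>{..m}. ?h (Suc i)) = (\<Oplus>i\<in>{..m}. \<zero>)"
  proof (intro finsum_cong')
    fix i assume "i \<in> {..m}"
    then have "p dvd (p choose Suc i)" using m by (intro dvd_choose_prime[OF _ _ _ p]) auto
    then show "?h (Suc i) = \<zero>" using x y by (intro kill) auto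
  qed auto
  finally show ?thesis using x y by (simp del: nat_pow_Suc)
qed

lemma (in cring) freshman:
  fixes p :: nat
  assumes "Factorial_Ring.prime p" "[p] \<cdot> \<one> = \<zero>" "x \<in> carrier R" "y \<in> carrier R"
  shows "(x \<oplus> y) [^] (p ^ k) = x [^] (p ^ k) \<oplus> y [^] (p ^ k)"
proof (induction k)
  case (Suc k)
  have "(x \<oplus> y) [^] (p ^ Suc k) = ((x \<oplus> y) [^] (p ^ k)) [^] p"
    using assms by (simp add: nat_pow_pow mult.commute)
  also have "\<dots> = (x [^] (p ^ k)) [^] p \<oplus> (y [^] (p ^ k)) [^] p"
    unfolding Suc using assms by (intro freshman_prime) auto
  finally show ?case using assms by (simp add: nat_pow_pow mult.commute)
qed (use assms in simp)

lemma ring_hom_char: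
  assumes "h \<in> Ring.ring_hom R S" "ring R" "ring S" "[(p::nat)] \<cdot>\<^bsub>R\<^esub> \<one>\<^bsub>R\<^esub> = \<zero>\<^bsub>R\<^esub>"
  shows "[p] \<cdot>\<^bsub>S\<^esub> \<one>\<^bsub>S\<^esub> = \<zero>\<^bsub>S\<^esub>"
proof -
  interpret ring_hom_ring R S h using assms ring_hom_ringI2 by blast
  have "h ([(n::nat)] \<cdot>\<^bsub>R\<^esub> \<one>\<^bsub>R\<^esub>) = [n] \<cdot>\<^bsub>S\<^esub> \<one>\<^bsub>S\<^esub>" for n
    by (induction n) (auto)
  then show ?thesis using assms(4) by (metis hom_zero)
qed

lemma (in algebraically_closed) frobenius_roots:
  fixes p :: nat
  assumes p: "Factorial_Ring.prime p" and char: "[p] \<cdot> \<one> = \<zero>" and k: "k > 0" and q: "q = p ^ k"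
  shows "card {x \<in> carrier L. x [^] q = x} = q"
proof -
  interpret UP: domain "poly_ring L" using univ_poly_is_domain[OF carrier_is_subring] .
  have q1: "q > 1" using p k unfolding q by (metis prime_gt_1_nat one_less_power)
  have charU: "[p] \<cdot>\<^bsub>poly_ring L\<^esub> \<one>\<^bsub>poly_ring L\<^esub> = \<zero>\<^bsub>poly_ring L\<^esub>"
    using ring_hom_char[OF canonical_embedding_is_hom[OF carrier_is_subring] _ UP.ring_axioms]
      char ring_axioms by simp
  define P where "P = X [^]\<^bsub>poly_ring L\<^esub> q \<ominus>\<^bsub>poly_ring L\<^esub> X"
  have X: "X \<in> carrier (poly_ring L)" using var_closed[OF carrier_is_subring] by simp
  have P: "P \<in> carrier (poly_ring L)" unfolding P_def using X by simp
  have dX: "degree X = 1" by (simp add: var_def)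
  have degP: "degree P = q"
  proof -
    have "degree (\<ominus>\<^bsub>poly_ring L\<^esub> X) = 1"
      using univ_poly_a_inv_degree[OF carrier_is_subring X] dX by simp
    moreover have "degree (X [^]\<^bsub>poly_ring L\<^esub> q) = q"
      using polynomial_pow_degree[OF X] dX by simp
    moreover have "polynomial (carrier L) (\<ominus>\<^bsub>poly_ring L\<^esub> X)" "polynomial (carrier L) (X [^]\<^bsub>poly_ring L\<^esub> q)"
      using X unfolding univ_poly_carrier by auto
    ultimately show ?thesis unfolding P_def a_minus_def univ_poly_add
      using poly_add_degree_eq[OF carrier_is_subring] q1 by simp
  qed
  have P0: "P \<noteq> []" using degP q1 by auto
  have evP: "eval P a = a [^] q \<ominus> a" if a: "a \<in> carrier L" for a
  proof -
    interpret E: ring_hom_ring "poly_ring L" L "\<lambda>p. eval p a"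
      using eval_ring_hom[OF carrier_is_subring a] .
    show ?thesis unfolding P_def a_minus_def using X eval_var[OF a] by (simp add: E.hom_nat_pow)
  qed
  have roots: "a \<in># roots P \<longleftrightarrow> a \<in> carrier L \<and> a [^] q = a" for a
    unfolding roots_mem_iff_is_root[OF P] is_root_def using evP P0 by (auto simp: r_right_minus_eq)
  have simple: "count (roots P) a \<le> 1" for a
  proof (rule ccontr)
    assume "\<not> ?thesis"
    then have c2: "2 \<le> alg_mult P a" and "a \<in># roots P"
      unfolding alg_mult_eq_count_roots[OF P] using count_greater_zero_iff[of "roots P" a] by linarith+
    then have a: "a \<in> carrier L" "a [^] q = a" using roots by auto
    define D where "D = [\<one>, \<ominus> a]"
    define C where "C = poly_of_const a"
    have D: "D \<in> carrier (poly_ring L)" using a unfolding D_def sym[OF univ_poly_carrier] polynomial_def by auto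
    interpret C: ring_hom_ring L "poly_ring L" poly_of_const
      using canonical_embedding_ring_hom[OF carrier_is_subring] by simp
    have C: "C \<in> carrier (poly_ring L)" "C [^]\<^bsub>poly_ring L\<^esub> q = C"
      unfolding C_def using a C.hom_nat_pow[of a q] by auto
    have "C = [a] \<or> C = [] \<and> a = \<zero>" unfolding C_def poly_of_const_def by auto
    then have XDC: "X = D \<oplus>\<^bsub>poly_ring L\<^esub> C"
      using a unfolding var_def D_def univ_poly_add by (auto simp: l_neg)
    have "X [^]\<^bsub>poly_ring L\<^esub> q = D [^]\<^bsub>poly_ring L\<^esub> q \<oplus>\<^bsub>poly_ring L\<^esub> C"
      unfolding XDC using UP.freshman[OF p charU D C(1), of k] C(2) unfolding q by simp
    moreover have "D [^]\<^bsub>poly_ring L\<^esub> q \<in> carrier (poly_ring L)" using D by simp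
    moreover have "C \<oplus>\<^bsub>poly_ring L\<^esub> (\<ominus>\<^bsub>poly_ring L\<^esub> D \<oplus>\<^bsub>poly_ring L\<^esub> \<ominus>\<^bsub>poly_ring L\<^esub> C) = \<ominus>\<^bsub>poly_ring L\<^esub> D"
      using D C(1) UP.r_neg2[of C "\<ominus>\<^bsub>poly_ring L\<^esub> D"] UP.a_comm[of "\<ominus>\<^bsub>poly_ring L\<^esub> C" "\<ominus>\<^bsub>poly_ring L\<^esub> D"] by simp
    ultimately have "P = D [^]\<^bsub>poly_ring L\<^esub> q \<ominus>\<^bsub>poly_ring L\<^esub> D"
      unfolding P_def using D C(1) arg_cong[OF XDC, of "a_minus (poly_ring L) (X [^]\<^bsub>poly_ring L\<^esub> q)"]
      by (simp add: a_minus_def UP.minus_add UP.a_assoc UP.r_neg2)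
    also have "D [^]\<^bsub>poly_ring L\<^esub> q = D \<otimes>\<^bsub>poly_ring L\<^esub> D [^]\<^bsub>poly_ring L\<^esub> (q - 1)"
      using D q1 UP.nat_pow_Suc2[OF D, of "q - 1"] by simp
    finally have P1: "P = D \<otimes>\<^bsub>poly_ring L\<^esub> (D [^]\<^bsub>poly_ring L\<^esub> (q - 1) \<ominus>\<^bsub>poly_ring L\<^esub> \<one>\<^bsub>poly_ring L\<^esub>)"
      using D by (simp add: UP.r_distr a_minus_def UP.r_minus)
    have "(D [^]\<^bsub>poly_ring L\<^esub> (2::nat)) pdivides P"
      using le_alg_mult_imp_pdivides[OF a(1) P c2] unfolding D_def .
    then obtain Q where Q: "Q \<in> carrier (poly_ring L)" "P = D [^]\<^bsub>poly_ring L\<^esub> (2::nat) \<otimes>\<^bsub>poly_ring L\<^esub> Q"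
      unfolding pdivides_def factor_def by auto
    then have "D \<otimes>\<^bsub>poly_ring L\<^esub> (D \<otimes>\<^bsub>poly_ring L\<^esub> Q) = P"
      using D by (simp add: numeral_2_eq_2 UP.m_assoc)
    moreover have "D \<noteq> \<zero>\<^bsub>poly_ring L\<^esub>" unfolding D_def univ_poly_zero by simp
    ultimately have "D \<otimes>\<^bsub>poly_ring L\<^esub> Q = D [^]\<^bsub>poly_ring L\<^esub> (q - 1) \<ominus>\<^bsub>poly_ring L\<^esub> \<one>\<^bsub>poly_ring L\<^esub>"
      unfolding P1 using D Q(1) by (subst (asm) UP.m_lcancel) auto
    then have ev: "eval (D \<otimes>\<^bsub>poly_ring L\<^esub> Q) a = eval (D [^]\<^bsub>poly_ring L\<^esub> (q - 1) \<ominus>\<^bsub>poly_ring L\<^esub> \<one>\<^bsub>poly_ring L\<^esub>) a"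
      by simp
    interpret E: ring_hom_ring "poly_ring L" L "\<lambda>p. eval p a"
      using eval_ring_hom[OF carrier_is_subring a(1)] .
    have "eval D a = \<zero>" unfolding D_def using a(1) by (simp add: r_neg)
    then have "\<zero> = \<ominus> \<one>"
      using ev D Q(1) q1 by (simp add: a_minus_def E.hom_nat_pow nat_pow_zero)
    then show False using one_not_zero by (metis minus_minus one_closed minus_zero)
  qed
  have "roots P = mset_set {x \<in> carrier L. x [^] q = x}" 
  proof -
    have f: "finite {x \<in> carrier L. x [^] q = x}"
    proof -
      have "{x \<in> carrier L. x [^] q = x} = set_mset (roots P)" using roots by blast
      then show ?thesis by simp
    qed
    show ?thesis
    proof (rule multiset_eqI)
      fix a show "count (roots P) a = count (mset_set {x \<in> carrier L. x [^] q = x}) a"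
        using simple[of a] roots[of a] f count_greater_zero_iff[of "roots P" a]
        by (cases "count (roots P) a = 0") (auto simp: count_mset_set' not_in_iff le_Suc_eq)
    qed
  qed
  then show ?thesis using roots_over_carrier[OF P] degP unfolding splitted_def by simp
qed


lemma
  assumes q: "primepow q"
  shows algebraic_closure_Fbar: "algebraic_closure (Fbar q)
      (ring.indexed_const (residue_ring (int (aprimedivisor q))) ` carrier (residue_ring (int (aprimedivisor q))))"
    and field_GF: "field (GF q)"
    and card_GF: "card (carrier (GF q)) = q"
proof -
  define p where "p = aprimedivisor q"
  obtain k where p: "Factorial_Ring.prime p" and k: "k > 0" and qp: "q = p ^ k"
    using q unfolding primepow_def p_def by (auto simp: aprimedivisor_prime_power)
  interpret R: residues_prime p "residue_ring (int p)" by unfold_locales (use p in auto)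
  show cl: "algebraic_closure (Fbar q)
      (ring.indexed_const (residue_ring (int (aprimedivisor q))) ` carrier (residue_ring (int (aprimedivisor q))))"
    using R.alg_closureE(1) unfolding Fbar_def p_def .
  interpret F: algebraic_closure "Fbar q"
    "ring.indexed_const (residue_ring (int (aprimedivisor q))) ` carrier (residue_ring (int (aprimedivisor q)))"
    by (rule cl)
  have "[(n::nat)] \<cdot>\<^bsub>residue_ring (int p)\<^esub> \<one>\<^bsub>residue_ring (int p)\<^esub> = int n mod int p" for n
    by (induction n) (auto simp: R.res_zero_eq R.res_one_eq R.res_add_eq mod_simps add.commute)
  then have "[p] \<cdot>\<^bsub>residue_ring (int p)\<^esub> \<one>\<^bsub>residue_ring (int p)\<^esub> = \<zero>\<^bsub>residue_ring (int p)\<^esub>"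
    by (simp add: R.res_zero_eq)
  from ring_hom_char[OF R.alg_closureE(2) R.ring_axioms _ this]
  have char: "[p] \<cdot>\<^bsub>Fbar q\<^esub> \<one>\<^bsub>Fbar q\<^esub> = \<zero>\<^bsub>Fbar q\<^esub>"
    using F.ring_axioms unfolding Fbar_def p_def by blast
  show "card (carrier (GF q)) = q"
    using F.frobenius_roots[OF p char k qp] by (simp add: GF_def)
  let ?K = "{x \<in> carrier (Fbar q). x [^]\<^bsub>Fbar q\<^esub> q = x}"
  have q1: "q > 1" using q primepow_gt_Suc_0 by auto
  have "subfield ?K (Fbar q)"
  proof (rule F.subfieldI'[OF F.subringI])
    show neg: "\<ominus>\<^bsub>Fbar q\<^esub> x \<in> ?K" if x: "x \<in> ?K" for x
    proof -
      have "\<zero>\<^bsub>Fbar q\<^esub> = x \<oplus>\<^bsub>Fbar q\<^esub> (\<ominus>\<^bsub>Fbar q\<^esub> x) [^]\<^bsub>Fbar q\<^esub> q"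
        using F.freshman[OF p char, of x "\<ominus>\<^bsub>Fbar q\<^esub> x" k] x q1
        by (simp add: qp[symmetric] F.r_neg F.nat_pow_zero)
      then have "\<ominus>\<^bsub>Fbar q\<^esub> x = (\<ominus>\<^bsub>Fbar q\<^esub> x) [^]\<^bsub>Fbar q\<^esub> q"
        using x by (intro F.minus_equality) (auto simp: F.a_comm)
      then show ?thesis using x by auto
    qed
    show "x \<oplus>\<^bsub>Fbar q\<^esub> y \<in> ?K" if "x \<in> ?K" "y \<in> ?K" for x y
      using F.freshman[OF p char, of x y k] that by (simp add: qp[symmetric])
    show "x \<otimes>\<^bsub>Fbar q\<^esub> y \<in> ?K" if "x \<in> ?K" "y \<in> ?K" for x y
      using that by (simp add: F.nat_pow_distrib)
    show "inv\<^bsub>Fbar q\<^esub> x \<in> ?K" if "x \<in> ?K - {\<zero>\<^bsub>Fbar q\<^esub>}" for x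
    proof -
      have x: "x \<in> Units (Fbar q)" using that F.field_Units by auto
      then have "x \<otimes>\<^bsub>Fbar q\<^esub> (inv\<^bsub>Fbar q\<^esub> x) [^]\<^bsub>Fbar q\<^esub> q = \<one>\<^bsub>Fbar q\<^esub>"
        using F.nat_pow_distrib[of x "inv\<^bsub>Fbar q\<^esub> x" q] that by simp
      then have "inv\<^bsub>Fbar q\<^esub> x = (inv\<^bsub>Fbar q\<^esub> x) [^]\<^bsub>Fbar q\<^esub> q"
        using x by (intro F.comm_inv_char) auto
      then show ?thesis using x by auto
    qed
  qed auto
  then show "field (GF q)" unfolding GF_def using F.subfield_iff(2) by blast
qed


lemma ex_cycle_type:
  assumes "\<mu> \<in> partitions n"
  shows "\<exists>\<sigma> \<in> carrier (sym_group n). cycle_type n \<sigma> = \<mu>"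
  using assms
proof (induction \<mu> arbitrary: n)
  case empty
  then have "n = 0" by (simp add: partitions_def)
  then show ?case
    by (intro bexI[of _ id]) (auto simp: cycle_type_def sym_group_def permutes_def)
next
  case (add m \<mu>)
  define k where "k = n - m"
  have n: "n = k + m" "m > 0" and "\<mu> \<in> partitions k"
    using add.prems by (auto simp: partitions_def k_def)
  then obtain \<tau> where \<tau>: "\<tau> permutes {1..k}" "cycle_type k \<tau> = \<mu>"
    using add.IH by (auto simp: sym_group_def)
  let ?B = "{k+1..n}"
  define c where "c x = (if x = n then k + 1 else if k < x \<and> x < n then x + 1 else x)" for x
  have pow: "(c ^^ i) (k + 1) = k + 1 + i" if "i < m" for i
    using that by (induction i) (auto simp: c_def n(1))
  have B: "(c ^^ m) (k + 1) = k + 1"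
  proof -
    obtain m' where "m = Suc m'" using n(2) by (cases m) auto
    then show ?thesis using pow[of m'] by (simp add: c_def n(1))
  qed
  have orb: "orbit c (k + 1) = ?B"
  proof -
    have "orbit c (k + 1) = {(c ^^ i) (k + 1) | i. i < m}"
      by (rule orbit_altdef_bounded[OF B n(2)])
    also have "\<dots> = (\<lambda>i. (c ^^ i) (k + 1)) ` {..<m}" by auto
    also have "\<dots> = (\<lambda>i. k + 1 + i) ` {..<m}" using pow by (intro image_cong) auto
    also have "\<dots> = ?B"
    proof -
      have "x \<in> (\<lambda>i. k + 1 + i) ` {..<m}" if "x \<in> ?B" for x
        using that n by (intro image_eqI[of _ _ "x - (k + 1)"]) auto
      then show ?thesis using n by auto
    qed
    finally show ?thesis .
  qed
  have cyc: "cyclic_on c ?B" unfolding cyclic_on_def using orb n by (intro bexI[of _ "k + 1"]) auto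
  have cp: "c permutes ?B"
  proof (rule bij_imp_permutes)
    have "inj_on c ?B" by (auto simp: inj_on_def c_def split: if_splits)
    moreover have "c ` ?B \<subseteq> ?B" using n by (auto simp: c_def)
    ultimately show "bij_betw c ?B ?B" by (simp add: bij_betw_def endo_inj_surj)
  qed (use n in \<open>auto simp: c_def\<close>)
  define \<sigma> where "\<sigma> = \<tau> \<circ> c"
  have disj: "{1..k} \<inter> ?B = {}" by auto
  have un: "{1..n} = {1..k} \<union> ?B" using n by auto
  have \<sigma>: "\<sigma> permutes {1..n}" unfolding \<sigma>_def un
    using \<tau>(1) cp by (intro permutes_compose) (auto intro: permutes_subset)
  have o1: "orbit \<sigma> x = orbit \<tau> x" if "x \<in> {1..k}" for x
  proof -
    have "cyclic_on \<tau> (orbit \<tau> x)" using cyclic_on_orbit[OF \<tau>(1)] by simp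
    then have "cyclic_on \<sigma> (orbit \<tau> x)" unfolding \<sigma>_def
      by (rule permutes_comp_preserves_cyclic1[OF cp _ disj permutes_orbit_subset[OF \<tau>(1) that]])
    moreover have "x \<in> orbit \<tau> x"
      using \<tau>(1) by (intro permutation_self_in_orbit) (auto simp: permutation_permutes)
    ultimately show ?thesis by (rule orbit_cyclic_eq3)
  qed
  have o2: "orbit \<sigma> x = ?B" if "x \<in> ?B" for x
    using permutes_comp_preserves_cyclic2[OF \<tau>(1) cyc disj] that
    unfolding \<sigma>_def by (intro orbit_cyclic_eq3) auto
  have "orbit \<sigma> ` {1..n} = orbit \<sigma> ` {1..k} \<union> orbit \<sigma> ` ?B" unfolding un by (rule image_Un)
  also have "orbit \<sigma> ` {1..k} = orbit \<tau> ` {1..k}" using o1 by (intro image_cong) auto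
  also have "orbit \<sigma> ` ?B = {?B}" using o2 n by (auto simp: image_def)
  finally have orbs: "orbit \<sigma> ` {1..n} = insert ?B (orbit \<tau> ` {1..k})" by simp
  have "?B \<notin> orbit \<tau> ` {1..k}"
  proof
    assume "?B \<in> orbit \<tau> ` {1..k}"
    then have "?B \<subseteq> {1..k}" using permutes_orbit_subset[OF \<tau>(1)] by blast
    then show False using n by auto
  qed
  then have "cycle_type n \<sigma> = add_mset m \<mu>"
    using \<tau>(2) n unfolding cycle_type_def orbs by simp
  then show ?case using \<sigma> by (auto simp: sym_group_def)
qed

end

theory Submission
  imports Defs
begin

text \<open>Both groups are the fixed points of a Frobenius map \<open>F\<close> on \<open>GL\<^sub>n\<close> over the algebraic closure.
  For a permutation \<open>w\<close> let \<open>T w\<close> be the finite torus of diagonal matrices fixed by \<open>F\<close> followed by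
  \<open>w\<close>. If \<open>F g = g w\<close>, then conjugation by \<open>g\<close> carries \<open>T w\<close> into the finite group; a regular
  element of the image is a square there iff it is one in \<open>T w\<close>, because a square root commutes with
  it. The kernel of squaring on \<open>T w\<close> consists of the vectors of signs that are constant on the cycles
  of \<open>w\<close>, so a proportion \<open>2\<^sup>-\<^sup>c\<close> of \<open>T w\<close> consists of squares, \<open>c\<close> being the number of cycles, and
  the nonregular elements of \<open>T w\<close> have proportion \<open>O(1/q)\<close>. A regular element of the group is
  reached from all tori together with total weight at most \<open>n!\<close>. Applied to the regular squares and to
  the regular nonsquares of the tori, this bounds the proportion of squares from below and from above
  by the average of \<open>2\<^sup>-\<^sup>c\<close> over all permutations, up to \<open>O(1/q)\<close>. In particular nothing needs to
  be known about the other elements of the group. Grouping permutations by cycle type turns the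
  average into the sum over partitions.\<close>

section \<open>Matrices over a ring with explicit carrier\<close>

text \<open>Every count in the group is a lower bound, obtained by dividing by an upper bound for a
  multiplicity. The result is two-sided because the lower bounds for squares and for nonsquares add
  up to 1, up to \<open>8 n^2 / q\<close>. The factor \<open>4 n^2\<close> comes from at most
  \<open>n^2\<close> pairs of positions, at each of which the entries of a torus element agree with
  proportion at most \<open>4 / q\<close>. The obstacle is the existence of \<open>g\<close> with
  \<open>F g = g w\<close>, an instance of the theorem of Lang and Steinberg. It is solved
  explicitly from a regular element \<open>t\<close> of \<open>T w\<close>: the torus equation says
  that the \<open>q\<close>-power map permutes the \<open>t i\<close>, up to inversion in the
  unitary case, and so permutes the columns of a Vandermonde matrix. A regular element exists once
  \<open>q > 4 n^2\<close>, so the estimate for nonregular elements serves twice. Odd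
  \<open>q\<close> enters through the difference of \<open>1\<close> and \<open>-1\<close> in the
  kernel of squaring, and through division by 2 when a Hermitian form is diagonalized. Both groups
  are treated at once: a Boolean \<open>u\<close> selects between \<open>x^q\<close> and
  \<open>x^(-q)\<close> on diagonal entries.\<close>

context ring
begin

lemma finsum_swap:
  assumes "finite A" "finite B" "\<And>i j. i \<in> A \<Longrightarrow> j \<in> B \<Longrightarrow> f i j \<in> carrier R"
  shows "(\<Oplus>i\<in>A. \<Oplus>j\<in>B. f i j) = (\<Oplus>j\<in>B. \<Oplus>i\<in>A. f i j)"
  using assms(1,3)
proof (induction A rule: finite_induct)
  case (insert a A)
  have "(\<Oplus>j\<in>B. \<Oplus>i\<in>insert a A. f i j) = (\<Oplus>j\<in>B. f a j \<oplus> (\<Oplus>i\<in>A. f i j))"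
    using insert by (intro finsum_cong') (auto intro!: finsum_closed)
  also have "\<dots> = (\<Oplus>j\<in>B. f a j) \<oplus> (\<Oplus>j\<in>B. \<Oplus>i\<in>A. f i j)"
    using insert by (intro finsum_addf) (auto intro!: finsum_closed)
  finally show ?case using insert by (auto intro!: finsum_closed)
qed simp

lemma finsum_single:
  assumes "finite A" "i \<in> A" "f i \<in> carrier R" "\<And>k. k \<in> A \<Longrightarrow> k \<noteq> i \<Longrightarrow> f k = \<zero>"
  shows "(\<Oplus>k\<in>A. f k) = f i"
proof -
  have "(\<Oplus>k\<in>A. f k) = (\<Oplus>k\<in>A. if i = k then f k else \<zero>)"
    using assms by (intro finsum_cong') auto
  then show ?thesis
    using add.finprod_singleton[of i A "\<lambda>k. if k = i then f i else \<zero>"] assms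
    by (auto simp: eq_commute cong: if_cong)
qed

lemma carrier_mat_monoid_iff:
  "A \<in> carrier (mat_monoid n R) \<longleftrightarrow>
    A \<in> carrier_mat n n \<and> (\<forall>i<n. \<forall>j<n. A $$ (i, j) \<in> carrier R)"
  unfolding mat_monoid_def by (auto dest!: elements_matD intro: elements_matI)

lemma mat_monoid_entry [simp]:
  assumes "i < n" "j < n"
  shows "(A \<otimes>\<^bsub>mat_monoid n R\<^esub> B) $$ (i, j) = (\<Oplus>k\<in>{..<n}. A $$ (i, k) \<otimes> B $$ (k, j))"
    and "\<one>\<^bsub>mat_monoid n R\<^esub> $$ (i, j) = (if i = j then \<one> else \<zero>)"
  using assms by (auto simp: mat_monoid_def)

lemma mat_monoid_eqI:
  assumes "A \<in> carrier (mat_monoid n R)" "B \<in> carrier (mat_monoid n R)"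
    "\<And>i j. i < n \<Longrightarrow> j < n \<Longrightarrow> A $$ (i, j) = B $$ (i, j)"
  shows "A = B"
  using assms by (auto simp: carrier_mat_monoid_iff)

lemma mat_monoid_entry_closed [simp]:
  "A \<in> carrier (mat_monoid n R) \<Longrightarrow> i < n \<Longrightarrow> j < n \<Longrightarrow> A $$ (i, j) \<in> carrier R"
  by (auto simp: carrier_mat_monoid_iff)

lemma mat_in_mat_monoid:
  assumes "\<And>i j. i < n \<Longrightarrow> j < n \<Longrightarrow> f i j \<in> carrier R"
  shows "mat n n (\<lambda>(i, j). f i j) \<in> carrier (mat_monoid n R)"
  using assms by (auto simp: carrier_mat_monoid_iff)

lemma mat_monoid_mult_dim:
  "A \<otimes>\<^bsub>mat_monoid n R\<^esub> B \<in> carrier_mat n n" "\<one>\<^bsub>mat_monoid n R\<^esub> \<in> carrier_mat n n"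
  by (auto simp: mat_monoid_def)

lemma monoid_mat_monoid: "monoid (mat_monoid n R)"
proof
  have cl: "P \<otimes>\<^bsub>mat_monoid n R\<^esub> Q \<in> carrier (mat_monoid n R)"
    if "P \<in> carrier (mat_monoid n R)" "Q \<in> carrier (mat_monoid n R)" for P Q
    using that unfolding carrier_mat_monoid_iff
    by (auto simp: mat_monoid_mult_dim intro!: finsum_closed)
  show "A \<otimes>\<^bsub>mat_monoid n R\<^esub> B \<in> carrier (mat_monoid n R)"
    if "A \<in> carrier (mat_monoid n R)" "B \<in> carrier (mat_monoid n R)" for A B using that by (intro cl)
  show "A \<otimes>\<^bsub>mat_monoid n R\<^esub> B \<otimes>\<^bsub>mat_monoid n R\<^esub> C = A \<otimes>\<^bsub>mat_monoid n R\<^esub> (B \<otimes>\<^bsub>mat_monoid n R\<^esub> C)"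
    if ABC: "A \<in> carrier (mat_monoid n R)" "B \<in> carrier (mat_monoid n R)" "C \<in> carrier (mat_monoid n R)"
    for A B C
  proof (rule mat_monoid_eqI)
    fix i j assume ij: "i < n" "j < n"
    have "(\<Oplus>k\<in>{..<n}. (\<Oplus>l\<in>{..<n}. A $$ (i, l) \<otimes> B $$ (l, k)) \<otimes> C $$ (k, j))
      = (\<Oplus>k\<in>{..<n}. \<Oplus>l\<in>{..<n}. A $$ (i, l) \<otimes> B $$ (l, k) \<otimes> C $$ (k, j))"
      using ABC ij by (intro finsum_cong' finsum_ldistr) (auto intro!: finsum_closed)
    also have "\<dots> = (\<Oplus>l\<in>{..<n}. \<Oplus>k\<in>{..<n}. A $$ (i, l) \<otimes> B $$ (l, k) \<otimes> C $$ (k, j))"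
      using ABC ij by (intro finsum_swap) auto
    also have "\<dots> = (\<Oplus>l\<in>{..<n}. \<Oplus>k\<in>{..<n}. A $$ (i, l) \<otimes> (B $$ (l, k) \<otimes> C $$ (k, j)))"
      using ABC ij by (intro finsum_cong') (auto intro!: finsum_closed simp: m_assoc)
    also have "\<dots> = (\<Oplus>l\<in>{..<n}. A $$ (i, l) \<otimes> (\<Oplus>k\<in>{..<n}. B $$ (l, k) \<otimes> C $$ (k, j)))"
      using ABC ij by (intro finsum_cong' finsum_rdistr[symmetric]) (auto intro!: finsum_closed)
    moreover have "(A \<otimes>\<^bsub>mat_monoid n R\<^esub> B \<otimes>\<^bsub>mat_monoid n R\<^esub> C) $$ (i, j)
      = (\<Oplus>k\<in>{..<n}. (\<Oplus>l\<in>{..<n}. A $$ (i, l) \<otimes> B $$ (l, k)) \<otimes> C $$ (k, j))"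
      using ABC ij by simp (intro finsum_cong', auto intro!: finsum_closed)
    moreover have "(A \<otimes>\<^bsub>mat_monoid n R\<^esub> (B \<otimes>\<^bsub>mat_monoid n R\<^esub> C)) $$ (i, j)
      = (\<Oplus>l\<in>{..<n}. A $$ (i, l) \<otimes> (\<Oplus>k\<in>{..<n}. B $$ (l, k) \<otimes> C $$ (k, j)))"
      using ABC ij by simp (intro finsum_cong', auto intro!: finsum_closed)
    ultimately show "(A \<otimes>\<^bsub>mat_monoid n R\<^esub> B \<otimes>\<^bsub>mat_monoid n R\<^esub> C) $$ (i, j) =
      (A \<otimes>\<^bsub>mat_monoid n R\<^esub> (B \<otimes>\<^bsub>mat_monoid n R\<^esub> C)) $$ (i, j)" by simp
  qed (use ABC in \<open>auto intro: cl\<close>)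
  show one: "\<one>\<^bsub>mat_monoid n R\<^esub> \<in> carrier (mat_monoid n R)"
    by (auto simp: carrier_mat_monoid_iff mat_monoid_mult_dim)
  show "\<one>\<^bsub>mat_monoid n R\<^esub> \<otimes>\<^bsub>mat_monoid n R\<^esub> A = A"
    if ABC: "A \<in> carrier (mat_monoid n R)" for A
  proof (rule mat_monoid_eqI)
    fix i j assume ij: "i < n" "j < n"
    then show "(\<one>\<^bsub>mat_monoid n R\<^esub> \<otimes>\<^bsub>mat_monoid n R\<^esub> A) $$ (i, j) = A $$ (i, j)"
      using ABC by (simp, subst finsum_single[where i = i]; auto)
  qed (use cl one ABC in auto)
  show "A \<otimes>\<^bsub>mat_monoid n R\<^esub> \<one>\<^bsub>mat_monoid n R\<^esub> = A"
    if ABC: "A \<in> carrier (mat_monoid n R)" for A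
  proof (rule mat_monoid_eqI)
    fix i j assume ij: "i < n" "j < n"
    then show "(A \<otimes>\<^bsub>mat_monoid n R\<^esub> \<one>\<^bsub>mat_monoid n R\<^esub>) $$ (i, j) = A $$ (i, j)"
      using ABC by (simp, subst finsum_single[where i = j]; auto)
  qed (use cl one ABC in auto)
qed

definition dmat :: "nat \<Rightarrow> (nat \<Rightarrow> 'a) \<Rightarrow> 'a mat"
  where "dmat n t = mat n n (\<lambda>(i, j). if i = j then t i else \<zero>)"

text \<open>Row \<open>i\<close> has its one in column \<open>w i\<close>. Hence multiplication on
  the left puts row \<open>w i\<close> in place \<open>i\<close>, and multiplication on the right
  moves column \<open>j\<close> to place \<open>w j\<close>. This convention fixes the form
  \<open>twist u (t (w i)) = t i\<close> of the torus equation.\<close>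

definition pmat :: "nat \<Rightarrow> (nat \<Rightarrow> nat) \<Rightarrow> 'a mat"
  where "pmat n w = mat n n (\<lambda>(i, j). if j = w i then \<one> else \<zero>)"

text \<open>A Gauss transformation: the identity with the column \<open>l\<close> written into place
  \<open>m\<close> off the diagonal, so that one multiplication clears a whole column.\<close>

definition emat :: "nat \<Rightarrow> nat \<Rightarrow> (nat \<Rightarrow> 'a) \<Rightarrow> 'a mat"
  where "emat n m l = mat n n (\<lambda>(i, j). if i = j then \<one> else if j = m then l i else \<zero>)"

lemma special_mat_entry [simp]:
  assumes "i < n" "j < n"
  shows "dmat n t $$ (i, j) = (if i = j then t i else \<zero>)"
    "pmat n w $$ (i, j) = (if j = w i then \<one> else \<zero>)"
    "emat n m l $$ (i, j) = (if i = j then \<one> else if j = m then l i else \<zero>)"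
  using assms by (auto simp: dmat_def pmat_def emat_def)

lemma pmat_closed [simp]: "pmat n w \<in> carrier (mat_monoid n R)"
  unfolding pmat_def by (rule mat_in_mat_monoid) auto

lemma dmat_closed [simp]: "(\<And>i. i < n \<Longrightarrow> t i \<in> carrier R) \<Longrightarrow> dmat n t \<in> carrier (mat_monoid n R)"
  unfolding dmat_def by (rule mat_in_mat_monoid) auto

lemma emat_closed [simp]: "(\<And>i. i < n \<Longrightarrow> l i \<in> carrier R) \<Longrightarrow> emat n m l \<in> carrier (mat_monoid n R)"
  unfolding emat_def by (rule mat_in_mat_monoid) auto

lemma dmat_mult_entry:
  assumes "A \<in> carrier (mat_monoid n R)" "\<And>i. i < n \<Longrightarrow> t i \<in> carrier R" "i < n" "j < n"
  shows "(dmat n t \<otimes>\<^bsub>mat_monoid n R\<^esub> A) $$ (i, j) = t i \<otimes> A $$ (i, j)"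
    "(A \<otimes>\<^bsub>mat_monoid n R\<^esub> dmat n t) $$ (i, j) = A $$ (i, j) \<otimes> t j"
  using assms by (simp, subst finsum_single[where i = i]; auto) (use assms in \<open>simp, subst finsum_single[where i = j]; auto\<close>)

lemma pmat_mult_entry:
  assumes "A \<in> carrier (mat_monoid n R)" "i < n" "j < n" "w i < n"
  shows "(pmat n w \<otimes>\<^bsub>mat_monoid n R\<^esub> A) $$ (i, j) = A $$ (w i, j)"
  using assms by (simp, subst finsum_single[where i = "w i"]; auto)

lemma mult_pmat_entry:
  assumes "A \<in> carrier (mat_monoid n R)" "i < n" "j < n" "w j < n" "inj_on w {..<n}"
  shows "(A \<otimes>\<^bsub>mat_monoid n R\<^esub> pmat n w) $$ (i, w j) = A $$ (i, j)"
  using assms by (simp, subst finsum_single[where i = j]; auto simp: inj_on_def)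

lemma emat_mult_entry:
  assumes "A \<in> carrier (mat_monoid n R)" "\<And>i. i < n \<Longrightarrow> l i \<in> carrier R" "l m = \<zero>" "m < n" "i < n" "j < n"
  shows "(emat n m l \<otimes>\<^bsub>mat_monoid n R\<^esub> A) $$ (i, j) = A $$ (i, j) \<oplus> l i \<otimes> A $$ (m, j)"
proof (cases "i = m")
  case True
  then show ?thesis using assms by (simp, subst finsum_single[where i = i]; auto)
next
  case False
  have "(\<Oplus>k\<in>{..<n}. emat n m l $$ (i, k) \<otimes> A $$ (k, j))
    = (\<Oplus>k\<in>{..<n}. (if k = i then A $$ (i, j) else \<zero>) \<oplus> (if k = m then l i \<otimes> A $$ (m, j) else \<zero>))"
    using assms False by (intro finsum_cong') auto
  also have "\<dots> = (\<Oplus>k\<in>{..<n}. if k = i then A $$ (i, j) else \<zero>) \<oplus> (\<Oplus>k\<in>{..<n}. if k = m then l i \<otimes> A $$ (m, j) else \<zero>)"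
    using assms by (intro finsum_addf) auto
  also have "\<dots> = A $$ (i, j) \<oplus> l i \<otimes> A $$ (m, j)"
    using assms finsum_single[of "{..<n}" i "\<lambda>k. if k = i then A $$ (i, j) else \<zero>"]
      finsum_single[of "{..<n}" m "\<lambda>k. if k = m then l i \<otimes> A $$ (m, j) else \<zero>"] by simp
  finally show ?thesis using assms by simp
qed

end

section \<open>Transposition over a commutative ring\<close>

context cring
begin

lemma transpose_closed [simp]:
  "A \<in> carrier (mat_monoid n R) \<Longrightarrow> transpose_mat A \<in> carrier (mat_monoid n R)"
  by (auto simp: carrier_mat_monoid_iff)

lemma transpose_entry [simp]:
  "A \<in> carrier (mat_monoid n R) \<Longrightarrow> i < n \<Longrightarrow> j < n \<Longrightarrow> transpose_mat A $$ (i, j) = A $$ (j, i)"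
  by (auto simp: carrier_mat_monoid_iff)

lemma transpose_mult:
  assumes "A \<in> carrier (mat_monoid n R)" "B \<in> carrier (mat_monoid n R)"
  shows "transpose_mat (A \<otimes>\<^bsub>mat_monoid n R\<^esub> B)
    = transpose_mat B \<otimes>\<^bsub>mat_monoid n R\<^esub> transpose_mat A"
proof -
  interpret M: monoid "mat_monoid n R" by (rule monoid_mat_monoid)
  show ?thesis
    using assms by (intro mat_monoid_eqI[of _ n])
      (auto intro!: finsum_cong' simp: m_comm transpose_entry[of _ n])
qed

lemma transpose_one: "transpose_mat \<one>\<^bsub>mat_monoid n R\<^esub> = \<one>\<^bsub>mat_monoid n R\<^esub>"
proof -
  interpret M: monoid "mat_monoid n R" by (rule monoid_mat_monoid)
  show ?thesis by (intro mat_monoid_eqI[of _ n]) (auto simp: transpose_entry[of _ n])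
qed

end

section \<open>Invertible matrices and centralizers of diagonal matrices over a field\<close>

context field
begin

text \<open>With an inverse \<open>B\<close>, the entry \<open>(i, i)\<close> of \<open>A B\<close>
  is one, whereas a zero row of \<open>A\<close> would make it zero. This stands in for
  determinants.\<close>

lemma Units_mat_row:
  assumes "A \<in> Units (mat_monoid n R)" "i < n"
  obtains j where "j < n" "A $$ (i, j) \<noteq> \<zero>"
proof -
  interpret M: monoid "mat_monoid n R" by (rule monoid_mat_monoid)
  obtain B where B: "B \<in> carrier (mat_monoid n R)" "A \<otimes>\<^bsub>mat_monoid n R\<^esub> B = \<one>\<^bsub>mat_monoid n R\<^esub>"
    using assms unfolding Units_def by blast
  have "(\<Oplus>k\<in>{..<n}. A $$ (i, k) \<otimes> B $$ (k, i)) = \<one>"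
    using arg_cong[OF B(2), of "\<lambda>A. A $$ (i, i)"] assms(2) by simp
  moreover have "(\<Oplus>k\<in>{..<n}. A $$ (i, k) \<otimes> B $$ (k, i)) = \<zero>" if "\<And>j. j < n \<Longrightarrow> A $$ (i, j) = \<zero>"
    using that B(1) assms(2) by (intro add.finprod_one_eqI) auto
  ultimately show thesis using that by force
qed

lemma dmat_Units_iff:
  assumes "\<And>i. i < n \<Longrightarrow> t i \<in> carrier R"
  shows "dmat n t \<in> Units (mat_monoid n R) \<longleftrightarrow> (\<forall>i<n. t i \<noteq> \<zero>)"
proof
  assume u: "dmat n t \<in> Units (mat_monoid n R)"
  show "\<forall>i<n. t i \<noteq> \<zero>"
  proof (intro allI impI)
    fix i assume "i < n"
    with Units_mat_row[OF u] obtain j where "j < n" "dmat n t $$ (i, j) \<noteq> \<zero>" by metis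
    then show "t i \<noteq> \<zero>" using \<open>i < n\<close> by (auto split: if_splits)
  qed
next
  interpret M: monoid "mat_monoid n R" by (rule monoid_mat_monoid)
  assume nz: "\<forall>i<n. t i \<noteq> \<zero>"
  have u: "t i \<in> Units R" if "i < n" for i using nz assms that by (simp add: field_Units)
  have t: "dmat n t \<in> carrier (mat_monoid n R)" "dmat n (\<lambda>i. inv t i) \<in> carrier (mat_monoid n R)"
    using assms u by auto
  have "dmat n t \<otimes>\<^bsub>mat_monoid n R\<^esub> dmat n (\<lambda>i. inv t i) = \<one>\<^bsub>mat_monoid n R\<^esub>"
    "dmat n (\<lambda>i. inv t i) \<otimes>\<^bsub>mat_monoid n R\<^esub> dmat n t = \<one>\<^bsub>mat_monoid n R\<^esub>"
    using t assms u by (auto intro!: mat_monoid_eqI[of _ n] simp: dmat_mult_entry simp del: mat_monoid_entry(1))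
  then show "dmat n t \<in> Units (mat_monoid n R)" using t unfolding Units_def by auto
qed

lemma pmat_Units:
  assumes w: "w permutes {..<n}"
  shows "pmat n w \<in> Units (mat_monoid n R)"
proof -
  interpret M: monoid "mat_monoid n R" by (rule monoid_mat_monoid)
  have *: "pmat n v \<otimes>\<^bsub>mat_monoid n R\<^esub> pmat n (inv_into UNIV v) = \<one>\<^bsub>mat_monoid n R\<^esub>" if v: "v permutes {..<n}" for v
  proof (rule mat_monoid_eqI)
    fix i j assume ij: "i < n" "j < n"
    have "v i < n" using permutes_in_image[OF v, of i] ij by auto
    then show "(pmat n v \<otimes>\<^bsub>mat_monoid n R\<^esub> pmat n (inv_into UNIV v)) $$ (i, j) = \<one>\<^bsub>mat_monoid n R\<^esub> $$ (i, j)"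
      using ij permutes_inverses[OF v] by (subst pmat_mult_entry) auto
  qed auto
  have "inv_into UNIV (inv_into UNIV w) = w" using w by (simp add: permutes_inv_inv)
  then show ?thesis using *[OF w] *[OF permutes_inv[OF w]] unfolding Units_def by auto
qed

lemma emat_Units:
  assumes "\<And>i. i < n \<Longrightarrow> l i \<in> carrier R" "l m = \<zero>" "m < n"
  shows "emat n m l \<in> Units (mat_monoid n R)"
proof -
  interpret M: monoid "mat_monoid n R" by (rule monoid_mat_monoid)
  have *: "emat n m l \<otimes>\<^bsub>mat_monoid n R\<^esub> emat n m (\<lambda>i. \<ominus> l i) = \<one>\<^bsub>mat_monoid n R\<^esub>"
    if l: "\<And>i. i < n \<Longrightarrow> l i \<in> carrier R" "l m = \<zero>" for l
    using l assms(3) by (intro mat_monoid_eqI[of _ n])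
     (auto simp: emat_mult_entry l_neg simp del: mat_monoid_entry(1))
  \<comment> \<open>The identity \<open>*\<close> for the negated column supplies the left inverse,
    once \<open>l\<close> is recognized as its double negation on the indices below
    \<open>n\<close>.\<close>
  have "emat n m l = emat n m (\<lambda>i. \<ominus> (\<ominus> l i))" using assms unfolding emat_def by (intro cong_mat) auto
  then show ?thesis using *[of l] *[of "\<lambda>i. \<ominus> l i"] assms unfolding Units_def by force
qed

lemma dmat_inj: 
  assumes "dmat n s = dmat n t" "i < n" shows "s i = t i"
  using arg_cong[OF assms(1), of "\<lambda>A. A $$ (i, i)"] assms(2) by simp

lemma dmat_mult:
  assumes "\<And>i. i < n \<Longrightarrow> s i \<in> carrier R" "\<And>i. i < n \<Longrightarrow> t i \<in> carrier R"
  shows "dmat n s \<otimes>\<^bsub>mat_monoid n R\<^esub> dmat n t = dmat n (\<lambda>i. s i \<otimes> t i)"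
proof -
  interpret M: monoid "mat_monoid n R" by (rule monoid_mat_monoid)
  show ?thesis using assms by (intro mat_monoid_eqI[of _ n])
   (auto simp: dmat_mult_entry simp del: mat_monoid_entry(1))
qed

lemma pmat_dmat:
  assumes "\<And>i. i < n \<Longrightarrow> t i \<in> carrier R" "w permutes {..<n}"
  shows "pmat n w \<otimes>\<^bsub>mat_monoid n R\<^esub> dmat n t = dmat n (\<lambda>i. t (w i)) \<otimes>\<^bsub>mat_monoid n R\<^esub> pmat n w"
proof -
  interpret M: monoid "mat_monoid n R" by (rule monoid_mat_monoid)
  have w: "w i < n" if "i < n" for i using permutes_in_image[OF assms(2), of i] that by auto
  show ?thesis using assms(1) w
    by (intro mat_monoid_eqI[of _ n]) (auto simp: dmat_mult_entry pmat_mult_entry simp del: mat_monoid_entry(1))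
qed

text \<open>At a nonzero entry \<open>(i, j)\<close> of \<open>A\<close> the relation cancels to
  \<open>s i = t j\<close>. In this form conjugate diagonal matrices are seen to have the same
  eigenvalues.\<close>

lemma intertwiner_image_subset:
  assumes A: "A \<in> Units (mat_monoid n R)"
    and s: "\<And>i. i < n \<Longrightarrow> s i \<in> carrier R" and t: "\<And>i. i < n \<Longrightarrow> t i \<in> carrier R"
    and eq: "dmat n s \<otimes>\<^bsub>mat_monoid n R\<^esub> A = A \<otimes>\<^bsub>mat_monoid n R\<^esub> dmat n t"
  shows "s ` {..<n} \<subseteq> t ` {..<n}"
proof
  fix x assume "x \<in> s ` {..<n}"
  then obtain i where i: "i < n" "x = s i" by auto
  obtain j where j: "j < n" "A $$ (i, j) \<noteq> \<zero>" using Units_mat_row[OF A i(1)] by blast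
  have Ac: "A \<in> carrier (mat_monoid n R)" using A by (simp add: Units_def)
  have "s i \<otimes> A $$ (i, j) = t j \<otimes> A $$ (i, j)"
    using arg_cong[OF eq, of "\<lambda>A. A $$ (i, j)"] i j Ac s t by (simp add: dmat_mult_entry m_comm del: mat_monoid_entry(1))
  then have "s i = t j" using j i s t Ac by (subst (asm) m_rcancel) auto
  then show "x \<in> t ` {..<n}" using i j by auto
qed

text \<open>The entry \<open>(i, j)\<close> satisfies \<open>t i a = t j a\<close>, so it vanishes
  off the diagonal. This is the gain from regularity: anything commuting with a regular diagonal
  matrix, in particular a square root of it, is diagonal.\<close>

lemma commute_dmat:
  assumes A: "A \<in> carrier (mat_monoid n R)"
    and t: "\<And>i. i < n \<Longrightarrow> t i \<in> carrier R" "inj_on t {..<n}"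
    and eq: "dmat n t \<otimes>\<^bsub>mat_monoid n R\<^esub> A = A \<otimes>\<^bsub>mat_monoid n R\<^esub> dmat n t"
  shows "A = dmat n (\<lambda>i. A $$ (i, i))"
proof (rule mat_monoid_eqI)
  fix i j assume ij: "i < n" "j < n"
  have "t i \<otimes> A $$ (i, j) = t j \<otimes> A $$ (i, j)"
    using arg_cong[OF eq, of "\<lambda>A. A $$ (i, j)"] ij A t by (simp add: dmat_mult_entry m_comm del: mat_monoid_entry(1))
  moreover have "t i \<noteq> t j" if "i \<noteq> j" using t(2) ij that by (auto simp: inj_on_def)
  ultimately show "A $$ (i, j) = dmat n (\<lambda>i. A $$ (i, i)) $$ (i, j)"
    using ij t A m_rcancel[of "A $$ (i, j)" "t i" "t j"] by (cases "i = j") auto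
qed (use A in auto)

end

section \<open>Interpolation and Vandermonde matrices\<close>

context field
begin

text \<open>Polynomials are lists with the leading coefficient first, hence the reversal.\<close>

lemma eval_rev_map:
  assumes "\<And>i. i < m \<Longrightarrow> v i \<in> carrier R" "x \<in> carrier R"
  shows "eval (rev (map v [0..<m])) x = (\<Oplus>i\<in>{..<m}. v i \<otimes> x [^] i)"
  using assms(1)
proof (induction m)
  case (Suc m)
  have "(\<Oplus>i\<in>{..<Suc m}. v i \<otimes> x [^] i) = v m \<otimes> x [^] m \<oplus> (\<Oplus>i\<in>{..<m}. v i \<otimes> x [^] i)"
    unfolding lessThan_Suc using Suc.prems assms(2) by (subst finsum_insert) auto
  then show ?case using Suc by simp
qed simp

text \<open>The top coefficients may vanish, so the list becomes a polynomial only after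
  \<open>normalize\<close>; the one nonzero coefficient keeps it from becoming empty. Then the
  number of roots is at most the degree, which is below \<open>m\<close>.\<close>

lemma finite_poly_roots:
  assumes v: "\<And>i. i < m \<Longrightarrow> v i \<in> carrier R" and nz: "i < m" "v i \<noteq> \<zero>"
  shows "finite {x \<in> carrier R. (\<Oplus>i\<in>{..<m}. v i \<otimes> x [^] i) = \<zero>}"
    and "card {x \<in> carrier R. (\<Oplus>i\<in>{..<m}. v i \<otimes> x [^] i) = \<zero>} < m"
proof -
  define p where "p = rev (map v [0..<m])"
  have p: "set p \<subseteq> carrier R" using v by (auto simp: p_def)
  have "polynomial (carrier R) (normalize p)" using normalize_gives_polynomial[OF p] .
  then have np: "normalize p \<in> carrier (poly_ring R)" by (simp add: univ_poly_carrier)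
  have ne: "normalize p \<noteq> []"
  proof
    have nn: "set p \<subseteq> {\<zero>}" if "normalize p = []" for p
      using that by (induction p) (auto split: if_splits)
    assume "normalize p = []"
    then have "v i = \<zero>" using nn[of p] nz(1) by (force simp: p_def)
    then show False using nz by simp
  qed
  have "x \<in># roots (normalize p) \<longleftrightarrow> x \<in> carrier R \<and> (\<Oplus>i\<in>{..<m}. v i \<otimes> x [^] i) = \<zero>" for x
    using eval_rev_map[of m v x] eval_normalize[OF p, of x] v ne
    unfolding roots_mem_iff_is_root[OF np] is_root_def p_def[symmetric] by auto
  then have eq: "{x \<in> carrier R. (\<Oplus>i\<in>{..<m}. v i \<otimes> x [^] i) = \<zero>} = set_mset (roots (normalize p))" by blast
  show "finite {x \<in> carrier R. (\<Oplus>i\<in>{..<m}. v i \<otimes> x [^] i) = \<zero>}" unfolding eq by simp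
  have "card (set_mset (roots (normalize p))) \<le> size (roots (normalize p))"
    unfolding size_multiset_overloaded_eq card_eq_sum by (intro sum_mono) (simp add: Suc_le_eq)
  also have "\<dots> \<le> degree (normalize p)" by (rule size_roots_le_degree[OF np])
  also have "\<dots> < length (normalize p)" using ne by (cases "normalize p") auto
  also have "\<dots> \<le> m" using normalize_length_le[of p] by (simp add: p_def)
  finally show "card {x \<in> carrier R. (\<Oplus>i\<in>{..<m}. v i \<otimes> x [^] i) = \<zero>} < m" unfolding eq .
qed

lemma card_power_eq_le:
  assumes c: "c \<in> carrier R" and m: "(m::nat) > 0"
  shows "finite {x \<in> carrier R. x [^] m = c}" "card {x \<in> carrier R. x [^] m = c} \<le> m"
proof -
  \<comment> \<open>The coefficients of \<open>X^m - c\<close>.\<close>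
  define v where "v i = (if i = m then \<one> else if i = 0 then \<ominus> c else \<zero>)" for i
  have v: "v i \<in> carrier R" for i using c by (simp add: v_def)
  have "(\<Oplus>i\<in>{..<Suc m}. v i \<otimes> x [^] i) = \<zero> \<longleftrightarrow> x [^] m = c" if x: "x \<in> carrier R" for x
  proof -
    have "(\<Oplus>i\<in>{..<m}. v i \<otimes> x [^] i) = v 0 \<otimes> x [^] (0::nat)"
      using m v x c by (intro finsum_single) (auto simp: v_def)
    then have "(\<Oplus>i\<in>{..<Suc m}. v i \<otimes> x [^] i) = x [^] m \<oplus> \<ominus> c"
      unfolding lessThan_Suc using v x m c by (subst finsum_insert) (auto simp: v_def)
    then show ?thesis using c x by (metis a_minus_def nat_pow_closed r_right_minus_eq)
  qed
  then have eq: "{x \<in> carrier R. x [^] m = c} = {x \<in> carrier R. (\<Oplus>i\<in>{..<Suc m}. v i \<otimes> x [^] i) = \<zero>}"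
    by blast
  show "finite {x \<in> carrier R. x [^] m = c}" "card {x \<in> carrier R. x [^] m = c} \<le> m"
    unfolding eq using finite_poly_roots[of "Suc m" v m] v by (auto simp: v_def)
qed

text \<open>The product of the \<open>X - a\<close> over \<open>a\<close> in \<open>S\<close>,
  written in coefficients. It has \<open>card S + 1\<close> of them, so for \<open>n - 1\<close>
  roots they fill a row of an \<open>n\<close> by \<open>n\<close> matrix.\<close>

lemma ex_poly_with_roots:
  assumes "finite S" "S \<subseteq> carrier R"
  shows "\<exists>v. (\<forall>i. v i \<in> carrier R) \<and>
    (\<forall>x\<in>carrier R. (\<Oplus>i\<in>{..<Suc (card S)}. v i \<otimes> x [^] i) = \<zero> \<longleftrightarrow> x \<in> S)"
  using assms
proof (induction S rule: finite_induct)
  case empty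
  then show ?case by (intro exI[of _ "\<lambda>_. \<one>"]) (simp add: lessThan_Suc)
next
  case (insert a S)
  define m where "m = card S"
  obtain v where v: "\<And>i. v i \<in> carrier R"
    and r: "\<And>x. x \<in> carrier R \<Longrightarrow> (\<Oplus>i\<in>{..<Suc m}. v i \<otimes> x [^] i) = \<zero> \<longleftrightarrow> x \<in> S"
    using insert by (auto simp: m_def)
  have a: "a \<in> carrier R" using insert by simp
  \<comment> \<open>\<open>w1\<close> is \<open>X\<close> times the old polynomial and
    \<open>w2\<close> is \<open>- a\<close> times it, each padded by one zero coefficient.\<close>
  define w1 where "w1 i = (if i = 0 then \<zero> else v (i - 1))" for i
  define w2 where "w2 i = (if i = Suc m then \<zero> else \<ominus> a \<otimes> v i)" for i
  have w: "w1 i \<in> carrier R" "w2 i \<in> carrier R" for i using a v by (auto simp: w1_def w2_def)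
  have "(\<Oplus>i\<in>{..<Suc (Suc m)}. (w1 i \<oplus> w2 i) \<otimes> x [^] i) = (x \<ominus> a) \<otimes> (\<Oplus>i\<in>{..<Suc m}. v i \<otimes> x [^] i)"
    if x: "x \<in> carrier R" for x
  proof -
    have "(\<Oplus>i\<in>{..<Suc (Suc m)}. w1 i \<otimes> x [^] i) = (\<Oplus>i\<in>{..Suc m}. w1 i \<otimes> x [^] i)"
      by (simp add: lessThan_Suc_atMost)
    also have "\<dots> = (\<Oplus>i\<in>{..m}. w1 (Suc i) \<otimes> x [^] Suc i) \<oplus> w1 0 \<otimes> x [^] (0::nat)"
      using x w by (intro finsum_Suc2) auto
    also have "\<dots> = (\<Oplus>i\<in>{..m}. x \<otimes> (v i \<otimes> x [^] i))"
      using x v by (auto simp: w1_def m_ac intro!: finsum_cong' finsum_closed)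
    also have "\<dots> = x \<otimes> (\<Oplus>i\<in>{..<Suc m}. v i \<otimes> x [^] i)"
      using x v by (simp add: finsum_rdistr lessThan_Suc_atMost)
    finally have 1: "(\<Oplus>i\<in>{..<Suc (Suc m)}. w1 i \<otimes> x [^] i) = x \<otimes> (\<Oplus>i\<in>{..<Suc m}. v i \<otimes> x [^] i)" .
    have "(\<Oplus>i\<in>{..<Suc (Suc m)}. w2 i \<otimes> x [^] i) = (\<Oplus>i\<in>{..<Suc m}. w2 i \<otimes> x [^] i)"
      unfolding lessThan_Suc[of "Suc m"] using x w w2_def[of "Suc m"] by (subst finsum_insert) (auto intro!: finsum_closed)
    also have "\<dots> = (\<Oplus>i\<in>{..<Suc m}. \<ominus> a \<otimes> (v i \<otimes> x [^] i))"
      using x v a by (intro finsum_cong') (auto simp: w2_def m_assoc)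
    also have "\<dots> = \<ominus> a \<otimes> (\<Oplus>i\<in>{..<Suc m}. v i \<otimes> x [^] i)"
      using x v a by (intro finsum_rdistr[symmetric]) auto
    finally have 2: "(\<Oplus>i\<in>{..<Suc (Suc m)}. w2 i \<otimes> x [^] i) = \<ominus> a \<otimes> (\<Oplus>i\<in>{..<Suc m}. v i \<otimes> x [^] i)" .
    have "(\<Oplus>i\<in>{..<Suc (Suc m)}. (w1 i \<oplus> w2 i) \<otimes> x [^] i)
      = (\<Oplus>i\<in>{..<Suc (Suc m)}. w1 i \<otimes> x [^] i \<oplus> w2 i \<otimes> x [^] i)"
      using w x by (intro finsum_cong') (auto simp: l_distr)
    also have "\<dots> = (\<Oplus>i\<in>{..<Suc (Suc m)}. w1 i \<otimes> x [^] i) \<oplus> (\<Oplus>i\<in>{..<Suc (Suc m)}. w2 i \<otimes> x [^] i)"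
      using w x by (intro finsum_addf) auto
    also have "\<dots> = (x \<ominus> a) \<otimes> (\<Oplus>i\<in>{..<Suc m}. v i \<otimes> x [^] i)"
      unfolding 1 2 a_minus_def using x a v by (intro l_distr[symmetric]) (auto intro!: finsum_closed)
    finally show ?thesis .
  qed
  moreover have "(\<Oplus>i\<in>{..<Suc m}. v i \<otimes> x [^] i) \<in> carrier R" if "x \<in> carrier R" for x
    using that v by (intro finsum_closed) auto
  ultimately have "(\<Oplus>i\<in>{..<Suc (Suc m)}. (w1 i \<oplus> w2 i) \<otimes> x [^] i) = \<zero> \<longleftrightarrow> x \<in> insert a S"
    if "x \<in> carrier R" for x
    using that a r[of x] by (auto simp: integral_iff)
  then show ?case using w insert by (intro exI[of _ "\<lambda>i. w1 i \<oplus> w2 i"]) (auto simp: m_def)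
qed

text \<open>The points index the columns, so that a permutation of the points is a multiplication by
  \<open>pmat\<close> on the right.\<close>

definition vmat :: "nat \<Rightarrow> (nat \<Rightarrow> 'a) \<Rightarrow> 'a mat"
  where "vmat n t = mat n n (\<lambda>(i, j). t j [^] i)"

lemma vmat_entry [simp]: "i < n \<Longrightarrow> j < n \<Longrightarrow> vmat n t $$ (i, j) = t j [^] i"
  by (simp add: vmat_def)

lemma vmat_closed [simp]: "(\<And>i. i < n \<Longrightarrow> t i \<in> carrier R) \<Longrightarrow> vmat n t \<in> carrier (mat_monoid n R)"
  unfolding vmat_def by (rule mat_in_mat_monoid) auto

text \<open>The coefficients of the Lagrange polynomials at the points \<open>t l\<close> form a
  left inverse \<open>C\<close>. It is a right inverse too: \<open>D = V C\<close> satisfies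
  \<open>D V = V\<close>, so each row of \<open>D - 1\<close> is a polynomial with \<open>n\<close>
  coefficients and the \<open>n\<close> roots \<open>t l\<close>, hence zero.\<close>

lemma vmat_Units:
  assumes t: "\<And>i. i < n \<Longrightarrow> t i \<in> carrier R" "inj_on t {..<n}"
  shows "vmat n t \<in> Units (mat_monoid n R)"
proof -
  interpret M: monoid "mat_monoid n R" by (rule monoid_mat_monoid)
  let ?M = "mat_monoid n R" and ?V = "vmat n t"
  have "\<exists>c. (\<forall>i. c i \<in> carrier R) \<and> (\<forall>l<n. (\<Oplus>i\<in>{..<n}. c i \<otimes> t l [^] i) = (if j = l then \<one> else \<zero>))"
    if j: "j < n" for j
  proof -
    define S where "S = t ` ({..<n} - {j})"
    have S: "finite S" "S \<subseteq> carrier R" using t by (auto simp: S_def)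
    have "inj_on t ({..<n} - {j})" using t(2) by (rule inj_on_subset) auto
    then have cS: "Suc (card S) = n" using j by (simp add: S_def card_image)
    obtain v where v: "\<And>i. v i \<in> carrier R"
      and r: "\<And>x. x \<in> carrier R \<Longrightarrow> (\<Oplus>i\<in>{..<n}. v i \<otimes> x [^] i) = \<zero> \<longleftrightarrow> x \<in> S"
      using ex_poly_with_roots[OF S] unfolding cS by blast
    define y where "y = (\<Oplus>i\<in>{..<n}. v i \<otimes> t j [^] i)"
    have "t j \<notin> S" using t(2) j by (auto simp: S_def inj_on_def)
    then have y: "y \<in> Units R" using v r[of "t j"] t j by (auto simp: y_def field_Units intro!: finsum_closed)
    have "(\<Oplus>i\<in>{..<n}. inv y \<otimes> v i \<otimes> t l [^] i) = (if j = l then \<one> else \<zero>)" if l: "l < n" for l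
    proof -
      have "(\<Oplus>i\<in>{..<n}. inv y \<otimes> v i \<otimes> t l [^] i) = (\<Oplus>i\<in>{..<n}. inv y \<otimes> (v i \<otimes> t l [^] i))"
        using v t l y by (intro finsum_cong') (auto simp: m_assoc)
      also have "\<dots> = inv y \<otimes> (\<Oplus>i\<in>{..<n}. v i \<otimes> t l [^] i)"
        using v t l y by (intro finsum_rdistr[symmetric]) auto
      also have "\<dots> = (if j = l then \<one> else \<zero>)"
      proof (cases "j = l")
        case True
        then show ?thesis using y unfolding True[symmetric] y_def[symmetric] by simp
      next
        case False
        then have "(\<Oplus>i\<in>{..<n}. v i \<otimes> t l [^] i) = \<zero>" using r[of "t l"] l t by (auto simp: S_def)
        then show ?thesis using False y by simp
      qed
      finally show ?thesis .
    qed
    then show ?thesis using v y by (intro exI[of _ "\<lambda>i. inv y \<otimes> v i"]) auto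
  qed
  then obtain c where c: "\<And>j i. j < n \<Longrightarrow> c j i \<in> carrier R"
    "\<And>j l. j < n \<Longrightarrow> l < n \<Longrightarrow> (\<Oplus>i\<in>{..<n}. c j i \<otimes> t l [^] i) = (if j = l then \<one> else \<zero>)"
    by metis
  define C where "C = mat n n (\<lambda>(j, i). c j i)"
  have C: "C \<in> carrier ?M" unfolding C_def using c by (intro mat_in_mat_monoid) auto
  have V: "?V \<in> carrier ?M" using t by simp
  have CV: "C \<otimes>\<^bsub>?M\<^esub> ?V = \<one>\<^bsub>?M\<^esub>"
  proof (rule mat_monoid_eqI)
    fix j l assume jl: "j < n" "l < n"
    have "(C \<otimes>\<^bsub>?M\<^esub> ?V) $$ (j, l) = (\<Oplus>i\<in>{..<n}. c j i \<otimes> t l [^] i)"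
      unfolding mat_monoid_entry(1)[OF jl] using jl c t by (intro finsum_cong') (auto simp: C_def)
    then show "(C \<otimes>\<^bsub>?M\<^esub> ?V) $$ (j, l) = \<one>\<^bsub>?M\<^esub> $$ (j, l)" using c jl by simp
  qed (use C V in auto)
  define D where "D = ?V \<otimes>\<^bsub>?M\<^esub> C"
  have D: "D \<in> carrier ?M" using C V by (simp add: D_def)
  have DV: "D \<otimes>\<^bsub>?M\<^esub> ?V = ?V" using C V CV by (simp add: D_def M.m_assoc)
  have "D = \<one>\<^bsub>?M\<^esub>"
  proof (rule mat_monoid_eqI)
    fix i k assume ik: "i < n" "k < n"
    let ?o = "\<lambda>k. if i = k then \<one> else \<zero>"
    define d where "d k = D $$ (i, k) \<ominus> ?o k" for k
    have d: "d k \<in> carrier R" if "k < n" for k using that D ik by (auto simp: d_def)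
    have root: "(\<Oplus>k\<in>{..<n}. d k \<otimes> t l [^] k) = \<zero>" if l: "l < n" for l
    proof -
      have eq: "d k \<otimes> t l [^] k = D $$ (i, k) \<otimes> t l [^] k \<oplus> \<ominus> ?o k \<otimes> t l [^] k" if "k < n" for k
        using that D l t ik unfolding d_def a_minus_def by (intro l_distr) auto
      have "(\<Oplus>k\<in>{..<n}. d k \<otimes> t l [^] k) = (\<Oplus>k\<in>{..<n}. D $$ (i, k) \<otimes> t l [^] k \<oplus> \<ominus> ?o k \<otimes> t l [^] k)"
        using D l t ik by (intro finsum_cong') (auto simp: eq)
      also have "\<dots> = (\<Oplus>k\<in>{..<n}. D $$ (i, k) \<otimes> t l [^] k) \<oplus> (\<Oplus>k\<in>{..<n}. \<ominus> ?o k \<otimes> t l [^] k)"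
        using D l t ik by (intro finsum_addf) auto
      also have "(\<Oplus>k\<in>{..<n}. \<ominus> ?o k \<otimes> t l [^] k) = \<ominus> ?o i \<otimes> t l [^] i"
        using ik l t by (intro finsum_single) auto
      also have "(\<Oplus>k\<in>{..<n}. D $$ (i, k) \<otimes> t l [^] k) = (D \<otimes>\<^bsub>?M\<^esub> ?V) $$ (i, l)"
        unfolding mat_monoid_entry(1)[OF ik(1) l] using ik l t D by (intro finsum_cong') auto
      finally show ?thesis unfolding DV using ik l t by (simp add: r_neg l_minus)
    qed
    have "d k = \<zero>"
    proof (rule ccontr)
      assume "d k \<noteq> \<zero>"
      let ?Z = "{x \<in> carrier R. (\<Oplus>k\<in>{..<n}. d k \<otimes> x [^] k) = \<zero>}"
      have Z: "finite ?Z" "card ?Z < n" using finite_poly_roots[of n d k] d ik(2) \<open>d k \<noteq> \<zero>\<close> by auto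
      have "t ` {..<n} \<subseteq> ?Z" using root t by auto
      then have "card (t ` {..<n}) \<le> card ?Z" using Z by (intro card_mono) auto
      then show False using Z t(2) by (simp add: card_image)
    qed
    then show "D $$ (i, k) = \<one>\<^bsub>?M\<^esub> $$ (i, k)"
      using ik D unfolding d_def by (auto split: if_splits)
  qed (use D in auto)
  then show ?thesis using C V CV unfolding D_def Units_def by blast
qed

end

section \<open>Frobenius maps and Hermitian matrices\<close>

lemma (in field) pow_nonzero: "x \<in> carrier R \<Longrightarrow> x \<noteq> \<zero> \<Longrightarrow> x [^] (m::nat) \<noteq> \<zero>"
  by (induction m) (auto simp: integral_iff)

locale frobenius_field = algebraically_closed L for L (structure) +
  fixes p e q :: nat
  assumes prime_p: "Factorial_Ring.prime p" and char: "[p] \<cdot> \<one> = \<zero>"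
    and e_pos: "e > 0" and q_def: "q = p ^ e" and odd_q: "odd q"
begin

lemma q_gt_1: "q > 1"
  using prime_p e_pos unfolding q_def by (metis prime_gt_1_nat one_less_power)

lemma frob_add:
  "x \<in> carrier L \<Longrightarrow> y \<in> carrier L \<Longrightarrow> (x \<oplus> y) [^] q = x [^] q \<oplus> y [^] q"
  unfolding q_def by (rule freshman[OF prime_p char])

lemma frob_zero [simp]: "\<zero> [^] q = \<zero>"
  using q_gt_1 by (simp add: nat_pow_zero)

lemma frob_minus: "x \<in> carrier L \<Longrightarrow> (\<ominus> x) [^] q = \<ominus> (x [^] q)"
  using frob_add[of "\<ominus> x" x] by (simp add: l_neg minus_equality)

lemma frob_inv: "x \<in> Units L \<Longrightarrow> (inv x) [^] q = inv (x [^] q)"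
  using nat_pow_distrib[of x "inv x" q] by (intro comm_inv_char[symmetric]) auto

lemma frob_finsum:
  assumes "finite A" "\<And>i. i \<in> A \<Longrightarrow> f i \<in> carrier L"
  shows "(\<Oplus>i\<in>A. f i) [^] q = (\<Oplus>i\<in>A. f i [^] q)"
  using assms
proof (induction A rule: finite_induct)
  case (insert a A)
  then show ?case by (subst (1 2) finsum_insert) (auto simp: frob_add intro!: finsum_closed)
qed simp

text \<open>With \<open>p = 2 m + 1\<close>, the element \<open>p x = 0\<close> is \<open>m\<close>
  times \<open>2 x = 0\<close> plus \<open>x\<close>. Odd characteristic acts on the rest of the
  proof through this lemma.\<close>

lemma double_eq_zero:
  assumes "x \<in> carrier L" "x \<oplus> x = \<zero>"
  shows "x = \<zero>"
proof -
  have "odd p" using odd_q e_pos unfolding q_def by simp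
  then obtain m where m: "p = 2 * m + 1" by (rule oddE)
  have even: "[(2 * k)] \<cdot> x = \<zero>" for k :: nat
    using assms by (induction k) (auto simp: a_assoc)
  have "[p] \<cdot> x = [p] \<cdot> \<one> \<otimes> x" using assms by (simp add: add_pow_ldistr)
  then have "[p] \<cdot> x = \<zero>" using char assms by simp
  then show ?thesis unfolding m using even[of m] assms by simp
qed

lemma minus_one_neq_one: "\<ominus> \<one> \<noteq> \<one>"
  using double_eq_zero[of \<one>] by (metis l_neg one_closed one_not_zero)

lemma ex_nth_root:
  assumes c: "c \<in> carrier L" and m: "(m::nat) > 0"
  obtains x where "x \<in> carrier L" "x [^] m = c"
proof -
  define v where "v i = (if i = m then \<one> else if i = 0 then \<ominus> c else \<zero>)" for i
  define P where "P = rev (map v [0..<Suc m])"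
  have v: "v i \<in> carrier L" for i using c by (simp add: v_def)
  have deg: "degree P = m" by (simp add: P_def)
  have "polynomial (carrier L) P" using v c by (auto simp: P_def polynomial_def v_def)
  then have P: "P \<in> carrier (poly_ring L)" by (simp add: univ_poly_carrier)
  have "size (roots P) = m" using roots_over_carrier[OF P] deg unfolding splitted_def by simp
  then obtain x where "x \<in># roots P" using m by fastforce
  then have x: "x \<in> carrier L" "eval P x = \<zero>" using roots_mem_iff_is_root[OF P] by (auto simp: is_root_def)
  have "(\<Oplus>i\<in>{..<m}. v i \<otimes> x [^] i) = v 0 \<otimes> x [^] (0::nat)"
    using m v x c by (intro finsum_single) (auto simp: v_def)
  then have "(\<Oplus>i\<in>{..<Suc m}. v i \<otimes> x [^] i) = x [^] m \<oplus> \<ominus> c"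
    unfolding lessThan_Suc using v x m c by (subst finsum_insert) (auto simp: v_def)
  then have "x [^] m \<ominus> c = \<zero>" using eval_rev_map[of "Suc m" v x] v x unfolding P_def a_minus_def by simp
  then show thesis using that[of x] x c by simp
qed

section \<open>The Frobenius map and the conjugate transpose on matrices\<close>

definition frob_mat :: "'a mat \<Rightarrow> 'a mat"
  where "frob_mat A = map_mat (\<lambda>a. a [^] q) A"

text \<open>The conjugation \<open>x^q\<close> has order two only on the field with
  \<open>q^2\<close> elements; over the algebraic closure, applying this map twice is the
  \<open>q^2\<close>-power map on entries.\<close>

definition conj_transpose :: "'a mat \<Rightarrow> 'a mat"
  where "conj_transpose A = transpose_mat (frob_mat A)"

lemma frob_mat_closed [simp]:
  "A \<in> carrier (mat_monoid n L) \<Longrightarrow> frob_mat A \<in> carrier (mat_monoid n L)"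
  by (auto simp: carrier_mat_monoid_iff frob_mat_def)

lemma frob_mat_entry [simp]:
  "A \<in> carrier (mat_monoid n L) \<Longrightarrow> i < n \<Longrightarrow> j < n \<Longrightarrow> frob_mat A $$ (i, j) = A $$ (i, j) [^] q"
  by (auto simp: carrier_mat_monoid_iff frob_mat_def)

lemma frob_mat_mult:
  assumes "A \<in> carrier (mat_monoid n L)" "B \<in> carrier (mat_monoid n L)"
  shows "frob_mat (A \<otimes>\<^bsub>mat_monoid n L\<^esub> B) = frob_mat A \<otimes>\<^bsub>mat_monoid n L\<^esub> frob_mat B"
proof -
  interpret M: monoid "mat_monoid n L" by (rule monoid_mat_monoid)
  show ?thesis
  proof (rule mat_monoid_eqI)
    fix i j assume ij: "i < n" "j < n"
    have "frob_mat (A \<otimes>\<^bsub>mat_monoid n L\<^esub> B) $$ (i, j) = (\<Oplus>k\<in>{..<n}. A $$ (i, k) \<otimes> B $$ (k, j)) [^] q"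
      using assms ij by (simp add: frob_mat_entry[of _ n])
    also have "\<dots> = (\<Oplus>k\<in>{..<n}. (A $$ (i, k) \<otimes> B $$ (k, j)) [^] q)"
      using assms ij by (intro frob_finsum) auto
    also have "\<dots> = (\<Oplus>k\<in>{..<n}. frob_mat A $$ (i, k) \<otimes> frob_mat B $$ (k, j))"
      using assms ij by (intro finsum_cong') (auto simp: nat_pow_distrib frob_mat_entry[of _ n])
    finally show "frob_mat (A \<otimes>\<^bsub>mat_monoid n L\<^esub> B) $$ (i, j)
      = (frob_mat A \<otimes>\<^bsub>mat_monoid n L\<^esub> frob_mat B) $$ (i, j)"
      using ij by simp
  qed (use assms in auto)
qed

lemma frob_mat_one: "frob_mat \<one>\<^bsub>mat_monoid n L\<^esub> = \<one>\<^bsub>mat_monoid n L\<^esub>"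
proof -
  interpret M: monoid "mat_monoid n L" by (rule monoid_mat_monoid)
  show ?thesis by (intro mat_monoid_eqI[of _ n]) (auto simp: frob_mat_entry[of _ n])
qed

lemma frob_mat_Units:
  assumes "A \<in> Units (mat_monoid n L)"
  shows "frob_mat A \<in> Units (mat_monoid n L)"
proof -
  obtain B where "A \<in> carrier (mat_monoid n L)" "B \<in> carrier (mat_monoid n L)"
    "A \<otimes>\<^bsub>mat_monoid n L\<^esub> B = \<one>\<^bsub>mat_monoid n L\<^esub>" "B \<otimes>\<^bsub>mat_monoid n L\<^esub> A = \<one>\<^bsub>mat_monoid n L\<^esub>"
    using assms unfolding Units_def by auto
  then show ?thesis unfolding Units_def
    by (auto simp: frob_mat_mult[symmetric] frob_mat_one intro!: bexI[of _ "frob_mat B"])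
qed

lemma conj_transpose_closed [simp]:
  "A \<in> carrier (mat_monoid n L) \<Longrightarrow> conj_transpose A \<in> carrier (mat_monoid n L)"
  by (simp add: conj_transpose_def)

lemma conj_transpose_entry [simp]:
  "A \<in> carrier (mat_monoid n L) \<Longrightarrow> i < n \<Longrightarrow> j < n \<Longrightarrow> conj_transpose A $$ (i, j) = A $$ (j, i) [^] q"
  by (simp add: conj_transpose_def transpose_entry[of _ n])

lemma conj_transpose_mult:
  assumes "A \<in> carrier (mat_monoid n L)" "B \<in> carrier (mat_monoid n L)"
  shows "conj_transpose (A \<otimes>\<^bsub>mat_monoid n L\<^esub> B)
    = conj_transpose B \<otimes>\<^bsub>mat_monoid n L\<^esub> conj_transpose A"
  using assms by (simp add: conj_transpose_def frob_mat_mult transpose_mult)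

lemma conj_transpose_one: "conj_transpose \<one>\<^bsub>mat_monoid n L\<^esub> = \<one>\<^bsub>mat_monoid n L\<^esub>"
  by (simp add: conj_transpose_def frob_mat_one transpose_one)

lemma conj_transpose_Units:
  assumes "A \<in> Units (mat_monoid n L)"
  shows "conj_transpose A \<in> Units (mat_monoid n L)"
proof -
  obtain B where "A \<in> carrier (mat_monoid n L)" "B \<in> carrier (mat_monoid n L)"
    "A \<otimes>\<^bsub>mat_monoid n L\<^esub> B = \<one>\<^bsub>mat_monoid n L\<^esub>" "B \<otimes>\<^bsub>mat_monoid n L\<^esub> A = \<one>\<^bsub>mat_monoid n L\<^esub>"
    using assms unfolding Units_def by auto
  then show ?thesis unfolding Units_def
    by (auto simp: conj_transpose_mult[symmetric] conj_transpose_one intro!: bexI[of _ "conj_transpose B"])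
qed

text \<open>The condition at \<open>(i, j)\<close> and at \<open>(j, i)\<close> together puts all
  entries into the field with \<open>q^2\<close> elements, where this is the usual notion.\<close>

definition hermitian :: "nat \<Rightarrow> 'a mat \<Rightarrow> bool"
  where "hermitian n A \<longleftrightarrow> A \<in> carrier (mat_monoid n L) \<and> (\<forall>i<n. \<forall>j<n. A $$ (i, j) [^] q = A $$ (j, i))"

text \<open>The matrix \<open>h\<close> ranges over the algebraic closure, where congruence does not
  preserve \<open>hermitian\<close>. The lemmas below therefore carry that property along
  separately.\<close>

definition congruent_mat :: "nat \<Rightarrow> 'a mat \<Rightarrow> 'a mat \<Rightarrow> bool"
  where "congruent_mat n A B \<longleftrightarrow> (\<exists>h\<in>Units (mat_monoid n L).
    B = h \<otimes>\<^bsub>mat_monoid n L\<^esub> A \<otimes>\<^bsub>mat_monoid n L\<^esub> conj_transpose h)"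

lemma congruent_mat_refl: "A \<in> carrier (mat_monoid n L) \<Longrightarrow> congruent_mat n A A"
proof -
  interpret M: monoid "mat_monoid n L" by (rule monoid_mat_monoid)
  show "A \<in> carrier (mat_monoid n L) \<Longrightarrow> congruent_mat n A A"
    unfolding congruent_mat_def
    by (intro bexI[of _ "\<one>\<^bsub>mat_monoid n L\<^esub>"]) (auto simp: conj_transpose_one)
qed

lemma congruent_mat_trans:
  assumes "A \<in> carrier (mat_monoid n L)" "congruent_mat n A B" "congruent_mat n B C"
  shows "congruent_mat n A C"
proof -
  interpret M: monoid "mat_monoid n L" by (rule monoid_mat_monoid)
  obtain g h where g: "g \<in> Units (mat_monoid n L)" "B = g \<otimes>\<^bsub>mat_monoid n L\<^esub> A \<otimes>\<^bsub>mat_monoid n L\<^esub> conj_transpose g"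
    and h: "h \<in> Units (mat_monoid n L)" "C = h \<otimes>\<^bsub>mat_monoid n L\<^esub> B \<otimes>\<^bsub>mat_monoid n L\<^esub> conj_transpose h"
    using assms by (auto simp: congruent_mat_def)
  then show ?thesis unfolding congruent_mat_def using assms(1)
    by (intro bexI[of _ "h \<otimes>\<^bsub>mat_monoid n L\<^esub> g"])
      (auto simp: conj_transpose_mult[of _ n] M.m_assoc M.Units_closed)
qed

lemma congruent_mat_Units:
  assumes "congruent_mat n A B" "A \<in> Units (mat_monoid n L)"
  shows "B \<in> Units (mat_monoid n L)"
proof -
  interpret M: monoid "mat_monoid n L" by (rule monoid_mat_monoid)
  show ?thesis using assms unfolding congruent_mat_def
    by (auto intro!: M.Units_m_closed conj_transpose_Units)
qed

text \<open>Adding \<open>l i\<close> times row \<open>m\<close> to row \<open>i\<close>, and likewise for the columns, is a congruence; it stays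
  within the Hermitian matrices if the \<open>l i\<close> lie in the field with \<open>q\<^sup>2\<close> elements.\<close>

lemma hermitian_emat_congruence:
  assumes A: "hermitian n A" and m: "m < n"
    and l: "\<And>i. i < n \<Longrightarrow> l i \<in> carrier L" "l m = \<zero>" "\<And>i. i < n \<Longrightarrow> (l i [^] q) [^] q = l i"
  obtains B where "congruent_mat n A B" "hermitian n B"
    "\<And>a b. a < n \<Longrightarrow> b < n \<Longrightarrow>
      B $$ (a, b) = A $$ (a, b) \<oplus> l a \<otimes> A $$ (m, b) \<oplus> l b [^] q \<otimes> (A $$ (a, m) \<oplus> l a \<otimes> A $$ (m, m))"
proof -
  interpret M: monoid "mat_monoid n L" by (rule monoid_mat_monoid)
  let ?M = "mat_monoid n L"
  define E where "E = emat n m l"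
  have E: "E \<in> Units ?M" "E \<in> carrier ?M" using emat_Units[of n l m] m l by (auto simp: E_def)
  have Ac: "A \<in> carrier ?M" and Ah: "\<And>i j. i < n \<Longrightarrow> j < n \<Longrightarrow> A $$ (i, j) [^] q = A $$ (j, i)"
    using A by (auto simp: hermitian_def)
  define B where "B = E \<otimes>\<^bsub>?M\<^esub> A \<otimes>\<^bsub>?M\<^esub> conj_transpose E"
  have B: "B \<in> carrier ?M" using E Ac by (simp add: B_def)
  have right: "(C \<otimes>\<^bsub>?M\<^esub> conj_transpose E) $$ (a, b) = C $$ (a, b) \<oplus> l b [^] q \<otimes> C $$ (a, m)"
    if "C \<in> carrier ?M" "a < n" "b < n" for C a b
  proof -
    \<comment> \<open>The factor on the right is reduced to one on the left by transposing, because
      the transpose of \<open>conj_transpose E\<close> is \<open>frob_mat E\<close>, again a Gauss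
      transformation.\<close>
    have fE: "frob_mat E = emat n m (\<lambda>i. l i [^] q)"
      using E(2) m l by (intro mat_monoid_eqI[of _ n]) (auto simp: E_def frob_mat_entry[of _ n])
    have tt: "transpose_mat (conj_transpose E) = frob_mat E"
      by (simp add: conj_transpose_def)
    have "(C \<otimes>\<^bsub>?M\<^esub> conj_transpose E) $$ (a, b) = transpose_mat (C \<otimes>\<^bsub>?M\<^esub> conj_transpose E) $$ (b, a)"
      using that E by (simp add: transpose_entry[of _ n] del: mat_monoid_entry)
    also have "\<dots> = (emat n m (\<lambda>i. l i [^] q) \<otimes>\<^bsub>?M\<^esub> transpose_mat C) $$ (b, a)"
      using that E by (simp add: transpose_mult[of _ n] tt fE del: mat_monoid_entry)
    also have "\<dots> = C $$ (a, b) \<oplus> l b [^] q \<otimes> C $$ (a, m)"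
      using that l m by (subst emat_mult_entry) (auto simp: transpose_entry[of _ n])
    finally show ?thesis .
  qed
  have left: "(E \<otimes>\<^bsub>?M\<^esub> A) $$ (a, b) = A $$ (a, b) \<oplus> l a \<otimes> A $$ (m, b)" if "a < n" "b < n" for a b
    unfolding E_def using that Ac l m by (intro emat_mult_entry) auto
  have entry: "B $$ (a, b) = A $$ (a, b) \<oplus> l a \<otimes> A $$ (m, b) \<oplus> l b [^] q \<otimes> (A $$ (a, m) \<oplus> l a \<otimes> A $$ (m, m))"
    if "a < n" "b < n" for a b
    using that E Ac m by (simp add: B_def right left del: mat_monoid_entry)
  have "B $$ (a, b) [^] q = B $$ (b, a)" if ab: "a < n" "b < n" for a b
  proof -
    have c: "A $$ (i, j) \<in> carrier L" if "i < n" "j < n" for i j using Ac that by simp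
    show ?thesis using ab m l c Ah
      by (simp add: entry frob_add nat_pow_distrib a_ac m_ac r_distr)
  qed
  then have "hermitian n B" using B by (simp add: hermitian_def)
  moreover have "congruent_mat n A B" using E unfolding congruent_mat_def B_def by blast
  ultimately show thesis using that entry by blast
qed

text \<open>If the diagonal entry \<open>r\<close> is zero, row \<open>r\<close> still has a nonzero
  entry \<open>b\<close> in some column \<open>j\<close>, and \<open>j > r\<close> because the
  earlier columns are already cleared. Adding \<open>b\<close> or \<open>- b\<close> times row
  \<open>j\<close> to row \<open>r\<close>, with the conjugate operation on columns, makes the
  diagonal entry nonzero. Rows above \<open>r\<close> have zero in column \<open>j\<close> and keep
  their zeros.\<close>

lemma hermitian_pivot:
  assumes A: "hermitian n A" "A \<in> Units (mat_monoid n L)" and r: "r < n"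
    and z: "\<And>a b. a < r \<Longrightarrow> b < n \<Longrightarrow> a \<noteq> b \<Longrightarrow> A $$ (a, b) = \<zero>"
  obtains B where "congruent_mat n A B" "hermitian n B" "B $$ (r, r) \<noteq> \<zero>"
    "\<And>a b. a < r \<Longrightarrow> b < n \<Longrightarrow> a \<noteq> b \<Longrightarrow> B $$ (a, b) = \<zero>"
proof (cases "A $$ (r, r) = \<zero>")
  case False
  then show thesis using that[of A] A z congruent_mat_refl by (auto simp: hermitian_def)
next
  case True
  have Ac: "A $$ (i, j) \<in> carrier L" and Ah: "A $$ (i, j) [^] q = A $$ (j, i)" if "i < n" "j < n" for i j
    using A that by (auto simp: hermitian_def)
  obtain j where j: "j < n" "A $$ (r, j) \<noteq> \<zero>" using Units_mat_row[OF A(2) r] by blast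
  have jr: "r < j"
  proof (rule ccontr)
    assume "\<not> r < j"
    then have "j < r" using True j by (cases "j = r") auto
    then have "A $$ (j, r) = \<zero>" using z r by auto
    then show False using Ah[of j r] j r by simp
  qed
  define b where "b = A $$ (r, j)"
  define s where "s = b \<otimes> b [^] q \<oplus> b \<otimes> b [^] q"
  define y where "y = b \<otimes> b [^] q \<otimes> A $$ (j, j)"
  have b: "b \<in> carrier L" "b \<noteq> \<zero>" "A $$ (j, r) = b [^] q" "(b [^] q) [^] q = b"
    using Ac[of r j] Ah[of r j] Ah[of j r] j r by (auto simp: b_def)
  have sy: "s \<in> carrier L" "y \<in> carrier L" using b Ac[of j j] j by (auto simp: s_def y_def)
  have "b \<otimes> b [^] q \<noteq> \<zero>" using b using pow_nonzero[of b q] by (auto simp: integral_iff)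
  then have s0: "s \<noteq> \<zero>" using b double_eq_zero[of "b \<otimes> b [^] q"] by (auto simp: s_def)
  \<comment> \<open>The two candidates for the new diagonal entry are \<open>y + s\<close> and
    \<open>y - s\<close>. They differ by \<open>2 s = 4 b b^q\<close>, so they cannot both
    vanish.\<close>
  have "\<exists>c. (c = b \<and> s \<oplus> y \<noteq> \<zero>) \<or> (c = \<ominus> b \<and> \<ominus> s \<oplus> y \<noteq> \<zero>)"
  proof (rule ccontr)
    assume "\<not> ?thesis"
    then have "s \<oplus> y = \<zero>" "\<ominus> s \<oplus> y = \<zero>" by auto
    then have "s \<oplus> s = \<zero>" using sy by (metis a_comm minus_equality minus_minus a_inv_closed)
    then show False using s0 sy double_eq_zero by blast
  qed
  then obtain c where c: "(c = b \<and> s \<oplus> y \<noteq> \<zero>) \<or> (c = \<ominus> b \<and> \<ominus> s \<oplus> y \<noteq> \<zero>)" by blast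
  then have cc: "c \<in> carrier L" "(c [^] q) [^] q = c" using b by (auto simp: frob_minus)
  define l where "l i = (if i = r then c else \<zero>)" for i
  have l: "l i \<in> carrier L" "l j = \<zero>" "(l i [^] q) [^] q = l i" for i
    using cc jr by (auto simp: l_def)
  obtain B where B: "congruent_mat n A B" "hermitian n B"
    "\<And>a b. a < n \<Longrightarrow> b < n \<Longrightarrow>
      B $$ (a, b) = A $$ (a, b) \<oplus> l a \<otimes> A $$ (j, b) \<oplus> l b [^] q \<otimes> (A $$ (a, j) \<oplus> l a \<otimes> A $$ (j, j))"
    using hermitian_emat_congruence[OF A(1) j(1), of l] l by blast
  have "B $$ (r, r) = c \<otimes> b [^] q \<oplus> c [^] q \<otimes> (b \<oplus> c \<otimes> A $$ (j, j))"
    using B(3)[of r r] r True b cc by (simp add: l_def b_def[symmetric])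
  also have "\<dots> \<noteq> \<zero>"
    using c
  proof
    assume "c = b \<and> s \<oplus> y \<noteq> \<zero>"
    moreover have "b \<otimes> b [^] q \<oplus> b [^] q \<otimes> (b \<oplus> b \<otimes> A $$ (j, j)) = s \<oplus> y"
      using b Ac[of j j] j by (simp add: s_def y_def r_distr a_ac m_ac)
    ultimately show ?thesis by simp
  next
    assume "c = \<ominus> b \<and> \<ominus> s \<oplus> y \<noteq> \<zero>"
    moreover have "\<ominus> b \<otimes> b [^] q \<oplus> (\<ominus> b) [^] q \<otimes> (b \<oplus> \<ominus> b \<otimes> A $$ (j, j)) = \<ominus> s \<oplus> y"
      using b Ac[of j j] j
      by (simp add: s_def y_def r_distr frob_minus l_minus r_minus minus_add a_ac m_ac)
    ultimately show ?thesis by simp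
  qed
  finally have "B $$ (r, r) \<noteq> \<zero>" .
  moreover have "B $$ (a, b) = \<zero>" if "a < r" "b < n" "a \<noteq> b" for a b
    using B(3)[of a b] that r z[of a b] z[of a j] j jr Ac[of j b] Ac[of j j] cc
    by (auto simp: l_def)
  ultimately show thesis using that B by blast
qed

text \<open>Gaussian elimination by congruences, with \<open>r\<close> rows finished. Clearing
  column \<open>r\<close> clears row \<open>r\<close> as well by the Hermitian symmetry.\<close>

lemma hermitian_diagonalize:
  assumes A: "hermitian n A" "A \<in> Units (mat_monoid n L)"
  shows "r \<le> n \<Longrightarrow> \<exists>B. congruent_mat n A B \<and> hermitian n B \<and>
    (\<forall>a b. a < r \<longrightarrow> b < n \<longrightarrow> a \<noteq> b \<longrightarrow> B $$ (a, b) = \<zero>)"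
proof (induction r)
  case 0
  then show ?case using A congruent_mat_refl by (auto simp: hermitian_def)
next
  case (Suc r)
  have Ac: "A \<in> carrier (mat_monoid n L)" using A by (simp add: hermitian_def)
  have r: "r < n" using Suc by simp
  obtain B where B: "congruent_mat n A B" "hermitian n B"
    "\<And>a b. a < r \<Longrightarrow> b < n \<Longrightarrow> a \<noteq> b \<Longrightarrow> B $$ (a, b) = \<zero>"
    using Suc by auto
  obtain C where C: "congruent_mat n B C" "hermitian n C" "C $$ (r, r) \<noteq> \<zero>"
    "\<And>a b. a < r \<Longrightarrow> b < n \<Longrightarrow> a \<noteq> b \<Longrightarrow> C $$ (a, b) = \<zero>"
    using hermitian_pivot[OF B(2) congruent_mat_Units[OF B(1) A(2)] r B(3)] by blast
  have Cc: "C $$ (i, j) \<in> carrier L" and Ch: "C $$ (i, j) [^] q = C $$ (j, i)" if "i < n" "j < n" for i j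
    using C that by (auto simp: hermitian_def)
  have u: "C $$ (r, r) \<in> Units L" using Cc r C(3) by (simp add: field_Units)
  have iu: "inv (C $$ (r, r)) [^] q = inv (C $$ (r, r))" using frob_inv[OF u] Ch r by simp
  \<comment> \<open>The usual elimination factors. The pivot is fixed by the \<open>q\<close>-power
    map, so they stay in the field with \<open>q^2\<close> elements, as
    \<open>hermitian_emat_congruence\<close> requires.\<close>
  define l where "l i = (if i = r then \<zero> else \<ominus> (C $$ (i, r) \<otimes> inv (C $$ (r, r))))" for i
  have lr: "l r = \<zero>" by (simp add: l_def)
  have l: "l i \<in> carrier L" "(l i [^] q) [^] q = l i" if "i < n" for i
    using that Cc u r iu Ch by (auto simp: l_def frob_minus nat_pow_distrib)
  obtain D where D: "congruent_mat n C D" "hermitian n D"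
    "\<And>a b. a < n \<Longrightarrow> b < n \<Longrightarrow>
      D $$ (a, b) = C $$ (a, b) \<oplus> l a \<otimes> C $$ (r, b) \<oplus> l b [^] q \<otimes> (C $$ (a, r) \<oplus> l a \<otimes> C $$ (r, r))"
    using hermitian_emat_congruence[OF C(2) r, of l] l lr by blast
  have col: "D $$ (a, r) = \<zero>" if "a < n" "a \<noteq> r" for a
  proof -
    have "l r = \<zero>" by (simp add: l_def)
    moreover have "C $$ (a, r) \<oplus> l a \<otimes> C $$ (r, r) = \<zero>"
      using that u Cc r by (simp add: l_def l_minus m_assoc r_neg)
    ultimately show ?thesis using D(3)[of a r] that r l(1)[of a] Cc by simp
  qed
  have "D $$ (a, b) = \<zero>" if ab: "a < Suc r" "b < n" "a \<noteq> b" for a b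
  proof (cases "a = r")
    case True
    then have "D $$ (b, r) [^] q = D $$ (r, b)" using D(2) ab r by (simp add: hermitian_def)
    then show ?thesis using True col[of b] ab by simp
  next
    case False
    then have a: "a < r" using ab by simp
    then have "l a = \<zero>" using C(4)[of a r] r u by (simp add: l_def)
    then show ?thesis using D(3)[of a b] C(4)[of a r] C(4)[of a b] a ab r l Cc by simp
  qed
  moreover have "congruent_mat n A D"
    using congruent_mat_trans[OF Ac congruent_mat_trans[OF Ac B(1) C(1)] D(1)] .
  ultimately show ?case using D(2) by (intro exI[of _ D]) simp
qed

text \<open>Every nondegenerate Hermitian form is congruent to the identity. After diagonalization a
  diagonal entry is written as \<open>c^(q+1) = c c^q\<close>, the root \<open>c\<close> being taken
  in the algebraically closed field.\<close>

lemma hermitian_factorization: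
  assumes K: "hermitian n K" "K \<in> Units (mat_monoid n L)"
  obtains h where "h \<in> Units (mat_monoid n L)" "K = h \<otimes>\<^bsub>mat_monoid n L\<^esub> conj_transpose h"
proof -
  interpret M: monoid "mat_monoid n L" by (rule monoid_mat_monoid)
  let ?M = "mat_monoid n L"
  obtain B where B: "congruent_mat n K B" "hermitian n B"
    "\<And>a b. a < n \<Longrightarrow> b < n \<Longrightarrow> a \<noteq> b \<Longrightarrow> B $$ (a, b) = \<zero>"
    using hermitian_diagonalize[OF K, of n] by auto
  have Bc: "B \<in> carrier ?M" using B by (simp add: hermitian_def)
  have Bu: "B \<in> Units ?M" using congruent_mat_Units[OF B(1) K(2)] .
  have Bd: "B = dmat n (\<lambda>i. B $$ (i, i))" using B(3) Bc by (intro mat_monoid_eqI[of _ n]) auto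
  have nz: "B $$ (i, i) \<noteq> \<zero>" if "i < n" for i
    using Bu Bd that dmat_Units_iff[of n "\<lambda>i. B $$ (i, i)"] Bc by auto
  have "\<exists>c. c \<in> carrier L \<and> c [^] (q + 1) = B $$ (i, i)" if "i < n" for i
    using ex_nth_root[of "B $$ (i, i)" "q + 1"] Bc that by (metis add_gr_0 less_one mat_monoid_entry_closed)
  then obtain c where c: "\<And>i. i < n \<Longrightarrow> c i \<in> carrier L" "\<And>i. i < n \<Longrightarrow> c i [^] (q + 1) = B $$ (i, i)"
    by metis
  have c0: "c i \<noteq> \<zero>" if "i < n" for i
    using nz[OF that] c(2)[OF that] by (auto simp: nat_pow_zero)
  define D where "D = dmat n c"
  have Du: "D \<in> Units ?M" unfolding D_def using c c0 dmat_Units_iff[of n c] by auto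
  have "conj_transpose D = dmat n (\<lambda>i. c i [^] q)"
    unfolding D_def using c by (intro mat_monoid_eqI[of _ n]) (auto simp: conj_transpose_entry[of _ n])
  then have "D \<otimes>\<^bsub>?M\<^esub> conj_transpose D = dmat n (\<lambda>i. c i \<otimes> c i [^] q)"
    unfolding D_def using c by (simp add: dmat_mult)
  also have "\<dots> = B"
    by (subst Bd, intro mat_monoid_eqI[of _ n]) (use c Bc in \<open>auto simp: m_comm\<close>)
  finally have DB: "D \<otimes>\<^bsub>?M\<^esub> conj_transpose D = B" .
  obtain g where g: "g \<in> Units ?M" "B = g \<otimes>\<^bsub>?M\<^esub> K \<otimes>\<^bsub>?M\<^esub> conj_transpose g"
    using B(1) by (auto simp: congruent_mat_def)
  define k where "k = inv\<^bsub>?M\<^esub> g"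
  have k: "k \<in> Units ?M" "k \<otimes>\<^bsub>?M\<^esub> g = \<one>\<^bsub>?M\<^esub>" using g by (auto simp: k_def)
  have ck: "conj_transpose g \<otimes>\<^bsub>?M\<^esub> conj_transpose k = \<one>\<^bsub>?M\<^esub>"
    using conj_transpose_mult[of k n g] k g by (simp add: M.Units_closed conj_transpose_one)
  have cl: "k \<in> carrier ?M" "g \<in> carrier ?M" "K \<in> carrier ?M" "D \<in> carrier ?M"
    using k g K Du by (auto simp: M.Units_closed)
  have "K = (k \<otimes>\<^bsub>?M\<^esub> g) \<otimes>\<^bsub>?M\<^esub> K \<otimes>\<^bsub>?M\<^esub> (conj_transpose g \<otimes>\<^bsub>?M\<^esub> conj_transpose k)"
    using k ck cl by simp
  also have "\<dots> = k \<otimes>\<^bsub>?M\<^esub> B \<otimes>\<^bsub>?M\<^esub> conj_transpose k"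
    unfolding g(2) using cl by (simp add: M.m_assoc)
  also have "\<dots> = (k \<otimes>\<^bsub>?M\<^esub> D) \<otimes>\<^bsub>?M\<^esub> conj_transpose (k \<otimes>\<^bsub>?M\<^esub> D)"
    unfolding DB[symmetric] using cl by (simp add: M.m_assoc conj_transpose_mult)
  finally show thesis using that[of "k \<otimes>\<^bsub>?M\<^esub> D"] k Du by blast
qed

end

section \<open>Twisted tori\<close>

lemma card_le_mult_fibres:
  assumes "finite B" "f ` A \<subseteq> B" "\<And>y. y \<in> B \<Longrightarrow> finite {x \<in> A. f x = y}"
    "\<And>y. y \<in> B \<Longrightarrow> card {x \<in> A. f x = y} \<le> m"
  shows "card A \<le> card B * m"
proof -
  have "A = (\<Union>y\<in>B. {x \<in> A. f x = y})" using assms(2) by auto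
  then have "card A \<le> (\<Sum>y\<in>B. card {x \<in> A. f x = y})" using card_UN_le[OF assms(1)] by metis
  also have "\<dots> \<le> card B * m" using sum_bounded_above[of B "\<lambda>y. card {x \<in> A. f x = y}" m] assms(4) by simp
  finally show ?thesis .
qed

context cring
begin

lemma Units_pow [simp]: "x \<in> Units R \<Longrightarrow> x [^] (m::nat) \<in> Units R"
  by (induction m) auto

lemma Units_r_cancel:
  "x \<in> Units R \<Longrightarrow> y \<in> carrier R \<Longrightarrow> z \<in> carrier R \<Longrightarrow> y \<otimes> x = z \<otimes> x \<longleftrightarrow> y = z"
  using Units_l_cancel[of x y z] by (simp add: m_comm Units_closed)

lemma inv_pow_Units:
  assumes "x \<in> Units R"
  shows "inv x [^] (m::nat) = inv (x [^] m)"
  using nat_pow_distrib[of x "inv x" m] assms by (intro comm_inv_char[symmetric]) (auto simp: Units_closed)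

lemma inv_mult_Units:
  assumes "x \<in> Units R" "y \<in> Units R"
  shows "inv (x \<otimes> y) = inv x \<otimes> inv y"
proof (rule comm_inv_char)
  have "x \<otimes> y \<otimes> (inv x \<otimes> inv y) = (x \<otimes> inv x) \<otimes> (y \<otimes> inv y)"
    using assms by (simp add: m_ac Units_closed del: Units_r_inv)
  then show "x \<otimes> y \<otimes> (inv x \<otimes> inv y) = \<one>" using assms by simp
qed (use assms in \<open>auto simp: Units_closed\<close>)

end

context frobenius_field
begin

text \<open>The Frobenius map on a diagonal entry, that is, the case of 1 by 1 matrices;
  \<open>u\<close> selects the unitary group.\<close>

definition twist :: "bool \<Rightarrow> 'a \<Rightarrow> 'a"
  where "twist u x = (if u then inv (x [^] q) else x [^] q)"

lemma twist_closed [simp]: "x \<in> Units L \<Longrightarrow> twist u x \<in> Units L"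
  by (simp add: twist_def)

lemma twist_one [simp]: "twist u \<one> = \<one>"
  by (simp add: twist_def)

lemma twist_mult: "x \<in> Units L \<Longrightarrow> y \<in> Units L \<Longrightarrow> twist u (x \<otimes> y) = twist u x \<otimes> twist u y"
  by (auto simp: twist_def nat_pow_distrib Units_closed inv_mult_Units)

lemma twist_minus_one [simp]: "twist u (\<ominus> \<one>) = \<ominus> \<one>"
proof -
  have "inv (\<ominus> \<one>) = \<ominus> \<one>" by (intro comm_inv_char) (auto simp: l_minus r_minus)
  then show ?thesis by (simp add: twist_def frob_minus)
qed

lemma twist_funpow_closed [simp]: "x \<in> Units L \<Longrightarrow> (twist u ^^ k) x \<in> Units L"
  by (induction k) auto

lemma twist_funpow:
  "x \<in> Units L \<Longrightarrow> (twist u ^^ k) x = (if u \<and> odd k then inv (x [^] (q ^ k)) else x [^] (q ^ k))"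
proof (induction k)
  case (Suc k)
  have "(y [^] m) [^] q = y [^] (q * m)" if "y \<in> Units L" for y m
    using that by (simp add: nat_pow_pow Units_closed mult.commute)
  moreover have "inv (x [^] m) [^] q = inv (x [^] (q * m))" for m
    using Suc.prems calculation[of x m] frob_inv[of "x [^] m"] by simp
  ultimately show ?case using Suc by (auto simp: twist_def Units_inv_inv)
qed (simp add: Units_closed)

text \<open>For \<open>k > 0\<close> a group of order \<open>q^k + 1\<close> if \<open>u\<close>
  holds and \<open>k\<close> is odd, and of order \<open>q^k - 1\<close> otherwise. The entry of a
  torus element at a point of a \<open>k\<close>-cycle lies in it.\<close>

definition twist_fixed :: "bool \<Rightarrow> nat \<Rightarrow> 'a set"
  where "twist_fixed u k = {x \<in> Units L. (twist u ^^ k) x = x}"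

lemma card_frob_power_fixed:
  assumes "k > 0"
  shows "card {x \<in> Units L. x [^] (q ^ k) = x} = q ^ k - 1" "finite {x \<in> Units L. x [^] (q ^ k) = x}"
proof -
  let ?A = "{x \<in> carrier L. x [^] (q ^ k) = x}"
  have Q: "q ^ k > 0" using q_gt_1 by simp
  have c: "card ?A = q ^ k"
    using frobenius_roots[OF prime_p char, of "e * k" "q ^ k"] e_pos assms by (simp add: q_def power_mult)
  then have fin: "finite ?A" using Q by (metis card.infinite less_numeral_extra(3))
  have eq: "{x \<in> Units L. x [^] (q ^ k) = x} = ?A - {\<zero>}" by (auto simp: field_Units)
  show "finite {x \<in> Units L. x [^] (q ^ k) = x}" unfolding eq using fin by simp
  show "card {x \<in> Units L. x [^] (q ^ k) = x} = q ^ k - 1"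
    unfolding eq using c fin Q by (subst card_Diff_singleton) (auto simp: nat_pow_zero)
qed

text \<open>The two-sided bound covers both possible orders. In the case \<open>u\<close> with odd
  \<open>k\<close> the elements are the roots of \<open>x^(Q+1) = 1\<close>, at most
  \<open>Q + 1\<close> many. The converse bound comes from the \<open>(Q-1)\<close>-th power map on
  the units of the field with \<open>Q^2\<close> elements: it lands among these roots, and its
  fibres have at most \<open>Q - 1\<close> elements.\<close>

lemma card_twist_fixed:
  assumes k: "k > 0"
  shows "finite (twist_fixed u k)" "q ^ k - 1 \<le> card (twist_fixed u k)" "card (twist_fixed u k) \<le> q ^ k + 1"
proof -
  define Q where "Q = q ^ k"
  have Q: "Q > 1" using q_gt_1 k unfolding Q_def by (metis one_less_power)
  show "finite (twist_fixed u k)" "q ^ k - 1 \<le> card (twist_fixed u k)" "card (twist_fixed u k) \<le> q ^ k + 1"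
  proof (atomize (full), cases "u \<and> odd k")
    case False
    then have eq: "twist_fixed u k = {x \<in> Units L. x [^] (q ^ k) = x}"
      by (auto simp: twist_fixed_def twist_funpow)
    show "finite (twist_fixed u k) \<and> q ^ k - 1 \<le> card (twist_fixed u k) \<and> card (twist_fixed u k) \<le> q ^ k + 1"
      unfolding eq using card_frob_power_fixed[OF k] by simp
  next
    case True
    have "inv (x [^] Q) = x \<longleftrightarrow> x [^] Suc Q = \<one>" if "x \<in> Units L" for x
    proof
      assume "inv (x [^] Q) = x"
      then have "x [^] Q \<otimes> x = x [^] Q \<otimes> inv (x [^] Q)" by simp
      then show "x [^] Suc Q = \<one>" using that by simp
    next
      assume "x [^] Suc Q = \<one>"
      then show "inv (x [^] Q) = x" using that by (intro comm_inv_char) (auto simp: Units_closed)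
    qed
    moreover have "x \<in> Units L" if "x \<in> carrier L" "x [^] Suc Q = \<one>" for x
      using that by (auto simp: field_Units)
    ultimately have eq: "twist_fixed u k = {x \<in> carrier L. x [^] Suc Q = \<one>}"
      using True by (auto simp: twist_fixed_def twist_funpow Q_def[symmetric] Units_closed simp del: nat_pow_Suc)
    have fin: "finite (twist_fixed u k)" "card (twist_fixed u k) \<le> Q + 1"
      unfolding eq using card_power_eq_le[of \<one> "Suc Q"] by (auto simp del: nat_pow_Suc)
    define Y where "Y = {x \<in> Units L. x [^] (q ^ (2 * k)) = x}"
    \<comment> \<open>The right-hand side is \<open>(Q + 1) (Q - 1) + 1\<close>, which gives the
      order of the unit group in factored form.\<close>
    have Q2: "q ^ (2 * k) = Suc (Q + 1) * (Q - 1) + 1 - (Q - 1)"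
    proof -
      obtain r where "Q = Suc r" using Q by (cases Q) auto
      then show ?thesis by (simp add: Q_def[symmetric] power_mult mult.commute[of 2] power2_eq_square)
    qed
    have Y1: "y [^] ((Q - 1) * Suc Q) = \<one>" if "y \<in> Y" for y
    proof -
      have "q ^ (2 * k) = Suc ((Q - 1) * Suc Q)"
        using Q2 Q by (cases Q) (auto simp: algebra_simps)
      then have "\<one> \<otimes> y = y [^] ((Q - 1) * Suc Q) \<otimes> y" using that by (simp add: Y_def Units_closed)
      then show ?thesis using that by (subst (asm) Units_r_cancel) (auto simp: Y_def Units_closed)
    qed
    have "card Y = (Q - 1) * Suc Q" "finite Y"
      using card_frob_power_fixed[of "2 * k"] k Q2 Q unfolding Y_def
      by (cases Q; simp add: algebra_simps)+
    moreover have "card Y \<le> card (twist_fixed u k) * (Q - 1)"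
    proof (rule card_le_mult_fibres[of _ "\<lambda>y. y [^] (Q - 1)"])
      show "(\<lambda>y. y [^] (Q - 1)) ` Y \<subseteq> twist_fixed u k"
      proof (intro image_subsetI)
        fix y assume y: "y \<in> Y"
        then have "(y [^] (Q - 1)) [^] Suc Q = \<one>"
          using Y1[OF y] nat_pow_pow[of y "Q - 1" "Suc Q"] by (simp add: Y_def Units_closed del: nat_pow_Suc)
        then show "y [^] (Q - 1) \<in> twist_fixed u k" using y unfolding eq by (simp add: Y_def Units_closed del: nat_pow_Suc)
      qed
      fix c assume c: "c \<in> twist_fixed u k"
      then have c': "c \<in> carrier L" by (simp add: eq)
      have sub: "{y \<in> Y. y [^] (Q - 1) = c} \<subseteq> {y \<in> carrier L. y [^] (Q - 1) = c}"
        by (auto simp: Y_def Units_closed)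
      show "finite {y \<in> Y. y [^] (Q - 1) = c}" using \<open>finite Y\<close> by simp
      show "card {y \<in> Y. y [^] (Q - 1) = c} \<le> Q - 1"
        using card_mono[OF _ sub] card_power_eq_le[OF c', of "Q - 1"] Q by force
    qed (use fin in auto)
    ultimately have "(Q - 1) * Suc Q \<le> (Q - 1) * card (twist_fixed u k)" by (metis mult.commute)
    then have "Suc Q \<le> card (twist_fixed u k)" using Q by (metis mult_le_cancel1 zero_less_diff)
    then show "finite (twist_fixed u k) \<and> q ^ k - 1 \<le> card (twist_fixed u k) \<and> card (twist_fixed u k) \<le> q ^ k + 1"
      using fin Q by (simp add: Q_def)
  qed
qed

text \<open>Extensional functions, so that the entries below \<open>n\<close> determine the element
  and the set is finite.\<close>

definition torus :: "bool \<Rightarrow> nat \<Rightarrow> (nat \<Rightarrow> nat) \<Rightarrow> (nat \<Rightarrow> 'a) set"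
  where "torus u n w = {t \<in> {..<n} \<rightarrow>\<^sub>E Units L. \<forall>i<n. twist u (t (w i)) = t i}"

definition torus_mult :: "nat \<Rightarrow> (nat \<Rightarrow> 'a) \<Rightarrow> (nat \<Rightarrow> 'a) \<Rightarrow> nat \<Rightarrow> 'a"
  where "torus_mult n s t = (\<lambda>i\<in>{..<n}. s i \<otimes> t i)"

end

locale twisted_torus = frobenius_field +
  fixes u :: bool and n :: nat and w :: "nat \<Rightarrow> nat"
  assumes w: "w permutes {..<n}"
begin

abbreviation "T \<equiv> torus u n w"

lemma w_less [simp]: "i < n \<Longrightarrow> w i < n"
  using permutes_in_image[OF w, of i] by auto

lemma w_funpow_less [simp]: "i < n \<Longrightarrow> (w ^^ m) i < n"
  by (induction m) auto

lemma permutation_w: "permutation w"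
  using w by (auto simp: permutation_permutes)

lemma self_in_orbit: "i \<in> orbit w i"
  using permutation_self_in_orbit[OF permutation_w] .

lemma orbit_sym: "j \<in> orbit w i \<Longrightarrow> i \<in> orbit w j"
  using orbit_swap[OF self_in_orbit] .

lemma torus_Units: "t \<in> T \<Longrightarrow> i < n \<Longrightarrow> t i \<in> Units L"
  by (auto simp: torus_def)

lemma torus_eqI:
  assumes "s \<in> T" "t \<in> T" "\<And>i. i < n \<Longrightarrow> s i = t i"
  shows "s = t"
  using assms unfolding torus_def by (intro PiE_ext[of s _ _ t]) auto

lemma torus_mult_closed: "s \<in> T \<Longrightarrow> t \<in> T \<Longrightarrow> torus_mult n s t \<in> T"
  by (auto simp: torus_def torus_mult_def twist_mult PiE_iff)

lemma torus_funpow: "t \<in> T \<Longrightarrow> i < n \<Longrightarrow> (twist u ^^ m) (t ((w ^^ m) i)) = t i"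
proof (induction m arbitrary: i)
  case (Suc m)
  then have "(twist u ^^ Suc m) (t ((w ^^ Suc m) i)) = twist u ((twist u ^^ m) (t ((w ^^ m) (w i))))"
    by (simp add: funpow_swap1)
  also have "\<dots> = twist u (t (w i))" using Suc by simp
  finally show ?case using Suc.prems by (simp add: torus_def)
qed simp

lemma torus_fixed:
  assumes "t \<in> T" "i < n" "(w ^^ k) i = i"
  shows "t i \<in> twist_fixed u k"
  using torus_funpow[OF assms(1,2), of k] torus_Units[OF assms(1,2)] assms(3)
  by (simp add: twist_fixed_def)

definition period :: "nat \<Rightarrow> nat"
  where "period i = funpow_dist1 w i i"

lemma period: "period i > 0" "(w ^^ period i) i = i"
  using funpow_dist1_prop[OF self_in_orbit] by (auto simp: period_def)

lemma finite_torus: "finite T"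
proof (rule finite_subset)
  show "T \<subseteq> (\<Pi>\<^sub>E i\<in>{..<n}. twist_fixed u (period i))"
    using torus_fixed period by (force simp: torus_def PiE_iff)
  show "finite (\<Pi>\<^sub>E i\<in>{..<n}. twist_fixed u (period i))"
    using card_twist_fixed period by (intro finite_PiE) auto
qed

lemma torus_one: "(\<lambda>i\<in>{..<n}. \<one>) \<in> T"
  by (auto simp: torus_def)

lemma card_torus_pos: "card T > 0"
  using finite_torus torus_one by (auto simp: card_gt_0_iff)

text \<open>The torus element supported on the cycle of \<open>i\<close> with value \<open>x\<close>
  at \<open>i\<close>. The value at \<open>j\<close> is forced by \<open>torus_funpow\<close>, with
  the number of steps that \<open>w\<close> takes from \<open>j\<close> to \<open>i\<close>.\<close>

definition cycle_elem :: "nat \<Rightarrow> 'a \<Rightarrow> nat \<Rightarrow> 'a"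
  where "cycle_elem i x = (\<lambda>j\<in>{..<n}. if j \<in> orbit w i then (twist u ^^ funpow_dist w j i) x else \<one>)"

lemma cycle_elem_in_torus:
  assumes i: "i < n" and x: "x \<in> twist_fixed u (period i)"
  shows "cycle_elem i x \<in> T" "cycle_elem i x i = x"
proof -
  have x': "x \<in> Units L" "(twist u ^^ period i) x = x" using x by (auto simp: twist_fixed_def)
  show "cycle_elem i x i = x" using i self_in_orbit by (simp add: cycle_elem_def funpow_dist_0)
  have "twist u (cycle_elem i x (w j)) = cycle_elem i x j" if j: "j < n" for j
  proof (cases "j \<in> orbit w i")
    case True
    then have wj: "w j \<in> orbit w i" by (rule orbit.step)
    show ?thesis
    \<comment> \<open>The way from \<open>w i\<close> back to \<open>i\<close> takes
      \<open>period i - 1\<close> steps. Hence the torus equation at \<open>i\<close> says exactly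
      that \<open>period i\<close> iterations of \<open>twist u\<close> fix
      \<open>x\<close>.\<close>
    proof (cases "j = i")
      case True
      then show ?thesis using j wj x' self_in_orbit
        by (simp add: cycle_elem_def period_def funpow_dist_0)
    next
      case False
      then have "funpow_dist w j i = Suc (funpow_dist w (w j) i)"
        by (rule funpow_dist_step[OF _ orbit_sym[OF True]])
      then show ?thesis using j wj True by (simp add: cycle_elem_def)
    qed
  next
    case False
    have "w j \<notin> orbit w i"
    proof
      assume "w j \<in> orbit w i"
      then have "i \<in> orbit w j" using orbit_sym[of "w j" i] permutation_orbit_step[OF permutation_w, of j] by simp
      then show False using orbit_sym False by blast
    qed
    then show ?thesis using j False by (simp add: cycle_elem_def)
  qed
  then show "cycle_elem i x \<in> T" using x' by (auto simp: torus_def cycle_elem_def PiE_iff)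
qed

text \<open>Elements \<open>t\<close> with \<open>t i = t j\<close> are multiplied by the elements
  supported on the cycle of \<open>i\<close>, about \<open>q^k\<close> many. If \<open>j\<close> is
  on another cycle, the product still shows \<open>t j = t i\<close> in place \<open>j\<close>, so
  the pair of factors can be recovered. If \<open>w\<close> takes \<open>j\<close> to
  \<open>i\<close> in \<open>d < k\<close> steps, then \<open>t i = t j\<close> forces
  \<open>t i\<close> into \<open>twist_fixed u d\<close>; recording it makes the map injective at
  the cost of at most \<open>q^(k-1) + 1\<close> values. In both cases a factor of order
  \<open>q\<close> remains.\<close>

lemma card_torus_collision:
  assumes ij: "i < n" "j < n" "i \<noteq> j"
  shows "q * card {t \<in> T. t i = t j} \<le> 4 * card T"
proof -
  let ?H = "{t \<in> T. t i = t j}"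
  define k where "k = period i"
  have k: "k > 0" using period by (simp add: k_def)
  let ?A = "twist_fixed u k"
  have finH: "finite ?H" using finite_torus by simp
  have H: "t \<in> T" "t i = t j" if "t \<in> ?H" for t using that by auto
  let ?f = "\<lambda>(t, x). torus_mult n t (cycle_elem i x)"
  have fT: "?f ` (?H \<times> ?A) \<subseteq> T"
    using cycle_elem_in_torus[OF ij(1)] torus_mult_closed by (auto simp: k_def)
  have fi: "?f (t, x) i = t i \<otimes> x" if "x \<in> ?A" for t x
    using cycle_elem_in_torus[OF ij(1)] that ij by (simp add: k_def torus_mult_def)
  have cancel: "x = x' \<and> t = t'"
    if tx: "t \<in> ?H" "x \<in> ?A" "t' \<in> ?H" "x' \<in> ?A" and eq: "?f (t, x) = ?f (t', x')" and i: "t i = t' i" for t x t' x'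
  proof
    have "t i \<otimes> x = t i \<otimes> x'" using fi[of x t] fi[of x' t'] tx eq i by simp
    moreover have "t i \<in> Units L" "x \<in> carrier L" "x' \<in> carrier L"
      using tx torus_Units[OF H(1) ij(1)] by (auto simp: twist_fixed_def Units_closed)
    ultimately show "x = x'" by simp
    show "t = t'"
    proof (rule torus_eqI)
      fix l assume l: "l < n"
      have c: "cycle_elem i x l \<in> Units L"
        using torus_Units[OF cycle_elem_in_torus(1)[OF ij(1)] l] tx by (simp add: k_def)
      have "t l \<otimes> cycle_elem i x l = t' l \<otimes> cycle_elem i x l"
        using fun_cong[OF eq, of l] l \<open>x = x'\<close> by (simp add: torus_mult_def)
      then show "t l = t' l"
        using c torus_Units[OF H(1) l] tx by (subst (asm) Units_r_cancel) (auto simp: Units_closed)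
    qed (use tx in auto)
  qed
  have main: "card ?H * card ?A \<le> card T * (q ^ (k - 1) + 1)"
  proof (cases "j \<in> orbit w i")
    case False
    have "inj_on ?f (?H \<times> ?A)"
    proof (rule inj_onI, clarify)
      fix t x t' x'
      assume *: "t \<in> T" "t i = t j" "x \<in> ?A" "t' \<in> T" "t' i = t' j" "x' \<in> ?A"
        and eq: "torus_mult n t (cycle_elem i x) = torus_mult n t' (cycle_elem i x')"
      have "t j = t' j" using fun_cong[OF eq, of j] False ij torus_Units * Units_closed
        by (simp add: torus_mult_def cycle_elem_def)
      then show "t = t' \<and> x = x'" using cancel[of t x t' x'] * eq by auto
    qed
    then have "card (?H \<times> ?A) \<le> card T" using fT finite_torus by (rule card_inj_on_le)
    then show ?thesis by (simp add: card_cartesian_product)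
  next
    case True
    define d where "d = funpow_dist w j i"
    have wd: "(w ^^ d) j = i" unfolding d_def using funpow_dist_prop[OF orbit_sym[OF True]] .
    then have d0: "d > 0" using ij by (cases d) auto
    \<comment> \<open>If \<open>a\<close> steps lead from \<open>i\<close> to \<open>j\<close>, then
      \<open>k - a\<close> steps lead back, and \<open>a > 0\<close> because \<open>j\<close>
      differs from \<open>i\<close>.\<close>
    have "d < k"
    proof -
      obtain a where a: "a < k" "j = (w ^^ a) i"
        using True unfolding k_def period_def orbit_conv_funpow_dist1[OF self_in_orbit] by auto
      have a0: "a > 0" using a ij by (cases a) auto
      have "(w ^^ (k - a)) j = (w ^^ ((k - a) + a)) i" unfolding a(2) funpow_add by simp
      then have "(w ^^ (k - a)) j = i" using a period(2)[of i] by (simp add: k_def)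
      then have "d \<le> k - a" unfolding d_def funpow_dist_def by (rule Least_le)
      then show ?thesis using a0 a by linarith
    qed
    let ?B = "twist_fixed u d"
    have tB: "t i \<in> ?B" if "t \<in> ?H" for t
      using torus_funpow[of t j d] H[OF that] ij torus_Units wd by (auto simp: twist_fixed_def)
    have "inj_on (\<lambda>z. (?f z, fst z i)) (?H \<times> ?A)"
    proof (rule inj_onI)
      fix z z' assume z: "z \<in> ?H \<times> ?A" "z' \<in> ?H \<times> ?A" and eq: "(?f z, fst z i) = (?f z', fst z' i)"
      obtain t x t' x' where zz: "z = (t, x)" "z' = (t', x')" by (cases z, cases z')
      have "x = x' \<and> t = t'" using z eq unfolding zz by (intro cancel) auto
      then show "z = z'" using zz by simp
    qed
    moreover have "(\<lambda>z. (?f z, fst z i)) ` (?H \<times> ?A) \<subseteq> T \<times> ?B"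
      using fT tB by auto
    ultimately have "card (?H \<times> ?A) \<le> card (T \<times> ?B)"
      using finite_torus card_twist_fixed(1)[OF d0] by (intro card_inj_on_le) auto
    then have "card ?H * card ?A \<le> card T * card ?B" by (simp add: card_cartesian_product)
    also have "card ?B \<le> q ^ (k - 1) + 1"
    proof -
      have "q ^ d \<le> q ^ (k - 1)" using q_gt_1 \<open>d < k\<close> by (intro power_increasing) auto
      then show ?thesis using card_twist_fixed(3)[OF d0, of u] by simp
    qed
    finally show ?thesis by simp
  qed
  have k': "q ^ k = q * q ^ (k - 1)" using k by (cases k) auto
  have Q: "q ^ (k - 1) \<ge> 1" using q_gt_1 by simp
  have q3: "q \<ge> 3" using q_gt_1 odd_q by (cases "q = 2") auto
  have "card ?H * (q ^ k - 1) \<le> card T * (q ^ (k - 1) + 1)"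
    using mult_le_mono2[OF card_twist_fixed(2)[OF k, of u], of "card ?H"] main by linarith
  then have "q * card ?H * (q ^ k - 1) \<le> card T * (q ^ k + q)"
    using mult_le_mono2[of _ _ q] unfolding k' by (metis (no_types, lifting) add_mult_distrib2 mult.assoc mult.left_commute mult.right_neutral)
  \<comment> \<open>The constant 4 absorbs the ones added and subtracted in
    \<open>card_twist_fixed\<close>: the left side is at most \<open>2 q^k\<close>.\<close>
  also have "q ^ k + q \<le> 4 * (q ^ k - 1)"
  proof -
    have "q \<le> q ^ k" unfolding k' using Q by simp
    then show ?thesis using q3 by linarith
  qed
  finally have "q * card ?H * (q ^ k - 1) \<le> 4 * card T * (q ^ k - 1)" by (simp add: mult_ac)
  moreover have "q ^ k - 1 > 0" using Q q3 unfolding k' by (metis One_nat_def k k' less_le_trans one_less_power q_gt_1 zero_less_diff)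
  ultimately show ?thesis by simp
qed

text \<open>Union bound over the ordered pairs of distinct positions; the error term of the theorem
  originates here.\<close>

lemma card_torus_nonregular:
  "q * card {t \<in> T. \<not> inj_on t {..<n}} \<le> 4 * n\<^sup>2 * card T"
proof -
  let ?P = "{(i, j). i < n \<and> j < n \<and> i \<noteq> j}"
  have P: "?P \<subseteq> {..<n} \<times> {..<n}" by auto
  then have fP: "finite ?P" by (rule finite_subset) simp
  have cP: "card ?P \<le> n\<^sup>2" using card_mono[OF _ P] by (simp add: power2_eq_square)
  have eq: "{t \<in> T. \<not> inj_on t {..<n}} = (\<Union>z\<in>?P. {t \<in> T. t (fst z) = t (snd z)})"
    unfolding inj_on_def by fastforce
  have "card {t \<in> T. \<not> inj_on t {..<n}} \<le> (\<Sum>z\<in>?P. card {t \<in> T. t (fst z) = t (snd z)})"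
    unfolding eq by (rule card_UN_le[OF fP])
  then have "q * card {t \<in> T. \<not> inj_on t {..<n}} \<le> (\<Sum>z\<in>?P. q * card {t \<in> T. t (fst z) = t (snd z)})"
    by (simp add: sum_distrib_left[symmetric])
  also have "\<dots> \<le> (\<Sum>z\<in>?P. 4 * card T)"
    using card_torus_collision by (intro sum_mono) auto
  also have "\<dots> \<le> 4 * n\<^sup>2 * card T" using cP by simp
  finally show ?thesis .
qed

section \<open>Squares in the torus\<close>

definition torus_squares :: "(nat \<Rightarrow> 'a) set"
  where "torus_squares = (\<lambda>t. torus_mult n t t) ` T"

lemma torus_squares_subset: "torus_squares \<subseteq> T"
  using torus_mult_closed by (auto simp: torus_squares_def)

text \<open>Because \<open>twist u\<close> fixes both signs, the torus equation reduces to
  \<open>t (w i) = t i\<close>, leaving one free sign for each cycle.\<close>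

lemma card_torus_involutions:
  "card {t \<in> T. \<forall>i<n. t i \<in> {\<one>, \<ominus> \<one>}} = 2 ^ card (orbit w ` {..<n})"
proof -
  let ?K = "{t \<in> T. \<forall>i<n. t i \<in> {\<one>, \<ominus> \<one>}}"
  let ?O = "orbit w ` {..<n}"
  let ?F = "?O \<rightarrow>\<^sub>E {\<one>, \<ominus> \<one>}"
  let ?g = "\<lambda>f. \<lambda>i\<in>{..<n}. f (orbit w i)"
  have m1: "\<ominus> \<one> \<in> Units L" using one_not_zero by (auto simp: field_Units)
  have orb: "orbit w (w i) = orbit w i" for i
    using orbit_cyclic_eq3[OF cyclic_on_orbit[OF w]] orbit.base[of w i] finite_lessThan by blast
  have inj: "inj_on ?g ?F"
  proof (rule inj_onI)
    fix f f' assume f: "f \<in> ?F" "f' \<in> ?F" and eq: "?g f = ?g f'"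
    show "f = f'"
    proof (rule PiE_ext[OF f])
      fix B assume "B \<in> ?O"
      then obtain i where "i < n" "B = orbit w i" by auto
      then show "f B = f' B" using fun_cong[OF eq, of i] by simp
    qed
  qed
  have img: "?g ` ?F = ?K"
  proof (intro equalityI subsetI)
    fix t assume "t \<in> ?g ` ?F"
    then obtain f where f: "f \<in> ?F" "t = ?g f" by auto
    have v: "f (orbit w i) \<in> {\<one>, \<ominus> \<one>}" if "i < n" for i using f(1) that by (auto simp: PiE_iff)
    then have "twist u (f (orbit w i)) = f (orbit w i)" "f (orbit w i) \<in> Units L" if "i < n" for i
      using that m1 by (metis insertE singletonD twist_minus_one twist_one Units_one_closed)+
    then show "t \<in> ?K" using v unfolding f(2) by (auto simp: torus_def orb)
  next
    fix t assume t: "t \<in> ?K"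
    then have step: "t (w i) = t i" if "i < n" for i
    proof -
      have "t (w i) \<in> {\<one>, \<ominus> \<one>}" "twist u (t (w i)) = t i" using t that by (auto simp: torus_def)
      then show ?thesis by auto
    qed
    have const: "t ((w ^^ m) i) = t i" if "i < n" for m i
      using that by (induction m) (auto simp: step)
    define f where "f = (\<lambda>B\<in>?O. t (SOME i. i \<in> B))"
    have fo: "f (orbit w i) = t i" if i: "i < n" for i
    proof -
      have "(SOME j. j \<in> orbit w i) \<in> orbit w i" using self_in_orbit by (rule someI)
      then obtain m where "(SOME j. j \<in> orbit w i) = (w ^^ m) i" by (auto simp: orbit_altdef)
      then show ?thesis using const[OF i] i by (simp add: f_def)
    qed
    have "f \<in> ?F" using t fo by (auto simp: f_def PiE_iff extensional_def)
    moreover have "t = ?g f"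
      using fo t by (intro ext) (auto simp: torus_def PiE_iff extensional_def)
    ultimately show "t \<in> ?g ` ?F" by blast
  qed
  have "card ?K = card ?F" unfolding img[symmetric] by (rule card_image[OF inj])
  also have "\<dots> = 2 ^ card ?O" using minus_one_neq_one by (simp add: card_PiE numeral_2_eq_2)
  finally show ?thesis .
qed

lemma square_eq_iff:
  assumes "x \<in> Units L" "y \<in> Units L"
  shows "x \<otimes> x = y \<otimes> y \<longleftrightarrow> (\<exists>z\<in>{\<one>, \<ominus> \<one>}. x = y \<otimes> z)"
proof
  assume eq: "x \<otimes> x = y \<otimes> y"
  have c: "x \<in> carrier L" "y \<in> carrier L" using assms by (auto simp: Units_closed)
  have "(x \<ominus> y) \<otimes> (x \<oplus> y) = x \<otimes> x \<ominus> y \<otimes> y"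
    using c by (simp add: a_minus_def l_distr r_distr l_minus r_minus a_ac m_comm r_neg2 r_neg1)
  also have "\<dots> = \<zero>" using c eq by simp
  finally have "x = y \<or> x \<oplus> y = \<zero>" using c by (auto simp: integral_iff)
  moreover have "x = \<ominus> y" if "x \<oplus> y = \<zero>" using that c by (metis minus_equality)
  ultimately show "\<exists>z\<in>{\<one>, \<ominus> \<one>}. x = y \<otimes> z" using c by (auto simp: r_minus)
qed (use assms in \<open>auto simp: Units_closed l_minus r_minus\<close>)

text \<open>Each nonempty fibre of squaring is a translate of the kernel. The quotient of two square
  roots is a vector of signs, and cancelling \<open>t i\<close> in the torus equation shows that it
  lies in the torus.\<close>

lemma card_torus_squares: "card T = 2 ^ card (orbit w ` {..<n}) * card torus_squares"
proof -
  let ?sq = "\<lambda>t. torus_mult n t t"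
  let ?K = "{t \<in> T. \<forall>i<n. t i \<in> {\<one>, \<ominus> \<one>}}"
  have fibre: "card {s \<in> T. ?sq s = y} = card ?K" if y: "y \<in> torus_squares" for y
  proof -
    obtain t where t: "t \<in> T" "y = ?sq t" using y by (auto simp: torus_squares_def)
    have inj: "inj_on (torus_mult n t) ?K"
    proof (rule inj_onI)
      fix a b assume ab: "a \<in> ?K" "b \<in> ?K" and eq: "torus_mult n t a = torus_mult n t b"
      show "a = b"
      proof (rule torus_eqI)
        fix i assume i: "i < n"
        have "t i \<otimes> a i = t i \<otimes> b i" using fun_cong[OF eq, of i] i by (simp add: torus_mult_def)
        moreover have "a i \<in> carrier L" "b i \<in> carrier L" using ab i torus_Units by (auto simp: Units_closed)
        ultimately show "a i = b i" using torus_Units[OF t(1) i] by simp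
      qed (use ab in auto)
    qed
    have img: "torus_mult n t ` ?K = {s \<in> T. ?sq s = y}"
    proof (intro equalityI subsetI)
      fix s assume "s \<in> torus_mult n t ` ?K"
      then obtain a where a: "a \<in> ?K" "s = torus_mult n t a" by auto
      have s: "s \<in> T" using a t torus_mult_closed by auto
      have "s i \<otimes> s i = t i \<otimes> t i" if i: "i < n" for i
        using square_eq_iff[of "s i" "t i"] torus_Units[OF s i] torus_Units[OF t(1) i] a i
        by (auto simp: torus_mult_def)
      then show "s \<in> {s \<in> T. ?sq s = y}" using s t by (auto simp: torus_mult_def restrict_def)
    next
      fix s assume "s \<in> {s \<in> T. ?sq s = y}"
      then have s: "s \<in> T" "?sq s = ?sq t" using t by auto
      have "\<exists>z. z \<in> {\<one>, \<ominus> \<one>} \<and> s i = t i \<otimes> z" if i: "i < n" for i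
        using fun_cong[OF s(2), of i] i square_eq_iff[OF torus_Units[OF s(1) i] torus_Units[OF t(1) i]]
        by (auto simp: torus_mult_def)
      then obtain z where z: "\<And>i. i < n \<Longrightarrow> z i \<in> {\<one>, \<ominus> \<one>}" "\<And>i. i < n \<Longrightarrow> s i = t i \<otimes> z i" by metis
      define a where "a = restrict z {..<n}"
      have m1: "\<ominus> \<one> \<in> Units L" using one_not_zero by (auto simp: field_Units)
      have zu: "z i \<in> Units L" "twist u (z i) = z i" if "i < n" for i
        using z(1)[OF that] m1 by auto
      have "z (w i) = z i" if i: "i < n" for i
      proof -
        have "twist u (t (w i) \<otimes> z (w i)) = t i \<otimes> z i"
          using s(1) z(2) i by (simp add: torus_def)
        then have "t i \<otimes> z (w i) = t i \<otimes> z i"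
          using t(1) zu i torus_Units[OF t(1), of "w i"] by (simp add: twist_mult torus_def)
        then show ?thesis using zu i torus_Units[OF t(1) i] by (simp add: Units_closed)
      qed
      then have "a \<in> ?K" using z(1) zu by (auto simp: a_def torus_def)
      moreover have "s = torus_mult n t a"
        using z s by (intro ext) (auto simp: a_def torus_mult_def torus_def PiE_iff extensional_def)
      ultimately show "s \<in> torus_mult n t ` ?K" by blast
    qed
    show ?thesis unfolding img[symmetric] by (rule card_image[OF inj])
  qed
  have "card T = (\<Sum>y\<in>torus_squares. card {s \<in> T. ?sq s = y})"
    using sum.image_gen[OF finite_torus, of "\<lambda>_. 1::nat" ?sq] by (simp add: torus_squares_def)
  also have "\<dots> = (\<Sum>y\<in>torus_squares. card ?K)" using fibre by (intro sum.cong) auto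
  finally show ?thesis unfolding card_torus_involutions by (simp add: mult.commute)
qed

text \<open>Discarding the nonregular elements costs any subset of the torus at most a proportion
  \<open>4 n^2 / q\<close>. Both bounds are instances of this, for the squares and for their
  complement.\<close>

lemma card_regular_torus_squares:
  "real (card {t \<in> torus_squares. inj_on t {..<n}}) / real (card T) \<ge>
    1 / 2 ^ card (orbit w ` {..<n}) - 4 * real n ^ 2 / real q"
  "real (card {t \<in> T - torus_squares. inj_on t {..<n}}) / real (card T) \<ge>
    1 - 1 / 2 ^ card (orbit w ` {..<n}) - 4 * real n ^ 2 / real q"
proof -
  let ?N = "{t \<in> T. \<not> inj_on t {..<n}}"
  have fS: "finite torus_squares" using finite_subset[OF torus_squares_subset finite_torus] .
  have "real (q * card ?N) \<le> real (4 * n\<^sup>2 * card T)" using card_torus_nonregular of_nat_le_iff by blast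
  then have N: "real (card ?N) / real (card T) \<le> 4 * real n ^ 2 / real q"
    using card_torus_pos q_gt_1 by (simp add: field_simps)
  have bound: "real (card {t \<in> S. inj_on t {..<n}}) / real (card T) \<ge>
      real (card S) / real (card T) - 4 * real n ^ 2 / real q" if S: "S \<subseteq> T" for S
  proof -
    have fin: "finite S" using S finite_torus finite_subset by blast
    have "card S \<le> card ({t \<in> S. inj_on t {..<n}} \<union> ?N)" 
      using fin finite_torus S by (intro card_mono) auto
    also have "\<dots> \<le> card {t \<in> S. inj_on t {..<n}} + card ?N" by (rule card_Un_le)
    finally have "real (card S) \<le> real (card {t \<in> S. inj_on t {..<n}}) + real (card ?N)" by linarith
    then have "real (card S) / real (card T) \<le>
        real (card {t \<in> S. inj_on t {..<n}}) / real (card T) + real (card ?N) / real (card T)"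
      unfolding add_divide_distrib[symmetric] by (rule divide_right_mono) simp
    then show ?thesis using N by linarith
  qed
  have c: "real (card torus_squares) / real (card T) = 1 / 2 ^ card (orbit w ` {..<n})"
    using card_torus_pos unfolding card_torus_squares by (simp add: field_simps)
  have "card (T - torus_squares) = card T - card torus_squares"
    using fS torus_squares_subset by (intro card_Diff_subset) auto
  moreover have "card torus_squares \<le> card T" using torus_squares_subset finite_torus by (intro card_mono)
  ultimately have c2: "real (card (T - torus_squares)) / real (card T) = 1 - 1 / 2 ^ card (orbit w ` {..<n})"
    using c card_torus_pos by (simp add: of_nat_diff diff_divide_distrib)
  show "real (card {t \<in> torus_squares. inj_on t {..<n}}) / real (card T) \<ge>
    1 / 2 ^ card (orbit w ` {..<n}) - 4 * real n ^ 2 / real q"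
    using bound[OF torus_squares_subset] unfolding c .
  show "real (card {t \<in> T - torus_squares. inj_on t {..<n}}) / real (card T) \<ge>
    1 - 1 / 2 ^ card (orbit w ` {..<n}) - 4 * real n ^ 2 / real q"
    using bound[of "T - torus_squares"] unfolding c2 by blast
qed

lemma ex_regular_torus_element:
  assumes "q > 4 * n\<^sup>2"
  obtains t where "t \<in> T" "inj_on t {..<n}"
proof -
  have "{t \<in> T. \<not> inj_on t {..<n}} \<noteq> T"
  proof
    assume "{t \<in> T. \<not> inj_on t {..<n}} = T"
    then have "q * card T \<le> 4 * n\<^sup>2 * card T" using card_torus_nonregular by simp
    then show False using assms card_torus_pos by simp
  qed
  then show thesis using that by blast
qed

end

section \<open>Rational points of the general linear group over an algebraic closure\<close>

lemma carrier_GL: "carrier (GL n R) = Units (mat_monoid n R)"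
  and mult_GL: "A \<otimes>\<^bsub>GL n R\<^esub> B = A \<otimes>\<^bsub>mat_monoid n R\<^esub> B"
  and one_GL: "\<one>\<^bsub>GL n R\<^esub> = \<one>\<^bsub>mat_monoid n R\<^esub>"
  by (simp_all add: GL_def units_of_def)

lemma (in ring) group_GL: "group (GL n R)"
  unfolding GL_def by (rule monoid.units_group[OF monoid_mat_monoid])

lemma (in ring) carrier_GL_closed: "A \<in> carrier (GL n R) \<Longrightarrow> A \<in> carrier (mat_monoid n R)"
  by (simp add: carrier_GL Units_def)

lemma finite_mats_with_entries:
  assumes "finite E"
  shows "finite {A \<in> carrier_mat n n. \<forall>i<n. \<forall>j<n. A $$ (i, j) \<in> E}"
proof (rule finite_subset)
  show "{A \<in> carrier_mat n n. \<forall>i<n. \<forall>j<n. A $$ (i, j) \<in> E}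
    \<subseteq> (\<lambda>f. mat n n f) ` (({..<n} \<times> {..<n}) \<rightarrow>\<^sub>E E)"
  proof
    fix A assume A: "A \<in> {A \<in> carrier_mat n n. \<forall>i<n. \<forall>j<n. A $$ (i, j) \<in> E}"
    then have "A = mat n n (restrict (\<lambda>ij. A $$ ij) ({..<n} \<times> {..<n}))" by (intro eq_matI) auto
    then show "A \<in> (\<lambda>f. mat n n f) ` (({..<n} \<times> {..<n}) \<rightarrow>\<^sub>E E)" using A by (intro image_eqI) (force simp: restrict_PiE_iff)+
  qed
  show "finite ((\<lambda>f. mat n n f) ` (({..<n} \<times> {..<n}) \<rightarrow>\<^sub>E E))"
    using assms by (intro finite_imageI finite_PiE) auto
qed

locale frobenius_GL = frobenius_field +
  fixes u :: bool and n :: nat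
begin

abbreviation "G \<equiv> GL n L"

sublocale G: group G by (rule group_GL)

definition frob_GL :: "'a mat \<Rightarrow> 'a mat"
  where "frob_GL A = (if u then inv\<^bsub>G\<^esub> (conj_transpose A) else frob_mat A)"

definition fixed_points :: "'a mat set"
  where "fixed_points = {A \<in> carrier G. frob_GL A = A}"

lemma frob_GL_closed: "A \<in> carrier G \<Longrightarrow> frob_GL A \<in> carrier G"
  using G.inv_closed unfolding frob_GL_def carrier_GL by (auto intro: conj_transpose_Units frob_mat_Units)

lemma frob_GL_mult:
  assumes "A \<in> carrier G" "B \<in> carrier G"
  shows "frob_GL (A \<otimes>\<^bsub>G\<^esub> B) = frob_GL A \<otimes>\<^bsub>G\<^esub> frob_GL B"
proof -
  have c: "A \<in> carrier (mat_monoid n L)" "B \<in> carrier (mat_monoid n L)"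
    using assms by (auto intro: carrier_GL_closed)
  have "conj_transpose (A \<otimes>\<^bsub>G\<^esub> B) = conj_transpose B \<otimes>\<^bsub>G\<^esub> conj_transpose A"
    "frob_mat (A \<otimes>\<^bsub>G\<^esub> B) = frob_mat A \<otimes>\<^bsub>G\<^esub> frob_mat B"
    using c by (auto simp: mult_GL conj_transpose_mult frob_mat_mult)
  moreover have "conj_transpose A \<in> carrier G" "conj_transpose B \<in> carrier G"
    using assms by (auto simp: carrier_GL conj_transpose_Units)
  ultimately show ?thesis by (simp add: frob_GL_def G.inv_mult_group)
qed

lemma frob_GL_hom: "frob_GL \<in> hom G G"
  using frob_GL_closed frob_GL_mult by (auto simp: hom_def)

lemma frob_GL_inv: "A \<in> carrier G \<Longrightarrow> frob_GL (inv\<^bsub>G\<^esub> A) = inv\<^bsub>G\<^esub> (frob_GL A)"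
  using group_hom.hom_inv[of G G frob_GL A] frob_GL_hom by (simp add: group_hom_def group_hom_axioms_def)

lemma subgroup_fixed_points: "subgroup fixed_points G"
proof -
  interpret h: group_hom G G frob_GL
    using frob_GL_hom by (simp add: group_hom_def group_hom_axioms_def)
  show ?thesis
    by (rule G.subgroupI) (auto simp: fixed_points_def frob_GL_mult frob_GL_inv intro: exI[of _ "\<one>\<^bsub>G\<^esub>"])
qed

text \<open>In either case the entries lie in the field with \<open>q^2\<close> elements. For the
  unitary group this follows by applying the map twice: the two inversions cancel and
  \<open>conj_transpose (conj_transpose A) = A\<close> remains.\<close>

lemma finite_fixed_points: "finite fixed_points"
proof -
  define Q where "Q = q ^ 2"
  let ?E = "{x \<in> carrier L. x [^] Q = x}"
  have "?E \<subseteq> insert \<zero> {x \<in> Units L. x [^] (q ^ 2) = x}" by (auto simp: Q_def field_Units)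
  then have E: "finite ?E" using card_frob_power_fixed(2)[of 2] finite_subset by auto
  have pow: "(x [^] q) [^] q = x [^] Q" if "x \<in> carrier L" for x
    using that by (simp add: nat_pow_pow Q_def power2_eq_square)
  have "A $$ (i, j) \<in> ?E" if A: "A \<in> fixed_points" and ij: "i < n" "j < n" for A i j
  proof -
    have AG: "A \<in> carrier G" "frob_GL A = A" using A by (auto simp: fixed_points_def)
    have Ac: "A \<in> carrier (mat_monoid n L)" using AG by (intro carrier_GL_closed)
    have "(A $$ (i, j) [^] q) [^] q = A $$ (i, j)"
    proof (cases u)
      case True
      have cA: "conj_transpose A \<in> carrier G" using AG by (simp add: carrier_GL conj_transpose_Units)
      have "inv\<^bsub>G\<^esub> (conj_transpose A) = A" using AG True unfolding frob_GL_def by simp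
      then have "conj_transpose A = inv\<^bsub>G\<^esub> A" using G.inv_inv[OF cA] by simp
      moreover have "frob_GL (inv\<^bsub>G\<^esub> A) = inv\<^bsub>G\<^esub> A" using frob_GL_inv AG by simp
      ultimately have "inv\<^bsub>G\<^esub> (conj_transpose (conj_transpose A)) = conj_transpose A"
        using True unfolding frob_GL_def by simp
      then have "inv\<^bsub>G\<^esub> (inv\<^bsub>G\<^esub> (conj_transpose (conj_transpose A))) = A"
        using \<open>inv\<^bsub>G\<^esub> (conj_transpose A) = A\<close> by simp
      moreover have "conj_transpose (conj_transpose A) \<in> carrier G"
        using AG by (simp add: carrier_GL conj_transpose_Units)
      ultimately have "conj_transpose (conj_transpose A) = A" by simp
      then show ?thesis using ij Ac by (metis conj_transpose_closed conj_transpose_entry)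
    next
      case False
      then have "frob_mat A = A" using AG False unfolding frob_GL_def by simp
      then have "A $$ (i, j) [^] q = A $$ (i, j)" using ij Ac by (metis frob_mat_entry)
      then show ?thesis by simp
    qed
    then show ?thesis using pow Ac ij by simp
  qed
  then have "fixed_points \<subseteq> {A \<in> carrier_mat n n. \<forall>i<n. \<forall>j<n. A $$ (i, j) \<in> ?E}"
    using carrier_GL_closed by (auto simp: fixed_points_def carrier_mat_monoid_iff)
  then show ?thesis using finite_mats_with_entries[OF E] finite_subset by blast
qed

section \<open>Diagonal matrices under the Frobenius map, and the Lang equation\<close>

lemma dmat_GL: "(\<And>i. i < n \<Longrightarrow> t i \<in> Units L) \<Longrightarrow> dmat n t \<in> carrier G"
  using dmat_Units_iff[of n t] unfolding carrier_GL by (auto simp: field_Units)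

lemma dmat_mult_GL:
  assumes "\<And>i. i < n \<Longrightarrow> s i \<in> Units L" "\<And>i. i < n \<Longrightarrow> t i \<in> Units L"
  shows "dmat n s \<otimes>\<^bsub>G\<^esub> dmat n t = dmat n (\<lambda>i. s i \<otimes> t i)"
  unfolding mult_GL using assms by (intro dmat_mult) (auto simp: Units_closed)

lemma dmat_cong: "(\<And>i. i < n \<Longrightarrow> s i = t i) \<Longrightarrow> dmat n s = dmat n t"
  unfolding dmat_def by (intro cong_mat) auto

lemma frob_GL_dmat:
  assumes t: "\<And>i. i < n \<Longrightarrow> t i \<in> Units L"
  shows "frob_GL (dmat n t) = dmat n (\<lambda>i. twist u (t i))"
proof -
  have c: "dmat n t \<in> carrier (mat_monoid n L)" using t by (auto simp: Units_closed)
  have f: "frob_mat (dmat n t) = dmat n (\<lambda>i. t i [^] q)"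
    using t c by (intro mat_monoid_eqI[of _ n]) (auto simp: frob_mat_entry[of _ n] Units_closed)
  have ct: "conj_transpose (dmat n t) = dmat n (\<lambda>i. t i [^] q)"
    using t c by (intro mat_monoid_eqI[of _ n]) (auto simp: conj_transpose_entry[of _ n] Units_closed)
  have "inv\<^bsub>G\<^esub> dmat n (\<lambda>i. t i [^] q) = dmat n (\<lambda>i. inv (t i [^] q))"
  proof (rule G.inv_equality)
    have "dmat n (\<lambda>i. inv (t i [^] q)) \<otimes>\<^bsub>G\<^esub> dmat n (\<lambda>i. t i [^] q) = dmat n (\<lambda>i. \<one>)"
      using t by (subst dmat_mult_GL) (auto intro!: dmat_cong)
    also have "\<dots> = \<one>\<^bsub>G\<^esub>" unfolding one_GL by (auto simp: dmat_def mat_monoid_def)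
    finally show "dmat n (\<lambda>i. inv (t i [^] q)) \<otimes>\<^bsub>G\<^esub> dmat n (\<lambda>i. t i [^] q) = \<one>\<^bsub>G\<^esub>" .
  qed (use t in \<open>auto intro!: dmat_GL\<close>)
  then show ?thesis by (simp add: frob_GL_def twist_def f ct)
qed

text \<open>The special case of the Lang-Steinberg theorem that is needed, for large \<open>q\<close>. For the
  standard Frobenius map a Vandermonde matrix at the entries of a regular element of the torus
  works. In the unitary case the Vandermonde matrix \<open>V\<close> satisfies the equation up to the Hermitian
  matrix \<open>V w V\<^sup>*\<close>, which is factored as \<open>h h\<^sup>*\<close>.\<close>

lemma ex_lang:
  assumes big: "q > 4 * n\<^sup>2" and w: "w permutes {..<n}"
  obtains g where "g \<in> carrier G" "frob_GL g = g \<otimes>\<^bsub>G\<^esub> pmat n w"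
proof -
  interpret M: monoid "mat_monoid n L" by (rule monoid_mat_monoid)
  interpret W: twisted_torus L p e q u n w by unfold_locales (rule w)
  let ?M = "mat_monoid n L"
  obtain t where t: "t \<in> W.T" "inj_on t {..<n}" using W.ex_regular_torus_element[OF big] .
  have tu: "t i \<in> Units L" if "i < n" for i using W.torus_Units[OF t(1) that] .
  have tc: "t i \<in> carrier L" if "i < n" for i using tu[OF that] by (simp add: Units_closed)
  have tw: "twist u (t (w i)) = t i" if "i < n" for i using t(1) that by (simp add: torus_def)
  define V where "V = vmat n t"
  define P where "P = pmat n w"
  have V: "V \<in> carrier G" unfolding V_def carrier_GL using vmat_Units[of n t] tc t by blast
  have Vc: "V \<in> carrier ?M" using V by (rule carrier_GL_closed)
  have P: "P \<in> carrier G" unfolding P_def carrier_GL by (rule pmat_Units[OF w])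
  have Pc: "P \<in> carrier ?M" using P by (rule carrier_GL_closed)
  have pow: "(t j [^] a) [^] q = (t j [^] q) [^] a" if "j < n" for a j :: nat
    using tc[OF that] by (simp add: nat_pow_pow mult.commute)
  show thesis
  proof (cases u)
    case False
    \<comment> \<open>Since \<open>t (w k) ^ q = t k\<close>, the \<open>q\<close>-power map turns
      column \<open>w k\<close> of \<open>V\<close> into column \<open>k\<close>; multiplication by
      \<open>P\<close> on the right moves column \<open>k\<close> to place
      \<open>w k\<close>.\<close>
    have "frob_mat V = V \<otimes>\<^bsub>?M\<^esub> P"
    proof (rule mat_monoid_eqI)
      fix i j assume ij: "i < n" "j < n"
      obtain k where k: "k < n" "j = w k" using permutes_image[OF w] ij by (metis imageE lessThan_iff)
      have "(V \<otimes>\<^bsub>?M\<^esub> P) $$ (i, w k) = V $$ (i, k)"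
        unfolding P_def using ij k Vc permutes_inj_on[OF w] by (intro mult_pmat_entry) auto
      moreover have "frob_mat V $$ (i, j) = V $$ (i, k)"
        using ij k Vc pow[of j i] tw[of k] False by (simp add: V_def twist_def frob_mat_entry[of _ n])
      ultimately show "frob_mat V $$ (i, j) = (V \<otimes>\<^bsub>?M\<^esub> P) $$ (i, j)" using k by simp
    qed (use Vc Pc in auto)
    then show thesis using that[of V] V False unfolding frob_GL_def mult_GL P_def by simp
  next
    case True
    define K where "K = V \<otimes>\<^bsub>?M\<^esub> (P \<otimes>\<^bsub>?M\<^esub> conj_transpose V)"
    have Kc: "K \<in> carrier ?M" using Vc Pc by (simp add: K_def)
    have inv_pow: "(t j [^] q) [^] a = inv t k [^] a" if "k < n" "j = w k" for j k a :: nat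
    proof -
      have "inv (t j [^] q) = t k" using tw[OF that(1)] that True by (simp add: twist_def)
      then have "inv t k = inv (inv (t j [^] q))" by simp
      also have "\<dots> = t j [^] q" using tu[of j] that by (intro Units_inv_inv) auto
      finally show ?thesis by simp
    qed
    \<comment> \<open>The entry is the sum of the powers \<open>t k ^ (a - b)\<close>, with a
      negative exponent written through the inverse.\<close>
    have K: "K $$ (a, b) = (\<Oplus>k\<in>{..<n}. t k [^] a \<otimes> inv t k [^] b)" if ab: "a < n" "b < n" for a b
    proof -
      have "(P \<otimes>\<^bsub>?M\<^esub> conj_transpose V) $$ (k, b) = inv t k [^] b" if k: "k < n" for k
        unfolding P_def using k ab Vc pow[of "w k" b] inv_pow[of k "w k" b]
        by (subst pmat_mult_entry) (auto simp: conj_transpose_entry[of _ n] V_def)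
      then show ?thesis unfolding K_def mat_monoid_entry(1)[OF ab]
        using ab tu by (intro finsum_cong') (auto simp: V_def Units_closed)
    qed
    have "K $$ (a, b) [^] q = K $$ (b, a)" if ab: "a < n" "b < n" for a b
    proof -
      have "K $$ (a, b) [^] q = (\<Oplus>k\<in>{..<n}. (t k [^] a \<otimes> inv t k [^] b) [^] q)"
        unfolding K[OF ab] using tu by (intro frob_finsum) (auto simp: Units_closed)
      \<comment> \<open>Summation over \<open>w k\<close> in place of \<open>k\<close> compensates
        the permutation: the \<open>q\<close>-power map takes \<open>t (w k)\<close> to the inverse
        of \<open>t k\<close>, which exchanges the roles of \<open>a\<close> and
        \<open>b\<close>.\<close>
      also have "\<dots> = (\<Oplus>k\<in>w ` {..<n}. (t k [^] a \<otimes> inv t k [^] b) [^] q)"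
        by (simp add: permutes_image[OF w])
      also have "\<dots> = (\<Oplus>k\<in>{..<n}. (t (w k) [^] a \<otimes> inv t (w k) [^] b) [^] q)"
        using tu permutes_inj_on[OF w]
        by (intro add.finprod_reindex) (auto simp: Units_closed permutes_image[OF w])
      also have "\<dots> = (\<Oplus>k\<in>{..<n}. t k [^] b \<otimes> inv t k [^] a)"
      proof (intro finsum_cong')
        fix k assume "k \<in> {..<n}"
        then have k: "k < n" "w k < n" by auto
        have "(inv t (w k) [^] b) [^] q = inv ((t (w k) [^] q) [^] b)"
          using tu[OF k(2)] pow[OF k(2), of b] frob_inv[of "t (w k) [^] b"]
          by (simp add: inv_pow_Units)
        also have "\<dots> = inv (inv t k [^] b)" using inv_pow[OF k(1) refl, of b] by simp
        also have "\<dots> = t k [^] b" using tu[OF k(1)] by (simp add: inv_pow_Units Units_inv_inv)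
        finally show "(t (w k) [^] a \<otimes> inv t (w k) [^] b) [^] q = t k [^] b \<otimes> inv t k [^] a"
          using tu k pow[OF k(2), of a] inv_pow[OF k(1) refl, of a]
          by (simp add: nat_pow_distrib Units_closed m_comm)
      qed (use tu in \<open>auto simp: Units_closed\<close>)
      finally show ?thesis using K[OF ab(2,1)] by simp
    qed
    then have "hermitian n K" using Kc by (simp add: hermitian_def)
    moreover have "K \<in> Units ?M"
      using V P conj_transpose_Units[of V n] unfolding K_def carrier_GL by (intro M.Units_m_closed)
    ultimately obtain h where h: "h \<in> Units ?M" "K = h \<otimes>\<^bsub>?M\<^esub> conj_transpose h"
      by (rule hermitian_factorization)
    have hG: "h \<in> carrier G" "conj_transpose h \<in> carrier G" using h conj_transpose_Units by (auto simp: carrier_GL)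
    define k where "k = inv\<^bsub>G\<^esub> h"
    have k: "k \<in> carrier G" "k \<otimes>\<^bsub>G\<^esub> h = \<one>\<^bsub>G\<^esub>" using hG by (auto simp: k_def)
    have ck: "conj_transpose k \<in> carrier G" "conj_transpose V \<in> carrier G"
      using k V by (auto simp: carrier_GL conj_transpose_Units)
    have "conj_transpose (k \<otimes>\<^bsub>G\<^esub> h) = conj_transpose h \<otimes>\<^bsub>G\<^esub> conj_transpose k"
      unfolding mult_GL using k hG by (intro conj_transpose_mult carrier_GL_closed)
    then have hk: "conj_transpose h \<otimes>\<^bsub>G\<^esub> conj_transpose k = \<one>\<^bsub>G\<^esub>"
      unfolding k(2) by (simp add: one_GL conj_transpose_one)
    \<comment> \<open>For \<open>K = V P V*\<close> and \<open>K = h h*\<close> the matrix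
      \<open>g = h^(-1) V\<close> satisfies \<open>g P g* = 1\<close>. Hence the inverse of
      \<open>g*\<close>, which is the image of \<open>g\<close> under the Frobenius map, is
      \<open>g P\<close>.\<close>
    define g where "g = k \<otimes>\<^bsub>G\<^esub> V"
    have g: "g \<in> carrier G" using k V by (simp add: g_def)
    have cg: "conj_transpose g = conj_transpose V \<otimes>\<^bsub>G\<^esub> conj_transpose k"
      unfolding g_def mult_GL using k V by (intro conj_transpose_mult carrier_GL_closed)
    have "g \<otimes>\<^bsub>G\<^esub> P \<otimes>\<^bsub>G\<^esub> conj_transpose g = k \<otimes>\<^bsub>G\<^esub> K \<otimes>\<^bsub>G\<^esub> conj_transpose k"
      unfolding cg unfolding g_def K_def mult_GL[symmetric] using k(1) V P ck by (simp add: G.m_assoc)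
    also have "\<dots> = (k \<otimes>\<^bsub>G\<^esub> h) \<otimes>\<^bsub>G\<^esub> (conj_transpose h \<otimes>\<^bsub>G\<^esub> conj_transpose k)"
      unfolding h(2) mult_GL[symmetric] using k(1) hG ck by (simp add: G.m_assoc)
    finally have "g \<otimes>\<^bsub>G\<^esub> P \<otimes>\<^bsub>G\<^esub> conj_transpose g = \<one>\<^bsub>G\<^esub>" unfolding k(2) hk by simp
    moreover have "conj_transpose g \<in> carrier G" using g by (simp add: carrier_GL conj_transpose_Units)
    ultimately have "inv\<^bsub>G\<^esub> (conj_transpose g) = g \<otimes>\<^bsub>G\<^esub> P"
      using g P by (intro G.inv_equality) auto
    then show thesis using that[OF g] True unfolding frob_GL_def P_def by simp
  qed
qed

text \<open>The image of \<open>g D g^(-1)\<close> is \<open>g P F(D) P^(-1) g^(-1)\<close>, and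
  moving \<open>P\<close> past the diagonal matrix \<open>F(D)\<close> permutes its entries by
  \<open>w\<close>. The torus equation is what remains after cancelling \<open>g\<close>.\<close>

lemma conj_dmat_fixed_iff:
  assumes g: "g \<in> carrier G" "frob_GL g = g \<otimes>\<^bsub>G\<^esub> pmat n w" and w: "w permutes {..<n}"
    and t: "\<And>i. i < n \<Longrightarrow> t i \<in> Units L"
  shows "g \<otimes>\<^bsub>G\<^esub> dmat n t \<otimes>\<^bsub>G\<^esub> inv\<^bsub>G\<^esub> g \<in> fixed_points \<longleftrightarrow> (\<forall>i<n. twist u (t (w i)) = t i)"
proof -
  let ?P = "pmat n w"
  have P: "?P \<in> carrier G" unfolding carrier_GL by (rule pmat_Units[OF w])
  have wl: "w i < n" if "i < n" for i using permutes_in_image[OF w, of i] that by auto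
  have D: "dmat n t \<in> carrier G" using t by (rule dmat_GL)
  let ?D1 = "dmat n (\<lambda>i. twist u (t i))" and ?D2 = "dmat n (\<lambda>i. twist u (t (w i)))"
  have D12: "?D1 \<in> carrier G" "?D2 \<in> carrier G" using t wl by (auto intro!: dmat_GL)
  have PD: "?P \<otimes>\<^bsub>G\<^esub> ?D1 = ?D2 \<otimes>\<^bsub>G\<^esub> ?P"
    unfolding mult_GL using t w by (intro pmat_dmat) (auto simp: Units_closed)
  have "frob_GL (g \<otimes>\<^bsub>G\<^esub> dmat n t \<otimes>\<^bsub>G\<^esub> inv\<^bsub>G\<^esub> g) = (g \<otimes>\<^bsub>G\<^esub> ?P) \<otimes>\<^bsub>G\<^esub> ?D1 \<otimes>\<^bsub>G\<^esub> inv\<^bsub>G\<^esub> (g \<otimes>\<^bsub>G\<^esub> ?P)"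
    using g D by (simp add: frob_GL_mult frob_GL_inv frob_GL_dmat[OF t])
  also have "\<dots> = g \<otimes>\<^bsub>G\<^esub> (?P \<otimes>\<^bsub>G\<^esub> ?D1) \<otimes>\<^bsub>G\<^esub> (inv\<^bsub>G\<^esub> ?P \<otimes>\<^bsub>G\<^esub> inv\<^bsub>G\<^esub> g)"
    using g P D12 by (simp add: G.m_assoc G.inv_mult_group)
  also have "\<dots> = g \<otimes>\<^bsub>G\<^esub> (?D2 \<otimes>\<^bsub>G\<^esub> (?P \<otimes>\<^bsub>G\<^esub> (inv\<^bsub>G\<^esub> ?P \<otimes>\<^bsub>G\<^esub> inv\<^bsub>G\<^esub> g)))"
    unfolding PD using g P D12 by (simp add: G.m_assoc)
  also have "?P \<otimes>\<^bsub>G\<^esub> (inv\<^bsub>G\<^esub> ?P \<otimes>\<^bsub>G\<^esub> inv\<^bsub>G\<^esub> g) = inv\<^bsub>G\<^esub> g"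
    using g P by (simp add: G.m_assoc[symmetric])
  finally have "frob_GL (g \<otimes>\<^bsub>G\<^esub> dmat n t \<otimes>\<^bsub>G\<^esub> inv\<^bsub>G\<^esub> g) = g \<otimes>\<^bsub>G\<^esub> ?D2 \<otimes>\<^bsub>G\<^esub> inv\<^bsub>G\<^esub> g"
    using g D12 by (simp add: G.m_assoc)
  moreover have "g \<otimes>\<^bsub>G\<^esub> ?D2 \<otimes>\<^bsub>G\<^esub> inv\<^bsub>G\<^esub> g = g \<otimes>\<^bsub>G\<^esub> dmat n t \<otimes>\<^bsub>G\<^esub> inv\<^bsub>G\<^esub> g \<longleftrightarrow> ?D2 = dmat n t"
    using g D D12 by simp
  moreover have "?D2 = dmat n t \<longleftrightarrow> (\<forall>i<n. twist u (t (w i)) = t i)"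
  proof
    assume eq: "?D2 = dmat n t"
    show "\<forall>i<n. twist u (t (w i)) = t i" using dmat_inj[OF eq] by simp
  qed (auto intro: dmat_cong)
  moreover have "g \<otimes>\<^bsub>G\<^esub> dmat n t \<otimes>\<^bsub>G\<^esub> inv\<^bsub>G\<^esub> g \<in> carrier G" using g D by simp
  ultimately show ?thesis by (simp add: fixed_points_def)
qed

end

section \<open>Counting regular elements through the tori\<close>

lemma card_inj_PiE_lessThan:
  fixes n :: nat
  assumes "finite E" "card E = n"
  shows "card {f \<in> {..<n} \<rightarrow>\<^sub>E E. inj_on f {..<n}} = fact n"
  using card_inj_on_subset_funcset[of "{..<n}" E "{..<n}"] assms by (simp add: fact_prod_rev)

context frobenius_GL
begin

text \<open>If every conjugate by a fixed point of \<open>g w (dmat t) (g w)\<inverse>\<close>, for \<open>t\<close> in \<open>S w\<close>, lies in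
  \<open>Y\<close>, then an element of \<open>Y\<close> arises from at most \<open>n!\<close> pairs \<open>(w, t)\<close>: its eigenvalues determine
  the set of values of \<open>t\<close>, and \<open>t\<close> determines \<open>w\<close>. A given pair occurs for at most \<open>|T w|\<close>
  conjugating elements.\<close>

lemma card_regular_conjugates:
  assumes g: "\<And>w. w permutes {..<n} \<Longrightarrow> g w \<in> carrier G \<and> frob_GL (g w) = g w \<otimes>\<^bsub>G\<^esub> pmat n w"
    and S: "\<And>w. w permutes {..<n} \<Longrightarrow> S w \<subseteq> {t \<in> torus u n w. inj_on t {..<n}}"
    and Y: "Y \<subseteq> fixed_points"
      "\<And>w t h. w permutes {..<n} \<Longrightarrow> t \<in> S w \<Longrightarrow> h \<in> fixed_points \<Longrightarrow>
        h \<otimes>\<^bsub>G\<^esub> (g w \<otimes>\<^bsub>G\<^esub> dmat n t \<otimes>\<^bsub>G\<^esub> inv\<^bsub>G\<^esub> g w) \<otimes>\<^bsub>G\<^esub> inv\<^bsub>G\<^esub> h \<in> Y"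
  shows "(\<Sum>w | w permutes {..<n}. real (card (S w)) / real (card (torus u n w))) * real (card fixed_points)
    \<le> fact n * real (card Y)"
proof -
  let ?W = "{w. w permutes {..<n}}"
  let ?\<Gamma> = "fixed_points"
  define c where "c w t = g w \<otimes>\<^bsub>G\<^esub> dmat n t \<otimes>\<^bsub>G\<^esub> inv\<^bsub>G\<^esub> g w" for w t
  define f where "f w t h = h \<otimes>\<^bsub>G\<^esub> c w t \<otimes>\<^bsub>G\<^esub> inv\<^bsub>G\<^esub> h" for w t h
  define N where "N w t y = {h \<in> ?\<Gamma>. f w t h = y}" for w t y
  have fW: "finite ?W" by (simp add: finite_permutations)
  have f\<Gamma>: "finite ?\<Gamma>" by (rule finite_fixed_points)
  have fY: "finite Y" using Y(1) f\<Gamma> finite_subset by blast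
  have \<Gamma>: "h \<in> carrier G" if "h \<in> ?\<Gamma>" for h using that by (simp add: fixed_points_def)
  have \<Gamma>m: "h \<otimes>\<^bsub>G\<^esub> k \<in> ?\<Gamma>" "inv\<^bsub>G\<^esub> h \<in> ?\<Gamma>" if "h \<in> ?\<Gamma>" "k \<in> ?\<Gamma>" for h k
    using that subgroup.m_closed[OF subgroup_fixed_points] subgroup.m_inv_closed[OF subgroup_fixed_points] by auto
  have T: "t \<in> torus u n w" "inj_on t {..<n}" "finite (torus u n w)" "card (torus u n w) > 0"
    "\<And>i. i < n \<Longrightarrow> t i \<in> Units L" "\<And>i. i < n \<Longrightarrow> t i \<in> carrier L" "dmat n t \<in> carrier G" "c w t \<in> carrier G"
    "g w \<in> carrier G"
    if "w \<in> ?W" "t \<in> S w" for w t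
  proof -
    interpret W: twisted_torus L p e q u n w using that by unfold_locales auto
    show t: "t \<in> torus u n w" "inj_on t {..<n}" "finite (torus u n w)" "card (torus u n w) > 0"
      using that S[of w] W.finite_torus W.card_torus_pos by auto
    show tu: "t i \<in> Units L" "t i \<in> carrier L" if "i < n" for i using W.torus_Units[OF t(1) that] by (auto simp: Units_closed)
    then show D: "dmat n t \<in> carrier G" by (intro dmat_GL)
    show gw: "g w \<in> carrier G" using g that by auto
    show "c w t \<in> carrier G" unfolding c_def using D gw by simp
  qed
  have fin_S: "finite (S w)" if "w \<in> ?W" for w
  proof -
    interpret W: twisted_torus L p e q u n w using that by unfold_locales auto
    show ?thesis using S[of w] W.finite_torus that finite_subset[of "S w" "torus u n w"] by auto
  qed
  \<comment> \<open>Two elements \<open>h\<close> and \<open>k\<close> of \<open>N w t y\<close>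
    differ by \<open>k^(-1) h\<close>, which centralizes \<open>c w t\<close>. Conjugated back by
    \<open>g w\<close> it commutes with a regular diagonal matrix, so it is diagonal and its entries
    form an element of the torus. For fixed \<open>k\<close> this injects \<open>N w t y\<close>
    into the torus.\<close>
  have card_N: "card (N w t y) \<le> card (torus u n w)" if wt: "w \<in> ?W" "t \<in> S w" for w t y
  proof (cases "N w t y = {}")
    case False
    then obtain k where k: "k \<in> ?\<Gamma>" "f w t k = y" by (auto simp: N_def)
    let ?G = "g w"
    note t = T[OF wt]
    define s where "s h = restrict (\<lambda>i. (inv\<^bsub>G\<^esub> ?G \<otimes>\<^bsub>G\<^esub> (inv\<^bsub>G\<^esub> k \<otimes>\<^bsub>G\<^esub> h) \<otimes>\<^bsub>G\<^esub> ?G) $$ (i, i)) {..<n}" for h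
    have s: "s h \<in> torus u n w \<and> h = k \<otimes>\<^bsub>G\<^esub> (?G \<otimes>\<^bsub>G\<^esub> dmat n (s h) \<otimes>\<^bsub>G\<^esub> inv\<^bsub>G\<^esub> ?G)" if "h \<in> N w t y" for h
    proof -
      have h: "h \<in> ?\<Gamma>" "f w t h = y" using that by (auto simp: N_def)
      define m where "m = inv\<^bsub>G\<^esub> k \<otimes>\<^bsub>G\<^esub> h"
      have m: "m \<in> ?\<Gamma>" "m \<in> carrier G" using h k \<Gamma> \<Gamma>m by (auto simp: m_def)
      have hm: "h = k \<otimes>\<^bsub>G\<^esub> m" using h k \<Gamma> by (simp add: m_def G.m_assoc[symmetric])
      have "k \<otimes>\<^bsub>G\<^esub> (m \<otimes>\<^bsub>G\<^esub> c w t \<otimes>\<^bsub>G\<^esub> inv\<^bsub>G\<^esub> m) \<otimes>\<^bsub>G\<^esub> inv\<^bsub>G\<^esub> k = k \<otimes>\<^bsub>G\<^esub> c w t \<otimes>\<^bsub>G\<^esub> inv\<^bsub>G\<^esub> k"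
        using h(2) k(2) k(1)[THEN \<Gamma>] m t unfolding f_def hm by (simp add: G.m_assoc G.inv_mult_group)
      then have "m \<otimes>\<^bsub>G\<^esub> c w t \<otimes>\<^bsub>G\<^esub> inv\<^bsub>G\<^esub> m = c w t" using k(1)[THEN \<Gamma>] m t by simp
      then have mc: "m \<otimes>\<^bsub>G\<^esub> c w t = c w t \<otimes>\<^bsub>G\<^esub> m" using m t by (metis G.inv_solve_right G.m_closed)
      define a where "a = inv\<^bsub>G\<^esub> ?G \<otimes>\<^bsub>G\<^esub> m \<otimes>\<^bsub>G\<^esub> ?G"
      have a: "a \<in> carrier G" using m t by (simp add: a_def)
      have "a \<otimes>\<^bsub>G\<^esub> dmat n t = inv\<^bsub>G\<^esub> ?G \<otimes>\<^bsub>G\<^esub> (m \<otimes>\<^bsub>G\<^esub> c w t) \<otimes>\<^bsub>G\<^esub> ?G"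
        unfolding a_def c_def using m t by (simp add: G.m_assoc)
      also have "\<dots> = dmat n t \<otimes>\<^bsub>G\<^esub> a"
        unfolding mc unfolding a_def c_def using m t by (simp add: G.m_assoc[symmetric])
      finally have "a = dmat n (\<lambda>i. a $$ (i, i))"
        using a t by (intro commute_dmat) (auto simp: mult_GL carrier_GL_closed)
      then have ad: "a = dmat n (s h)"
        using dmat_cong[of "s h" "\<lambda>i. a $$ (i, i)"] by (simp add: s_def a_def m_def)
      have mg: "m = ?G \<otimes>\<^bsub>G\<^esub> dmat n (s h) \<otimes>\<^bsub>G\<^esub> inv\<^bsub>G\<^esub> ?G"
        unfolding ad[symmetric] a_def using m t by (simp add: G.m_assoc) (simp add: G.m_assoc[symmetric])
      have sc: "s h i \<in> carrier L" if "i < n" for i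
      proof -
        have "s h i = a $$ (i, i)" using that by (simp add: s_def a_def m_def)
        then show ?thesis using carrier_GL_closed[OF a] that by simp
      qed
      have su: "s h i \<in> Units L" if "i < n" for i
        using a sc that dmat_Units_iff[of n "s h"] unfolding ad carrier_GL by (auto simp: field_Units)
      have "\<forall>i<n. twist u (s h (w i)) = s h i"
        using conj_dmat_fixed_iff[of ?G w "s h"] g wt m(1) su unfolding mg by auto
      then have "s h \<in> torus u n w" using su by (auto simp: torus_def s_def)
      then show ?thesis unfolding mg[symmetric] using hm by blast
    qed
    have "inj_on s (N w t y)" using s by (metis inj_onI)
    moreover have "s ` N w t y \<subseteq> torus u n w" using s by blast
    ultimately show ?thesis using t(3) by (rule card_inj_on_le)
  qed simp
  define B where "B y = {(w, t). w \<in> ?W \<and> t \<in> S w \<and> N w t y \<noteq> {}}" for y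
  have B_sub: "B y \<subseteq> Sigma ?W S" for y by (auto simp: B_def)
  have fin_B: "finite (B y)" for y using finite_subset[OF B_sub] fW fin_S by auto
  have vals: "t ` {..<n} \<subseteq> t' ` {..<n}" if 1: "(w, t) \<in> B y" and 2: "(w', t') \<in> B y" for w t w' t' y
  proof -
    obtain h h' where h: "h \<in> ?\<Gamma>" "f w t h = y" "h' \<in> ?\<Gamma>" "f w' t' h' = y"
      using 1 2 by (auto simp: B_def N_def)
    have wt: "w \<in> ?W" "t \<in> S w" "w' \<in> ?W" "t' \<in> S w'" using 1 2 by (auto simp: B_def)
    note t = T[OF wt(1,2)] and t' = T[OF wt(3,4)]
    define a where "a = h \<otimes>\<^bsub>G\<^esub> g w"
    define b where "b = h' \<otimes>\<^bsub>G\<^esub> g w'"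
    have ab: "a \<in> carrier G" "b \<in> carrier G" using h \<Gamma> t t' by (auto simp: a_def b_def)
    have "a \<otimes>\<^bsub>G\<^esub> dmat n t \<otimes>\<^bsub>G\<^esub> inv\<^bsub>G\<^esub> a = b \<otimes>\<^bsub>G\<^esub> dmat n t' \<otimes>\<^bsub>G\<^esub> inv\<^bsub>G\<^esub> b"
      using h(2,4) h(1,3)[THEN \<Gamma>] t t' unfolding f_def c_def a_def b_def by (simp add: G.m_assoc G.inv_mult_group)
    then have *: "a \<otimes>\<^bsub>G\<^esub> dmat n t = b \<otimes>\<^bsub>G\<^esub> dmat n t' \<otimes>\<^bsub>G\<^esub> inv\<^bsub>G\<^esub> b \<otimes>\<^bsub>G\<^esub> a"
      using ab t t' by (metis G.inv_closed G.inv_solve_right G.m_closed)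
    have "dmat n t \<otimes>\<^bsub>G\<^esub> (inv\<^bsub>G\<^esub> a \<otimes>\<^bsub>G\<^esub> b) = inv\<^bsub>G\<^esub> a \<otimes>\<^bsub>G\<^esub> (a \<otimes>\<^bsub>G\<^esub> dmat n t) \<otimes>\<^bsub>G\<^esub> (inv\<^bsub>G\<^esub> a \<otimes>\<^bsub>G\<^esub> b)"
      using ab t by (simp add: G.m_assoc[symmetric])
    also have "\<dots> = (inv\<^bsub>G\<^esub> a \<otimes>\<^bsub>G\<^esub> b) \<otimes>\<^bsub>G\<^esub> dmat n t'"
    proof -
      have "a \<otimes>\<^bsub>G\<^esub> (inv\<^bsub>G\<^esub> a \<otimes>\<^bsub>G\<^esub> b) = b" using ab by (simp add: G.m_assoc[symmetric])
      then show ?thesis unfolding * using ab t'(7) by (simp add: G.m_assoc)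
    qed
    finally show ?thesis
      using ab t t' by (intro intertwiner_image_subset[of "inv\<^bsub>G\<^esub> a \<otimes>\<^bsub>G\<^esub> b"])
        (auto simp: mult_GL[symmetric] carrier_GL[symmetric])
  qed
  have card_B: "card (B y) \<le> fact n" for y
  proof (cases "B y = {}")
    case False
    then obtain w0 t0 where 0: "(w0, t0) \<in> B y" by auto
    let ?E = "t0 ` {..<n}"
    have inj0: "inj_on t0 {..<n}" using T(2)[of w0 t0] 0 by (auto simp: B_def)
    have E: "finite ?E" "card ?E = n" using inj0 by (auto simp: card_image)
    have "inj_on snd (B y)"
    proof (rule inj_onI)
      fix z z' assume z: "z \<in> B y" "z' \<in> B y" "snd z = snd z'"
      obtain w t w' where zz: "z = (w, t)" "z' = (w', t)" using z(3) by (cases z, cases z') auto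
      have wt: "w permutes {..<n}" "w' permutes {..<n}" "t \<in> S w" "t \<in> S w'"
        using z unfolding zz B_def by auto
      have t: "t \<in> torus u n w" "t \<in> torus u n w'" "inj_on t {..<n}" using S wt by auto
      \<comment> \<open>If \<open>w a = j\<close> and \<open>w' b = j\<close>, the torus equations
        for \<open>w\<close> and \<open>w'\<close> give \<open>t a = twist u (t j) = t b\<close>, so
        \<open>a = b\<close> by regularity.\<close>
      have "inv_into UNIV w j = inv_into UNIV w' j" for j
      proof (cases "j < n")
        case True
        let ?a = "inv_into UNIV w j" and ?b = "inv_into UNIV w' j"
        have ab: "?a < n" "?b < n" "w ?a = j" "w' ?b = j"
          using permutes_in_image[OF permutes_inv[OF wt(1)], of j] permutes_in_image[OF permutes_inv[OF wt(2)], of j]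
            permutes_inverses(1)[OF wt(1)] permutes_inverses(1)[OF wt(2)] True by auto
        have tw: "twist u (t (v i)) = t i" if "t \<in> torus u n v" "i < n" for v i
          using that by (simp add: torus_def)
        have "t ?a = t ?b" using tw[OF t(1) ab(1)] tw[OF t(2) ab(2)] unfolding ab(3,4) by simp
        then show ?thesis using t(3) ab by (auto simp: inj_on_def)
      next
        case False
        then show ?thesis using permutes_not_in[OF permutes_inv[OF wt(1)], of j] permutes_not_in[OF permutes_inv[OF wt(2)], of j] by simp
      qed
      then have "w = w'" using permutes_inv_inv[OF wt(1)] permutes_inv_inv[OF wt(2)] by (metis ext)
      then show "z = z'" using zz by simp
    qed
    \<comment> \<open>By \<open>vals\<close> all values of \<open>t\<close> lie among the
      \<open>n\<close> values of the fixed \<open>t0\<close>, so \<open>t\<close> is one of the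
      \<open>n!\<close> injections into that set.\<close>
    moreover have "snd ` B y \<subseteq> {f \<in> {..<n} \<rightarrow>\<^sub>E ?E. inj_on f {..<n}}"
    proof
      fix t assume "t \<in> snd ` B y"
      then obtain w where w: "(w, t) \<in> B y" by auto
      then have wt: "w \<in> ?W" "t \<in> S w" by (auto simp: B_def)
      have "t \<in> extensional {..<n}" using T(1)[OF wt] by (auto simp: torus_def PiE_iff)
      then show "t \<in> {f \<in> {..<n} \<rightarrow>\<^sub>E ?E. inj_on f {..<n}}"
        using vals[OF w 0] T(2)[OF wt] by (auto simp: PiE_iff)
    qed
    moreover have "finite {f \<in> {..<n} \<rightarrow>\<^sub>E ?E. inj_on f {..<n}}"
      using finite_PiE[of "{..<n}" "\<lambda>_. ?E"] by simp
    ultimately have "card (B y) \<le> card {f \<in> {..<n} \<rightarrow>\<^sub>E ?E. inj_on f {..<n}}" by (rule card_inj_on_le)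
    then show ?thesis unfolding card_inj_PiE_lessThan[OF E] .
  qed simp
  have split: "(\<Sum>y\<in>Y. real (card (N w t y))) = real (card ?\<Gamma>)" if wt: "w \<in> ?W" "t \<in> S w" for w t
  proof -
    have "f w t ` ?\<Gamma> \<subseteq> Y" using Y(2)[of w t] wt by (auto simp: f_def c_def)
    then have "(\<Sum>y\<in>Y. \<Sum>h\<in>N w t y. 1) = (\<Sum>h\<in>?\<Gamma>. 1::real)"
      unfolding N_def using f\<Gamma> fY by (intro sum.group) auto
    then show ?thesis by simp
  qed
  \<comment> \<open>Double counting of the triples of \<open>w\<close>, \<open>t\<close> and
    \<open>h\<close>, weighted by the reciprocal order of the torus and sorted by the element
    \<open>y\<close> that they produce. Each pair in \<open>B y\<close> then has weight at most
    1.\<close>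
  have "(\<Sum>w\<in>?W. real (card (S w)) / real (card (torus u n w))) * real (card ?\<Gamma>)
      = (\<Sum>w\<in>?W. \<Sum>t\<in>S w. real (card ?\<Gamma>) / real (card (torus u n w)))"
    by (simp add: sum_distrib_right)
  also have "\<dots> = (\<Sum>z\<in>Sigma ?W S. real (card ?\<Gamma>) / real (card (torus u n (fst z))))"
    using fW fin_S by (subst sum.Sigma) (auto simp: case_prod_beta)
  also have "\<dots> = (\<Sum>z\<in>Sigma ?W S. \<Sum>y\<in>Y. real (card (N (fst z) (snd z) y)) / real (card (torus u n (fst z))))"
    by (intro sum.cong refl) (auto simp: sum_divide_distrib[symmetric] split)
  also have "\<dots> = (\<Sum>y\<in>Y. \<Sum>z\<in>Sigma ?W S. real (card (N (fst z) (snd z) y)) / real (card (torus u n (fst z))))"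
    by (rule sum.swap)
  also have "\<dots> = (\<Sum>y\<in>Y. \<Sum>z\<in>B y. real (card (N (fst z) (snd z) y)) / real (card (torus u n (fst z))))"
    using fW fin_S B_sub by (intro sum.cong refl sum.mono_neutral_right) (auto simp: B_def)
  also have "\<dots> \<le> (\<Sum>y\<in>Y. \<Sum>z\<in>B y. 1)"
  proof (intro sum_mono)
    fix y z assume "z \<in> B y"
    then have "fst z \<in> ?W" "snd z \<in> S (fst z)" by (auto simp: B_def)
    then show "real (card (N (fst z) (snd z) y)) / real (card (torus u n (fst z))) \<le> 1"
      using card_N T(4) by (simp add: divide_le_eq_1)
  qed
  also have "\<dots> \<le> (\<Sum>y\<in>Y. fact n)"
  proof (intro sum_mono)
    fix y
    have "real (card (B y)) \<le> real (fact n)" using card_B by (intro of_nat_mono)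
    then show "(\<Sum>z\<in>B y. 1) \<le> (fact n :: real)" by simp
  qed
  finally show ?thesis by (simp add: mult.commute)
qed

lemma squares_proportion:
  assumes big: "q > 4 * n\<^sup>2"
  shows "\<bar>real (card {y \<otimes>\<^bsub>G\<^esub> y | y. y \<in> fixed_points}) / real (card fixed_points)
    - (\<Sum>w | w permutes {..<n}. 1 / 2 ^ card (orbit w ` {..<n})) / fact n\<bar> \<le> 4 * real n ^ 2 / real q"
proof -
  let ?W = "{w. w permutes {..<n}}"
  let ?\<Gamma> = "fixed_points"
  define Q where "Q = {y \<otimes>\<^bsub>G\<^esub> y | y. y \<in> ?\<Gamma>}"
  define \<epsilon> where "\<epsilon> = 4 * real n ^ 2 / real q"
  define c where "c w = 1 / (2::real) ^ card (orbit w ` {..<n})" for w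
  have "\<forall>w. \<exists>g. w permutes {..<n} \<longrightarrow> g \<in> carrier G \<and> frob_GL g = g \<otimes>\<^bsub>G\<^esub> pmat n w"
    using ex_lang[OF big] by metis
  then obtain g where g: "\<And>w. w permutes {..<n} \<Longrightarrow> g w \<in> carrier G \<and> frob_GL (g w) = g w \<otimes>\<^bsub>G\<^esub> pmat n w"
    by metis
  have \<Gamma>: "h \<in> carrier G" if "h \<in> ?\<Gamma>" for h using that by (simp add: fixed_points_def)
  have \<Gamma>m: "h \<otimes>\<^bsub>G\<^esub> k \<in> ?\<Gamma>" "inv\<^bsub>G\<^esub> h \<in> ?\<Gamma>" if "h \<in> ?\<Gamma>" "k \<in> ?\<Gamma>" for h k
    using that subgroup.m_closed[OF subgroup_fixed_points] subgroup.m_inv_closed[OF subgroup_fixed_points] by auto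
  have Q: "Q \<subseteq> ?\<Gamma>" using \<Gamma>m by (auto simp: Q_def)
  let ?cc = "\<lambda>w t. g w \<otimes>\<^bsub>G\<^esub> dmat n t \<otimes>\<^bsub>G\<^esub> inv\<^bsub>G\<^esub> g w"
  have conj_in: "?cc w t \<in> ?\<Gamma>" "dmat n t \<in> carrier G" "\<And>i. i < n \<Longrightarrow> t i \<in> Units L"
    if wt: "w permutes {..<n}" "t \<in> torus u n w" for w t
  proof -
    interpret W: twisted_torus L p e q u n w using wt by unfold_locales
    have tu: "t i \<in> Units L" if "i < n" for i using W.torus_Units[OF wt(2) that] .
    then show "\<And>i. i < n \<Longrightarrow> t i \<in> Units L" "dmat n t \<in> carrier G" by (auto intro: dmat_GL)
    show "?cc w t \<in> ?\<Gamma>" using conj_dmat_fixed_iff[of "g w" w t] g wt tu by (auto simp: torus_def)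
  qed
  define S1 where "S1 w = {t \<in> twisted_torus.torus_squares L q u n w. inj_on t {..<n}}" for w
  define S2 where "S2 w = {t \<in> torus u n w - twisted_torus.torus_squares L q u n w. inj_on t {..<n}}" for w
  have lower: "c w - \<epsilon> \<le> real (card (S1 w)) / real (card (torus u n w))"
    "1 - c w - \<epsilon> \<le> real (card (S2 w)) / real (card (torus u n w))"
    "S1 w \<subseteq> {t \<in> torus u n w. inj_on t {..<n}}"
    "\<And>t. t \<in> S1 w \<longleftrightarrow> (\<exists>s\<in>torus u n w. t = torus_mult n s s) \<and> inj_on t {..<n}"
    "S2 w = {t \<in> torus u n w. \<not> (\<exists>s\<in>torus u n w. t = torus_mult n s s) \<and> inj_on t {..<n}}"
    if "w permutes {..<n}" for w
  proof -
    interpret W: twisted_torus L p e q u n w using that by unfold_locales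
    show "c w - \<epsilon> \<le> real (card (S1 w)) / real (card (torus u n w))"
      "1 - c w - \<epsilon> \<le> real (card (S2 w)) / real (card (torus u n w))"
      using W.card_regular_torus_squares unfolding S1_def S2_def c_def \<epsilon>_def by auto
    show "S1 w \<subseteq> {t \<in> torus u n w. inj_on t {..<n}}" using W.torus_squares_subset by (auto simp: S1_def)
    show "\<And>t. t \<in> S1 w \<longleftrightarrow> (\<exists>s\<in>torus u n w. t = torus_mult n s s) \<and> inj_on t {..<n}"
      "S2 w = {t \<in> torus u n w. \<not> (\<exists>s\<in>torus u n w. t = torus_mult n s s) \<and> inj_on t {..<n}}"
      by (auto simp: S1_def S2_def W.torus_squares_def)
  qed
  have sq_conj: "?cc w s \<otimes>\<^bsub>G\<^esub> ?cc w s = ?cc w (torus_mult n s s)"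
    if w: "w permutes {..<n}" and s: "\<And>i. i < n \<Longrightarrow> s i \<in> Units L" for w s
  proof -
    have gw: "g w \<in> carrier G" using g[OF w] by simp
    have D: "dmat n s \<in> carrier G" using s by (rule dmat_GL)
    have "?cc w s \<otimes>\<^bsub>G\<^esub> ?cc w s = g w \<otimes>\<^bsub>G\<^esub> (dmat n s \<otimes>\<^bsub>G\<^esub> dmat n s) \<otimes>\<^bsub>G\<^esub> inv\<^bsub>G\<^esub> g w"
      using gw D by (simp add: G.m_assoc) (simp add: G.m_assoc[symmetric])
    also have "dmat n s \<otimes>\<^bsub>G\<^esub> dmat n s = dmat n (torus_mult n s s)"
      using s by (subst dmat_mult_GL) (auto intro!: dmat_cong simp: torus_mult_def)
    finally show ?thesis .
  qed
  have conj_sq: "h \<otimes>\<^bsub>G\<^esub> (a \<otimes>\<^bsub>G\<^esub> a) \<otimes>\<^bsub>G\<^esub> inv\<^bsub>G\<^esub> h = (h \<otimes>\<^bsub>G\<^esub> a \<otimes>\<^bsub>G\<^esub> inv\<^bsub>G\<^esub> h) \<otimes>\<^bsub>G\<^esub> (h \<otimes>\<^bsub>G\<^esub> a \<otimes>\<^bsub>G\<^esub> inv\<^bsub>G\<^esub> h)"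
    if "h \<in> carrier G" "a \<in> carrier G" for h a
    using that by (simp add: G.m_assoc) (simp add: G.m_assoc[symmetric])
  have canc: "inv\<^bsub>G\<^esub> a \<otimes>\<^bsub>G\<^esub> (a \<otimes>\<^bsub>G\<^esub> b) = b" if "a \<in> carrier G" "b \<in> carrier G" for a b
    using that by (simp add: G.m_assoc[symmetric])
  have Y1: "h \<otimes>\<^bsub>G\<^esub> ?cc w t \<otimes>\<^bsub>G\<^esub> inv\<^bsub>G\<^esub> h \<in> Q"
    if wt: "w permutes {..<n}" "t \<in> S1 w" and h: "h \<in> ?\<Gamma>" for w t h
  proof -
    obtain s where s: "s \<in> torus u n w" "t = torus_mult n s s" using lower(4)[OF wt(1)] wt(2) by auto
    have cs: "?cc w s \<in> ?\<Gamma>" using conj_in[OF wt(1) s(1)] by simp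
    have "h \<otimes>\<^bsub>G\<^esub> ?cc w t \<otimes>\<^bsub>G\<^esub> inv\<^bsub>G\<^esub> h = h \<otimes>\<^bsub>G\<^esub> (?cc w s \<otimes>\<^bsub>G\<^esub> ?cc w s) \<otimes>\<^bsub>G\<^esub> inv\<^bsub>G\<^esub> h"
      unfolding s(2) using sq_conj[OF wt(1)] conj_in(3)[OF wt(1) s(1)] by simp
    also have "\<dots> = (h \<otimes>\<^bsub>G\<^esub> ?cc w s \<otimes>\<^bsub>G\<^esub> inv\<^bsub>G\<^esub> h) \<otimes>\<^bsub>G\<^esub> (h \<otimes>\<^bsub>G\<^esub> ?cc w s \<otimes>\<^bsub>G\<^esub> inv\<^bsub>G\<^esub> h)"
      using conj_sq[OF \<Gamma>[OF h] \<Gamma>[OF cs]] .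
    finally show ?thesis unfolding Q_def mem_Collect_eq
      using \<Gamma>m(1)[OF \<Gamma>m(1)[OF h cs] \<Gamma>m(2)[OF h h]] by (intro exI conjI)
  qed
  have Y2: "h \<otimes>\<^bsub>G\<^esub> ?cc w t \<otimes>\<^bsub>G\<^esub> inv\<^bsub>G\<^esub> h \<in> ?\<Gamma> - Q"
    if w: "w permutes {..<n}" and t: "t \<in> S2 w" and h: "h \<in> ?\<Gamma>" for w t h
  proof
    have tT: "t \<in> torus u n w" "inj_on t {..<n}" "\<not> (\<exists>s\<in>torus u n w. t = torus_mult n s s)"
      using lower(5)[OF w] t by auto
    note ct = conj_in[OF w tT(1)]
    have gw: "g w \<in> carrier G" using g[OF w] by simp
    have hG: "h \<in> carrier G" using \<Gamma> h by simp
    show "h \<otimes>\<^bsub>G\<^esub> ?cc w t \<otimes>\<^bsub>G\<^esub> inv\<^bsub>G\<^esub> h \<in> ?\<Gamma>" by (rule \<Gamma>m(1)[OF \<Gamma>m(1)[OF h ct(1)] \<Gamma>m(2)[OF h h]])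
    show "h \<otimes>\<^bsub>G\<^esub> ?cc w t \<otimes>\<^bsub>G\<^esub> inv\<^bsub>G\<^esub> h \<notin> Q"
    proof
      assume "h \<otimes>\<^bsub>G\<^esub> ?cc w t \<otimes>\<^bsub>G\<^esub> inv\<^bsub>G\<^esub> h \<in> Q"
      then obtain y where y: "y \<in> ?\<Gamma>" "h \<otimes>\<^bsub>G\<^esub> ?cc w t \<otimes>\<^bsub>G\<^esub> inv\<^bsub>G\<^esub> h = y \<otimes>\<^bsub>G\<^esub> y" by (auto simp: Q_def)
      define z where "z = inv\<^bsub>G\<^esub> h \<otimes>\<^bsub>G\<^esub> y \<otimes>\<^bsub>G\<^esub> h"
      have z\<Gamma>: "z \<in> ?\<Gamma>" unfolding z_def by (rule \<Gamma>m(1)[OF \<Gamma>m(1)[OF \<Gamma>m(2)[OF h h] y(1)] h])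
      have z: "z \<in> carrier G" using \<Gamma>[OF z\<Gamma>] .
      have "z \<otimes>\<^bsub>G\<^esub> z = inv\<^bsub>G\<^esub> h \<otimes>\<^bsub>G\<^esub> (y \<otimes>\<^bsub>G\<^esub> y) \<otimes>\<^bsub>G\<^esub> h"
        using conj_sq[of "inv\<^bsub>G\<^esub> h" y] hG \<Gamma>[OF y(1)] by (simp add: z_def)
      also have "\<dots> = ?cc w t"
        unfolding y(2)[symmetric] using hG gw ct(2) by (simp add: G.m_assoc canc)
      finally have zz: "z \<otimes>\<^bsub>G\<^esub> z = ?cc w t" .
      \<comment> \<open>Undoing the conjugation by \<open>g w\<close> makes \<open>z\<close> a
        square root \<open>a\<close> of the regular matrix \<open>dmat n t\<close>. It commutes with
        its square, so it is diagonal; as \<open>z\<close> is a fixed point, its entries form an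
        element of the torus with square \<open>t\<close>.\<close>
      define a where "a = inv\<^bsub>G\<^esub> g w \<otimes>\<^bsub>G\<^esub> z \<otimes>\<^bsub>G\<^esub> g w"
      have a: "a \<in> carrier G" using z gw by (simp add: a_def)
      have zg: "z = g w \<otimes>\<^bsub>G\<^esub> a \<otimes>\<^bsub>G\<^esub> inv\<^bsub>G\<^esub> g w"
        unfolding a_def using z gw by (simp add: G.m_assoc) (simp add: G.m_assoc[symmetric])
      have "a \<otimes>\<^bsub>G\<^esub> a = inv\<^bsub>G\<^esub> g w \<otimes>\<^bsub>G\<^esub> (z \<otimes>\<^bsub>G\<^esub> z) \<otimes>\<^bsub>G\<^esub> g w"
        using conj_sq[of "inv\<^bsub>G\<^esub> g w" z] gw z by (simp add: a_def)
      also have "\<dots> = dmat n t" unfolding zz using gw ct(2) by (simp add: G.m_assoc canc)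
      finally have aa: "a \<otimes>\<^bsub>G\<^esub> a = dmat n t" .
      then have "dmat n t \<otimes>\<^bsub>G\<^esub> a = a \<otimes>\<^bsub>G\<^esub> dmat n t" using a by (metis G.m_assoc)
      then have "a = dmat n (\<lambda>i. a $$ (i, i))"
        using a tT(2) ct(3) by (intro commute_dmat) (auto simp: mult_GL carrier_GL_closed Units_closed)
      moreover define s where "s = restrict (\<lambda>i. a $$ (i, i)) {..<n}"
      ultimately have ad: "a = dmat n s" using dmat_cong[of s "\<lambda>i. a $$ (i, i)"] by simp
      have su: "s i \<in> Units L" if "i < n" for i
      proof -
        have "s j \<in> carrier L" if "j < n" for j using carrier_GL_closed[OF a] that by (simp add: s_def)
        then show ?thesis using a that dmat_Units_iff[of n s] unfolding ad carrier_GL by (auto simp: field_Units)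
      qed
      have "\<forall>i<n. twist u (s (w i)) = s i"
        using conj_dmat_fixed_iff[of "g w" w s] g[OF w] w z\<Gamma> su unfolding zg ad by auto
      then have sT: "s \<in> torus u n w" using su by (auto simp: torus_def s_def)
      have "dmat n t = dmat n (\<lambda>i. s i \<otimes> s i)" using aa dmat_mult_GL[of s s] su unfolding ad by simp
      then have "t i = s i \<otimes> s i" if "i < n" for i using dmat_inj that by metis
      then have "t = torus_mult n s s"
        using tT(1) by (intro ext) (auto simp: torus_mult_def torus_def PiE_iff extensional_def)
      then show False using tT(3) sT by blast
    qed
  qed
  have f\<Gamma>: "finite ?\<Gamma>" by (rule finite_fixed_points)
  have pos: "real (card ?\<Gamma>) > 0"
    using f\<Gamma> subgroup.one_closed[OF subgroup_fixed_points] by (auto simp: card_gt_0_iff)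
  have cW: "card ?W = fact n" using card_permutations[of "{..<n}" n] by simp
  have "(\<Sum>w\<in>?W. real (card (S1 w)) / real (card (torus u n w))) * real (card ?\<Gamma>) \<le> fact n * real (card Q)"
    using lower(3) Y1 Q by (intro card_regular_conjugates[of g S1]) (auto simp: g)
  moreover have "(\<Sum>w\<in>?W. c w - \<epsilon>) \<le> (\<Sum>w\<in>?W. real (card (S1 w)) / real (card (torus u n w)))"
    using lower(1) by (intro sum_mono) auto
  ultimately have "(\<Sum>w\<in>?W. c w - \<epsilon>) * real (card ?\<Gamma>) \<le> fact n * real (card Q)"
    using pos by (meson mult_right_mono less_imp_le order_trans)
  then have 1: "(\<Sum>w\<in>?W. c w - \<epsilon>) / fact n \<le> real (card Q) / real (card ?\<Gamma>)"
    using pos by (simp add: field_simps)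
  have "(\<Sum>w\<in>?W. real (card (S2 w)) / real (card (torus u n w))) * real (card ?\<Gamma>) \<le> fact n * real (card (?\<Gamma> - Q))"
    using lower(5) Y2 by (intro card_regular_conjugates[of g S2]) (auto simp: g)
  moreover have "(\<Sum>w\<in>?W. 1 - c w - \<epsilon>) \<le> (\<Sum>w\<in>?W. real (card (S2 w)) / real (card (torus u n w)))"
    using lower(2) by (intro sum_mono) auto
  ultimately have "(\<Sum>w\<in>?W. 1 - c w - \<epsilon>) * real (card ?\<Gamma>) \<le> fact n * real (card (?\<Gamma> - Q))"
    using pos by (meson mult_right_mono less_imp_le order_trans)
  moreover have "real (card (?\<Gamma> - Q)) = real (card ?\<Gamma>) - real (card Q)"
    using Q f\<Gamma> card_mono[OF f\<Gamma> Q] by (subst card_Diff_subset) (auto simp: finite_subset of_nat_diff)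
  \<comment> \<open>There are \<open>n!\<close> permutations, so both \<open>1\<close> and
    \<open>2\<close> bound by averages of \<open>c w\<close>; the complement turns the second into
    an upper bound for \<open>Q\<close>.\<close>
  ultimately have 2: "(\<Sum>w\<in>?W. 1 - c w - \<epsilon>) / fact n \<le> 1 - real (card Q) / real (card ?\<Gamma>)"
    using pos by (simp add: field_simps)
  have "(\<Sum>w\<in>?W. c w - \<epsilon>) / fact n = (\<Sum>w\<in>?W. c w) / fact n - \<epsilon>"
    by (simp add: sum_subtractf cW diff_divide_distrib)
  moreover have "(\<Sum>w\<in>?W. 1 - c w - \<epsilon>) / fact n = 1 - (\<Sum>w\<in>?W. c w) / fact n - \<epsilon>"
    by (simp add: sum_subtractf cW diff_divide_distrib)
  ultimately have "\<bar>real (card Q) / real (card ?\<Gamma>) - (\<Sum>w\<in>?W. c w) / fact n\<bar> \<le> \<epsilon>"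
    using 1 2 by (simp add: abs_le_iff)
  then show ?thesis unfolding Q_def c_def \<epsilon>_def .
qed

end

section \<open>Cycle types of permutations\<close>

lemma card_orbit_pos:
  assumes "w permutes S" "finite S"
  shows "card (orbit w i) = funpow_dist1 w i i" "card (orbit w i) > 0" "finite (orbit w i)"
    "(w ^^ card (orbit w i)) i = i" "i \<in> orbit w i"
proof -
  have "permutation w" using assms by (auto simp: permutation_permutes)
  then show s: "i \<in> orbit w i" by (rule permutation_self_in_orbit)
  show c: "card (orbit w i) = funpow_dist1 w i i"
    unfolding orbit_conv_funpow_dist1[OF s] using inj_on_funpow_dist1[OF s] by (simp add: card_image)
  show "card (orbit w i) > 0" "(w ^^ card (orbit w i)) i = i"
    unfolding c using funpow_dist1_prop[OF s] by auto
  then show "finite (orbit w i)" by (metis card.infinite less_numeral_extra(3))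
qed

lemma orbit_eq_or_disjoint:
  assumes "w permutes S" "finite S" "j \<in> orbit w i"
  shows "orbit w j = orbit w i"
  using orbit_cyclic_eq3[OF cyclic_on_orbit[OF assms(1,2)] assms(3)] .

lemma funpow_eq_iff_mod_orbit:
  assumes "w permutes S" "finite S"
  shows "(w ^^ a) i = (w ^^ b) i \<longleftrightarrow> a mod card (orbit w i) = b mod card (orbit w i)"
proof -
  note c = card_orbit_pos[OF assms, of i]
  have "(w ^^ m) i = (w ^^ (m mod card (orbit w i))) i" for m
    using funpow_mod_eq[OF c(4)] by simp
  moreover have "inj_on (\<lambda>m. (w ^^ m) i) {0..<card (orbit w i)}"
    unfolding c(1) by (rule inj_on_funpow_dist1[OF c(5)])
  moreover have "m mod card (orbit w i) \<in> {0..<card (orbit w i)}" for m using c(2) by simp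
  ultimately show ?thesis by (metis inj_on_eq_iff)
qed

lemma cycle_type_in_partitions:
  assumes w: "w permutes {1..n}"
  shows "cycle_type n w \<in> partitions n" "size (cycle_type n w) = card (orbit w ` {1..n})"
proof -
  let ?O = "orbit w ` {1..n}"
  show "size (cycle_type n w) = card ?O" by (simp add: cycle_type_def)
  have pos: "card B > 0" "finite B" if "B \<in> ?O" for B using that card_orbit_pos[OF w] by auto
  have U: "\<Union> ?O = {1..n}"
    using permutes_orbit_subset[OF w] card_orbit_pos(5)[OF w] by blast
  have "pairwise disjnt ?O"
  proof (rule pairwiseI, rule ccontr)
    fix A B assume AB: "A \<in> ?O" "B \<in> ?O" "A \<noteq> B" "\<not> disjnt A B"
    then obtain i j k where "A = orbit w i" "B = orbit w j" "k \<in> orbit w i" "k \<in> orbit w j"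
      by (auto simp: disjnt_iff)
    then show False using orbit_eq_or_disjoint[OF w finite_atLeastAtMost] AB(3) by metis
  qed
  then have "card (\<Union> ?O) = (\<Sum>B\<in>?O. card B)" using pos by (intro card_Union_disjoint) auto
  then have "(\<Sum>B\<in>?O. card B) = n" unfolding U by simp
  then have "sum_mset (cycle_type n w) = n"
    unfolding cycle_type_def by (simp add: sum_unfold_sum_mset)
  moreover have "0 \<notin># cycle_type n w" using pos by (force simp: cycle_type_def)
  ultimately show "cycle_type n w \<in> partitions n" by (simp add: partitions_def)
qed

text \<open>Every partition is a cycle type, and there are finitely many permutations.\<close>

lemma finite_partitions: "finite (partitions n)"
proof (rule finite_subset)
  show "partitions n \<subseteq> cycle_type n ` {w. w permutes {1..n}}"
    using ex_cycle_type by (force simp: sym_group_def)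
qed (simp add: finite_permutations)

text \<open>An arbitrary bijection is corrected by a permutation of \<open>A\<close> that matches
  the values.\<close>

lemma ex_bij_betw_image_mset_eq:
  assumes "finite A" "finite B" "image_mset f (mset_set A) = image_mset g (mset_set B)"
  obtains h where "bij_betw h A B" "\<And>x. x \<in> A \<Longrightarrow> g (h x) = f x"
proof -
  have "card A = card B" using arg_cong[OF assms(3), of size] by simp
  then obtain c where c: "bij_betw c A B" using finite_same_card_bij assms by blast
  have "image_mset (\<lambda>x. g (c x)) (mset_set A) = image_mset g (image_mset c (mset_set A))"
    by (simp add: multiset.map_comp comp_def)
  also have "\<dots> = image_mset f (mset_set A)"
    using c assms by (simp add: image_mset_mset_set bij_betw_def)
  finally obtain p where p: "p permutes A" "\<And>x. x \<in> A \<Longrightarrow> f x = g (c (p x))"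
    using image_mset_eq_implies_permutes[OF assms(1), of f "\<lambda>x. g (c x)"] by metis
  have "bij_betw (c \<circ> p) A B" using bij_betw_trans[OF permutes_imp_bij[OF p(1)] c] .
  then show thesis using that[of "c \<circ> p"] p by simp
qed

text \<open>The cycles are matched by a bijection \<open>\<beta>\<close> preserving length. With a
  base point \<open>a x\<close> on the cycle of \<open>x\<close> and a base point \<open>b x\<close>
  on its partner, the conjugating map sends \<open>m\<close> steps from \<open>a x\<close> to
  \<open>m\<close> steps from \<open>b x\<close>.\<close>

lemma cycle_type_eq_imp_conjugate:
  assumes v: "v permutes {1..n}" and w: "w permutes {1..n}" and eq: "cycle_type n v = cycle_type n w"
  obtains h where "h permutes {1..n}" "h \<circ> v = w \<circ> h"
proof -
  let ?S = "{1..n}"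
  obtain \<beta> where \<beta>: "bij_betw \<beta> (orbit v ` ?S) (orbit w ` ?S)"
    "\<And>B. B \<in> orbit v ` ?S \<Longrightarrow> card (\<beta> B) = card B"
    using ex_bij_betw_image_mset_eq[OF _ _ eq[unfolded cycle_type_def]]
    by (metis finite_atLeastAtMost finite_imageI)
  define a where "a x = (SOME y. y \<in> orbit v x)" for x
  define b where "b x = (SOME y. y \<in> \<beta> (orbit v x))" for x
  have vS: "v x \<in> ?S" if "x \<in> ?S" for x using that permutes_in_image[OF v, of x] by blast
  have a: "orbit v (a x) = orbit v x" for x
    using someI[of "\<lambda>y. y \<in> orbit v x" x] card_orbit_pos(5)[OF v]
      orbit_eq_or_disjoint[OF v finite_atLeastAtMost] unfolding a_def by auto
  have ab_const: "a (v x) = a x" "b (v x) = b x" for x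
    using orbit_eq_or_disjoint[OF v finite_atLeastAtMost orbit.base[of v x]] by (auto simp: a_def b_def)
  have b: "orbit w (b x) = \<beta> (orbit v x)" if x: "x \<in> ?S" for x
  proof -
    have "\<beta> (orbit v x) \<in> orbit w ` ?S" using bij_betwE[OF \<beta>(1)] x by blast
    then obtain y where y: "\<beta> (orbit v x) = orbit w y" by auto
    then have "b x \<in> orbit w y" using someI[of "\<lambda>z. z \<in> orbit w y" y] card_orbit_pos(5)[OF w]
      by (auto simp: b_def)
    then show ?thesis using orbit_eq_or_disjoint[OF w finite_atLeastAtMost] y by simp
  qed
  define d where "d x = funpow_dist v (a x) x" for x
  have d: "(v ^^ d x) (a x) = x" for x
    unfolding d_def using funpow_dist_prop a card_orbit_pos(5)[OF v finite_atLeastAtMost, of x] by metis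
  define h where "h x = (if x \<in> ?S then (w ^^ d x) (b x) else x)" for x
  \<comment> \<open>The number of steps matters only modulo the length of the cycle, which is the
    same for both partners.\<close>
  have h: "h x = (w ^^ m) (b x)" if x: "x \<in> ?S" "(v ^^ m) (a x) = x" for x m
  proof -
    have "(v ^^ m) (a x) = (v ^^ d x) (a x)" using x d by simp
    then have "m mod card (orbit v x) = d x mod card (orbit v x)"
      using funpow_eq_iff_mod_orbit[OF v finite_atLeastAtMost, of m "a x" "d x"] a by simp
    then have "(w ^^ m) (b x) = (w ^^ d x) (b x)"
      using funpow_eq_iff_mod_orbit[OF w finite_atLeastAtMost, of m "b x" "d x"] b[OF x(1)] \<beta>(2) x(1) by auto
    then show ?thesis using x by (simp add: h_def)
  qed
  have comm: "h (v x) = w (h x)" for x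
  proof (cases "x \<in> ?S")
    case True
    have "(v ^^ Suc (d x)) (a (v x)) = v x" using d ab_const by simp
    then have "h (v x) = (w ^^ Suc (d x)) (b (v x))" using h[of "v x" "Suc (d x)"] vS[OF True] by simp
    then show ?thesis using h[OF True d] ab_const by simp
  next
    case False
    then show ?thesis using permutes_not_in[OF v False] permutes_not_in[OF w False] by (auto simp: h_def)
  qed
  have orb_h: "h x \<in> \<beta> (orbit v x)" if "x \<in> ?S" for x
  proof -
    have "(w ^^ m) y \<in> orbit w y" for m y
      using card_orbit_pos(5)[OF w finite_atLeastAtMost, of y] by (induction m) (auto intro: orbit.step)
    then show ?thesis using b[OF that] that by (auto simp: h_def)
  qed
  have "h ` ?S \<subseteq> ?S"
    using orb_h bij_betwE[OF \<beta>(1)] permutes_orbit_subset[OF w] by blast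
  moreover have "inj_on h ?S"
  proof (rule inj_onI)
    fix x y assume xy: "x \<in> ?S" "y \<in> ?S" "h x = h y"
    have o: "\<beta> (orbit v x) \<in> orbit w ` ?S" "\<beta> (orbit v y) \<in> orbit w ` ?S"
      using bij_betwE[OF \<beta>(1)] xy by auto
    then have "\<beta> (orbit v x) = \<beta> (orbit v y)"
      using orb_h xy orbit_eq_or_disjoint[OF w finite_atLeastAtMost] by (metis imageE)
    then have oo: "orbit v x = orbit v y" using \<beta>(1) xy by (auto simp: bij_betw_def inj_on_def)
    then have same: "a x = a y" "b x = b y" by (auto simp: a_def b_def)
    have "(w ^^ d x) (b x) = (w ^^ d y) (b x)" using xy same by (simp add: h_def)
    then have "d x mod card (orbit v x) = d y mod card (orbit v x)"
      using funpow_eq_iff_mod_orbit[OF w finite_atLeastAtMost, of "d x" "b x" "d y"] b[OF xy(1)] \<beta>(2) xy(1) by auto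
    then have "(v ^^ d x) (a x) = (v ^^ d y) (a x)"
      using funpow_eq_iff_mod_orbit[OF v finite_atLeastAtMost, of "d x" "a x" "d y"] a by simp
    then show "x = y" using d[of x] d[of y] same(1) by metis
  qed
  ultimately have "bij_betw h ?S ?S" by (simp add: bij_betw_def endo_inj_surj)
  then have "h permutes ?S" by (rule bij_imp_permutes) (auto simp: h_def)
  then show thesis using that[of h] comm by (auto simp: fun_eq_iff)
qed

section \<open>Conjugacy classes and centralizers in the symmetric group\<close>

lemma orbit_conjugate:
  assumes "h permutes S" "h \<circ> v = w \<circ> h"
  shows "orbit w (h x) = h ` orbit v x"
proof -
  have "(w ^^ m) (h x) = h ((v ^^ m) x)" for m
    using fun_cong[OF assms(2)] by (induction m) (auto simp: comp_def)
  then show ?thesis by (auto simp: orbit_altdef)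
qed

lemma cycle_type_conjugate:
  assumes "h permutes {1..n}" "h \<circ> v = w \<circ> h"
  shows "cycle_type n v = cycle_type n w"
proof -
  have inj: "inj h" using assms(1) by (rule permutes_inj)
  have inj_im: "inj_on (image h) A" for A
    by (rule inj_onI) (simp add: inj_image_eq_iff[OF inj])
  have "orbit w ` {1..n} = orbit w ` h ` {1..n}" by (simp only: permutes_image[OF assms(1)])
  also have "\<dots> = image h ` orbit v ` {1..n}" using orbit_conjugate[OF assms] by (auto simp: image_image)
  finally have "cycle_type n w = image_mset card (mset_set (image h ` orbit v ` {1..n}))"
    by (simp add: cycle_type_def)
  also have "\<dots> = image_mset card (image_mset (image h) (mset_set (orbit v ` {1..n})))"
    unfolding image_mset_mset_set[OF inj_im] ..
  also have "\<dots> = cycle_type n v"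
    unfolding cycle_type_def using inj
    by (simp add: multiset.map_comp comp_def card_image inj_on_subset[OF inj])
  finally show ?thesis by simp
qed

text \<open>The orbit-stabilizer count for conjugation: permutations with the cycle type of
  \<open>s\<close> are its conjugates, and the elements conjugating \<open>s\<close> to a given
  \<open>w\<close> form a left coset of the centralizer.\<close>

lemma card_cycle_type:
  assumes s: "s permutes {1..n}"
  shows "card {w. w permutes {1..n} \<and> cycle_type n w = cycle_type n s}
    * card (centralizer (sym_group n) s) = fact n"
proof -
  let ?P = "{w. w permutes {1..n}}"
  let ?C = "centralizer (sym_group n) s"
  let ?X = "{w. w permutes {1..n} \<and> cycle_type n w = cycle_type n s}"
  let ?f = "\<lambda>h. h \<circ> s \<circ> inv_into UNIV h"
  have C: "?C = {g. g permutes {1..n} \<and> g \<circ> s = s \<circ> g}"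
    by (auto simp: centralizer_def sym_group_def)
  have conj: "?f h = w \<longleftrightarrow> h \<circ> s = w \<circ> h" if "h permutes {1..n}" for h w
    using permutes_inv_o[OF that] by (metis comp_assoc comp_id)
  have img: "?f ` ?P = ?X"
  proof (intro equalityI subsetI)
    fix w assume "w \<in> ?f ` ?P"
    then obtain h where h: "h permutes {1..n}" "w = ?f h" by (elim imageE) simp
    then show "w \<in> ?X"
      using conj[OF h(1), of w] cycle_type_conjugate[OF h(1), of s w] s
      by (auto intro!: permutes_compose permutes_inv)
  next
    fix w assume w: "w \<in> ?X"
    then obtain h where "h permutes {1..n}" "h \<circ> s = w \<circ> h"
      using cycle_type_eq_imp_conjugate[OF s, of w] by (metis (mono_tags, lifting) mem_Collect_eq)
    then show "w \<in> ?f ` ?P" using conj[of h w] by (intro image_eqI[of _ _ h]) auto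
  qed
  have fibre: "card {h \<in> ?P. ?f h = w} = card ?C" if w: "w \<in> ?X" for w
  proof -
    obtain h where h: "h permutes {1..n}" "?f h = w" using w unfolding img[symmetric] by (elim imageE) simp
    have hs: "h \<circ> s = w \<circ> h" using conj[OF h(1), of w] h(2) by blast
    have "inj_on ((\<circ>) h) ?C"
      using permutes_inj[OF h(1)] by (auto intro!: inj_onI simp: fun_eq_iff inj_def)
    moreover have "(\<circ>) h ` ?C = {h \<in> ?P. ?f h = w}"
    proof (intro equalityI subsetI)
      fix k assume "k \<in> (\<circ>) h ` ?C"
      then obtain g where g: "g permutes {1..n}" "g \<circ> s = s \<circ> g" "k = h \<circ> g" using C by auto
      have k: "k permutes {1..n}" unfolding g(3) using g h by (intro permutes_compose)
      have "k \<circ> s = w \<circ> k" unfolding g(3) comp_assoc g(2) using hs by (metis comp_assoc)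
      then show "k \<in> {h \<in> ?P. ?f h = w}" using conj[OF k] k by simp
    next
      fix k assume "k \<in> {h \<in> ?P. ?f h = w}"
      then have k: "k permutes {1..n}" "k \<circ> s = w \<circ> k" using conj by auto
      define g where "g = inv_into UNIV h \<circ> k"
      have g: "g permutes {1..n}" unfolding g_def using h k by (intro permutes_compose permutes_inv)
      have hg: "h \<circ> g = k" unfolding g_def using permutes_inv_o[OF h(1)] by (metis comp_assoc id_comp)
      have "h \<circ> (g \<circ> s) = h \<circ> (s \<circ> g)" using hs k(2) hg by (metis comp_assoc)
      then have "g \<circ> s = s \<circ> g" using permutes_inv_o[OF h(1)] by (metis comp_assoc id_comp)
      then show "k \<in> (\<circ>) h ` ?C" using g hg C by blast
    qed
    ultimately show ?thesis by (metis card_image)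
  qed
  have fin: "finite ?P" by (simp add: finite_permutations)
  have "fact n = card ?P" using card_permutations[of "{1..n}" n] by simp
  also have "\<dots> = (\<Sum>w\<in>?X. card {h \<in> ?P. ?f h = w})"
    using sum.image_gen[OF fin, of "\<lambda>_. 1::nat" ?f] unfolding img by simp
  also have "\<dots> = (\<Sum>w\<in>?X. card ?C)" using fibre by (intro sum.cong) auto
  finally show ?thesis by simp
qed

text \<open>Matrix indices start at 0, whereas cycle types refer to \<open>{1..n}\<close>;
  conjugation by \<open>Suc\<close> carries cycles to cycles.\<close>

lemma sum_orbits_reindex:
  fixes n :: nat
  shows "(\<Sum>w | w permutes {..<n}. 1 / 2 ^ card (orbit w ` {..<n}))
    = (\<Sum>w | w permutes {1..n}. 1 / (2::real) ^ card (orbit w ` {1..n}))"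
proof -
  let ?F = "\<lambda>\<pi> x. if x \<in> {1..n} then Suc (\<pi> (inv_into {..<n} Suc x)) else x"
  have b: "bij_betw Suc {..<n} {1..n}"
    by (intro bij_betw_imageI inj_onI image_Suc_lessThan) simp
  have bb: "bij_betw ?F {\<pi>. \<pi> permutes {..<n}} {\<pi>. \<pi> permutes {1..n}}"
    using bij_betw_permutations[OF b] .
  have iv: "inv_into {..<n} Suc (Suc i) = i" if "i < n" for i
    using that by (intro inv_into_f_f) auto
  have orbs: "card (orbit (?F w) ` {1..n}) = card (orbit w ` {..<n})" if w: "w permutes {..<n}" for w
  proof -
    have wl: "w i < n" if "i < n" for i using permutes_in_image[OF w, of i] that by auto
    have step: "(?F w ^^ m) (Suc i) = Suc ((w ^^ m) i) \<and> (w ^^ m) i < n" if "i < n" for i m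
      using that by (induction m) (auto simp: iv wl)
    have "orbit (?F w) (Suc i) = Suc ` orbit w i" if "i < n" for i
      using step[OF that] by (auto simp: orbit_altdef)
    then have "orbit (?F w) ` Suc ` {..<n} = image Suc ` orbit w ` {..<n}"
      by (auto simp: image_image)
    then have "orbit (?F w) ` {1..n} = image Suc ` orbit w ` {..<n}"
      unfolding image_Suc_lessThan .
    then show ?thesis by (simp add: card_image inj_on_def inj_image_eq_iff)
  qed
  have "(\<Sum>w | w permutes {..<n}. 1 / (2::real) ^ card (orbit w ` {..<n}))
      = (\<Sum>w | w permutes {..<n}. 1 / 2 ^ card (orbit (?F w) ` {1..n}))"
    by (intro sum.cong refl) (simp only: orbs mem_Collect_eq)
  also have "\<dots> = (\<Sum>w | w permutes {1..n}. 1 / 2 ^ card (orbit w ` {1..n}))"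
    by (rule sum.reindex_bij_betw[OF bb])
  finally show ?thesis .
qed

lemma sum_permutations_eq_sum_partitions:
  assumes \<sigma>: "\<And>\<mu>. \<mu> \<in> partitions n \<Longrightarrow> \<sigma> \<mu> \<in> carrier (sym_group n) \<and> cycle_type n (\<sigma> \<mu>) = \<mu>"
  shows "(\<Sum>w | w permutes {..<n}. 1 / 2 ^ card (orbit w ` {..<n})) / fact n
    = (\<Sum>\<mu>\<in>partitions n. 1 / (2 ^ size \<mu> * real (card (centralizer (sym_group n) (\<sigma> \<mu>)))))"
proof -
  let ?P = "{w. w permutes {1..n}}"
  let ?X = "\<lambda>\<mu>. {w \<in> ?P. cycle_type n w = \<mu>}"
  have fin: "finite ?P" by (simp add: finite_permutations)
  have "(\<Sum>w\<in>?P. 1 / (2::real) ^ card (orbit w ` {1..n}))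
      = (\<Sum>\<mu>\<in>partitions n. \<Sum>w\<in>?X \<mu>. 1 / (2::real) ^ card (orbit w ` {1..n}))"
    using cycle_type_in_partitions(1) by (intro sum.group[symmetric] fin finite_partitions) auto
  also have "\<dots> = (\<Sum>\<mu>\<in>partitions n. real (card (?X \<mu>)) / 2 ^ size \<mu>)"
  proof (intro sum.cong refl)
    fix \<mu>
    have "(\<Sum>w\<in>?X \<mu>. 1 / (2::real) ^ card (orbit w ` {1..n})) = (\<Sum>w\<in>?X \<mu>. 1 / 2 ^ size \<mu>)"
      using cycle_type_in_partitions(2) by (intro sum.cong) auto
    then show "(\<Sum>w\<in>?X \<mu>. 1 / (2::real) ^ card (orbit w ` {1..n})) = real (card (?X \<mu>)) / 2 ^ size \<mu>" by simp
  qed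
  also have "\<dots> = (\<Sum>\<mu>\<in>partitions n. fact n * (1 / (2 ^ size \<mu> * real (card (centralizer (sym_group n) (\<sigma> \<mu>))))))"
  proof (intro sum.cong refl)
    fix \<mu> assume "\<mu> \<in> partitions n"
    then have s: "\<sigma> \<mu> permutes {1..n}" "cycle_type n (\<sigma> \<mu>) = \<mu>" using \<sigma> by (auto simp: sym_group_def)
    have eq: "card (?X \<mu>) * card (centralizer (sym_group n) (\<sigma> \<mu>)) = fact n"
      using card_cycle_type[OF s(1)] s(2) by simp
    then have nz: "card (centralizer (sym_group n) (\<sigma> \<mu>)) > 0" by (cases "card (centralizer (sym_group n) (\<sigma> \<mu>)) = 0") auto
    have "real (card (?X \<mu>)) * real (card (centralizer (sym_group n) (\<sigma> \<mu>))) = fact n"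
      using arg_cong[OF eq, of real] by simp
    then show "real (card (?X \<mu>)) / 2 ^ size \<mu> = fact n * (1 / (2 ^ size \<mu> * real (card (centralizer (sym_group n) (\<sigma> \<mu>)))))"
      using nz by (simp add: field_simps)
  qed
  finally have "(\<Sum>w\<in>?P. 1 / (2::real) ^ card (orbit w ` {1..n}))
      = fact n * (\<Sum>\<mu>\<in>partitions n. 1 / (2 ^ size \<mu> * real (card (centralizer (sym_group n) (\<sigma> \<mu>)))))"
    unfolding sum_distrib_left[symmetric] .
  then show ?thesis unfolding sum_orbits_reindex by (simp only: nonzero_mult_div_cancel_left[OF fact_nonzero])
qed

section \<open>The limits\<close>

lemma ex_frobenius_field_Fbar:
  assumes "primepow q" "odd q"
  obtains p e where "frobenius_field (Fbar q) p e q"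
proof -
  define p where "p = aprimedivisor q"
  obtain k where p: "Factorial_Ring.prime p" and k: "k > 0" and qp: "q = p ^ k"
    using assms(1) unfolding primepow_def p_def by (auto simp: aprimedivisor_prime_power)
  interpret R: residues_prime p "residue_ring (int p)" by unfold_locales (use p in auto)
  interpret F: algebraic_closure "Fbar q"
    "ring.indexed_const (residue_ring (int (aprimedivisor q))) ` carrier (residue_ring (int (aprimedivisor q)))"
    by (rule algebraic_closure_Fbar[OF assms(1)])
  have "[(m::nat)] \<cdot>\<^bsub>residue_ring (int p)\<^esub> \<one>\<^bsub>residue_ring (int p)\<^esub> = int m mod int p" for m
    by (induction m) (auto simp: R.res_zero_eq R.res_one_eq R.res_add_eq mod_simps add.commute)
  then have "[p] \<cdot>\<^bsub>residue_ring (int p)\<^esub> \<one>\<^bsub>residue_ring (int p)\<^esub> = \<zero>\<^bsub>residue_ring (int p)\<^esub>"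
    by (simp add: R.res_zero_eq)
  from ring_hom_char[OF R.alg_closureE(2) R.ring_axioms _ this]
  have char: "[p] \<cdot>\<^bsub>Fbar q\<^esub> \<one>\<^bsub>Fbar q\<^esub> = \<zero>\<^bsub>Fbar q\<^esub>"
    using F.ring_axioms unfolding Fbar_def p_def by blast
  have "frobenius_field (Fbar q) p k q"
    by unfold_locales (rule p char k qp assms(2))+
  then show thesis by (rule that)
qed

text \<open>A power in \<open>K\<close> starts from the one of \<open>K\<close>, so agreement of the
  products on the carrier of \<open>K\<close> suffices. This matters for \<open>GL n (GF q)\<close>,
  whose products are sums formed in a smaller carrier.\<close>

lemma squares_eq:
  assumes "group H" "carrier K \<subseteq> carrier H" "\<one>\<^bsub>K\<^esub> = \<one>\<^bsub>H\<^esub>"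
    "\<And>x y. x \<in> carrier K \<Longrightarrow> y \<in> carrier K \<Longrightarrow> x \<otimes>\<^bsub>K\<^esub> y = x \<otimes>\<^bsub>H\<^esub> y" "\<one>\<^bsub>K\<^esub> \<in> carrier K"
  shows "squares K = {x \<otimes>\<^bsub>H\<^esub> x | x. x \<in> carrier K}"
proof -
  interpret H: group H by fact
  have "x [^]\<^bsub>K\<^esub> (2::nat) = x \<otimes>\<^bsub>H\<^esub> x" if "x \<in> carrier K" for x
  proof -
    have "x \<in> carrier H" using assms(2) that by blast
    then have "\<one>\<^bsub>K\<^esub> \<otimes>\<^bsub>K\<^esub> x = x" using assms(3,4,5) that by simp
    then show ?thesis using assms(4) that by (simp add: nat_pow_def numeral_2_eq_2)
  qed
  then show ?thesis unfolding squares_def Setcompr_eq_image by (intro image_cong refl)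
qed

context frobenius_field
begin

text \<open>A matrix over \<open>K\<close> that is invertible over \<open>L\<close> is invertible
  over \<open>K\<close>: its inverse is again a fixed point, because the fixed points form a group,
  and so has entries in \<open>K\<close>.\<close>

lemma GF_eq_fixed:
  assumes GF: "K = L\<lparr>carrier := {x \<in> carrier L. x [^] q = x}\<rparr>" and K: "field K"
  shows "carrier (GL n K) = frobenius_GL.fixed_points L q False n"
    and "\<And>A B. A \<in> carrier (GL n K) \<Longrightarrow> B \<in> carrier (GL n K) \<Longrightarrow> A \<otimes>\<^bsub>GL n K\<^esub> B = A \<otimes>\<^bsub>GL n L\<^esub> B"
    and "\<one>\<^bsub>GL n K\<^esub> = \<one>\<^bsub>GL n L\<^esub>"
proof -
  interpret K: field K by (rule K)
  interpret G: frobenius_GL L p e q False n by unfold_locales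
  interpret M: monoid "mat_monoid n L" by (rule monoid_mat_monoid)
  interpret KM: monoid "mat_monoid n K" by (rule K.monoid_mat_monoid)
  have ops: "x \<oplus>\<^bsub>K\<^esub> y = x \<oplus> y" "x \<otimes>\<^bsub>K\<^esub> y = x \<otimes> y" "\<zero>\<^bsub>K\<^esub> = \<zero>" "\<one>\<^bsub>K\<^esub> = \<one>" for x y
    by (simp_all add: GF)
  have carrier_K: "x \<in> carrier K \<longleftrightarrow> x \<in> carrier L \<and> x [^] q = x" for x by (simp add: GF)
  \<comment> \<open>Sums depend on the carrier of the ring, so the two are compared only for
    summands in \<open>K\<close>.\<close>
  have finsum_K: "finsum K f A = finsum L f A" if "finite A" "f \<in> A \<rightarrow> carrier K" for f :: "nat \<Rightarrow> 'a" and A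
    using that
  proof (induction A rule: finite_induct)
    case (insert a A)
    then have "f \<in> A \<rightarrow> carrier L" "f a \<in> carrier L" by (auto simp: carrier_K)
    then show ?case using insert by (simp add: ops)
  qed (simp add: ops)
  have carrier_KM: "A \<in> carrier (mat_monoid n K) \<longleftrightarrow> A \<in> carrier (mat_monoid n L) \<and> frob_mat A = A" for A
  proof
    assume A: "A \<in> carrier (mat_monoid n K)"
    then have AL: "A \<in> carrier (mat_monoid n L)"
      by (auto simp: K.carrier_mat_monoid_iff carrier_mat_monoid_iff carrier_K)
    moreover have "frob_mat A = A"
      using A AL by (intro mat_monoid_eqI[of _ n]) (auto simp: frob_mat_entry[of _ n] K.carrier_mat_monoid_iff carrier_K)
    ultimately show "A \<in> carrier (mat_monoid n L) \<and> frob_mat A = A" by simp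
  next
    assume A: "A \<in> carrier (mat_monoid n L) \<and> frob_mat A = A"
    then have "A $$ (i, j) [^] q = A $$ (i, j)" if "i < n" "j < n" for i j
      using frob_mat_entry[of A n i j] that by simp
    then show "A \<in> carrier (mat_monoid n K)"
      using A by (auto simp: K.carrier_mat_monoid_iff carrier_mat_monoid_iff carrier_K)
  qed
  have KM_mult: "A \<otimes>\<^bsub>mat_monoid n K\<^esub> B = A \<otimes>\<^bsub>mat_monoid n L\<^esub> B"
    if A: "A \<in> carrier (mat_monoid n K)" and B: "B \<in> carrier (mat_monoid n K)" for A B
  proof (rule mat_monoid_eqI)
    have AB: "A \<otimes>\<^bsub>mat_monoid n K\<^esub> B \<in> carrier (mat_monoid n K)" using A B by (rule KM.m_closed)
    then show "A \<otimes>\<^bsub>mat_monoid n K\<^esub> B \<in> carrier (mat_monoid n L)" unfolding carrier_KM by simp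
    show "A \<otimes>\<^bsub>mat_monoid n L\<^esub> B \<in> carrier (mat_monoid n L)" using A B unfolding carrier_KM by simp
    fix i j assume ij: "i < n" "j < n"
    have "(\<Oplus>\<^bsub>K\<^esub>k\<in>{..<n}. A $$ (i, k) \<otimes>\<^bsub>K\<^esub> B $$ (k, j)) = (\<Oplus>k\<in>{..<n}. A $$ (i, k) \<otimes>\<^bsub>K\<^esub> B $$ (k, j))"
      using A B ij by (intro finsum_K) auto
    then show "(A \<otimes>\<^bsub>mat_monoid n K\<^esub> B) $$ (i, j) = (A \<otimes>\<^bsub>mat_monoid n L\<^esub> B) $$ (i, j)"
      using ij by (simp add: ops)
  qed
  have KM_one: "\<one>\<^bsub>mat_monoid n K\<^esub> = \<one>\<^bsub>mat_monoid n L\<^esub>" unfolding mat_monoid_def ops by simp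
  show "\<one>\<^bsub>GL n K\<^esub> = \<one>\<^bsub>GL n L\<^esub>" by (simp add: one_GL KM_one)
  show "A \<otimes>\<^bsub>GL n K\<^esub> B = A \<otimes>\<^bsub>GL n L\<^esub> B" if "A \<in> carrier (GL n K)" "B \<in> carrier (GL n K)" for A B
    using that unfolding mult_GL carrier_GL by (intro KM_mult) auto
  show "carrier (GL n K) = G.fixed_points"
  proof (intro equalityI subsetI)
    fix A assume "A \<in> carrier (GL n K)"
    then obtain B where A: "A \<in> carrier (mat_monoid n K)" and B: "B \<in> carrier (mat_monoid n K)"
      and AB: "A \<otimes>\<^bsub>mat_monoid n K\<^esub> B = \<one>\<^bsub>mat_monoid n K\<^esub>" "B \<otimes>\<^bsub>mat_monoid n K\<^esub> A = \<one>\<^bsub>mat_monoid n K\<^esub>"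
      unfolding carrier_GL Units_def by blast
    have "A \<in> Units (mat_monoid n L)" unfolding Units_def
      using A B AB KM_mult[OF A B] KM_mult[OF B A] KM_one unfolding carrier_KM by auto
    then show "A \<in> G.fixed_points"
      using A unfolding carrier_KM G.fixed_points_def carrier_GL G.frob_GL_def by simp
  next
    fix A assume A: "A \<in> G.fixed_points"
    then have AG: "A \<in> carrier G.G" "frob_mat A = A" by (auto simp: G.fixed_points_def G.frob_GL_def)
    define B where "B = inv\<^bsub>G.G\<^esub> A"
    have B: "B \<in> G.fixed_points" unfolding B_def
      using subgroup.m_inv_closed[OF G.subgroup_fixed_points A] .
    then have BG: "B \<in> carrier G.G" "frob_mat B = B" by (auto simp: G.fixed_points_def G.frob_GL_def)
    have AK: "A \<in> carrier (mat_monoid n K)" and BK: "B \<in> carrier (mat_monoid n K)"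
      unfolding carrier_KM using AG BG by (auto intro: carrier_GL_closed)
    have "A \<otimes>\<^bsub>G.G\<^esub> B = \<one>\<^bsub>G.G\<^esub>" "B \<otimes>\<^bsub>G.G\<^esub> A = \<one>\<^bsub>G.G\<^esub>" using AG by (auto simp: B_def)
    then have "A \<otimes>\<^bsub>mat_monoid n K\<^esub> B = \<one>\<^bsub>mat_monoid n K\<^esub>" "B \<otimes>\<^bsub>mat_monoid n K\<^esub> A = \<one>\<^bsub>mat_monoid n K\<^esub>"
      unfolding KM_mult[OF AK BK] KM_mult[OF BK AK] KM_one by (simp_all add: mult_GL one_GL)
    then show "A \<in> carrier (GL n K)" unfolding carrier_GL Units_def using AK BK by blast
  qed
qed

end

lemma squares_proportion_U_GL:
  assumes q: "primepow q" "odd q" "q > 4 * n\<^sup>2"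
  defines "c \<equiv> (\<Sum>w | w permutes {..<n}. 1 / (2::real) ^ card (orbit w ` {..<n})) / fact n"
  shows "\<bar>real (card (squares (U n q))) / real (order (U n q)) - c\<bar> \<le> 4 * real n ^ 2 / real q"
    and "\<bar>real (card (squares (GL n (GF q)))) / real (order (GL n (GF q))) - c\<bar> \<le> 4 * real n ^ 2 / real q"
proof -
  obtain p e where F: "frobenius_field (Fbar q) p e q" using ex_frobenius_field_Fbar[OF q(1,2)] .
  interpret F: frobenius_field "Fbar q" p e q by (rule F)
  interpret GT: frobenius_GL "Fbar q" p e q True n by unfold_locales
  interpret GF: frobenius_GL "Fbar q" p e q False n by unfold_locales
  have group: "group (GL n (Fbar q))" by (rule F.group_GL)
  have cU: "carrier (U n q) = GT.fixed_points"
    by (auto simp: U_def GT.fixed_points_def unitary_frobenius_def GT.frob_GL_def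
        F.conj_transpose_def F.frob_mat_def)
  have "squares (U n q) = {x \<otimes>\<^bsub>GL n (Fbar q)\<^esub> x | x. x \<in> carrier (U n q)}"
  proof (rule squares_eq[OF group])
    show "\<one>\<^bsub>U n q\<^esub> \<in> carrier (U n q)"
      unfolding cU using subgroup.one_closed[OF GT.subgroup_fixed_points] by (simp add: U_def)
  qed (auto simp: U_def)
  then show "\<bar>real (card (squares (U n q))) / real (order (U n q)) - c\<bar> \<le> 4 * real n ^ 2 / real q"
    using GT.squares_proportion[OF q(3)] unfolding cU order_def c_def by simp
  note K = F.GF_eq_fixed[OF GF_def field_GF[OF q(1)], where n = n]
  have "squares (GL n (GF q)) = {x \<otimes>\<^bsub>GL n (Fbar q)\<^esub> x | x. x \<in> carrier (GL n (GF q))}"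
  proof (rule squares_eq[OF group])
    show "carrier (GL n (GF q)) \<subseteq> carrier (GL n (Fbar q))" unfolding K by (auto simp: GF.fixed_points_def)
    show "\<one>\<^bsub>GL n (GF q)\<^esub> \<in> carrier (GL n (GF q))"
      unfolding K using subgroup.one_closed[OF GF.subgroup_fixed_points] .
  qed (use K in auto)
  then show "\<bar>real (card (squares (GL n (GF q)))) / real (order (GL n (GF q))) - c\<bar> \<le> 4 * real n ^ 2 / real q"
    using GF.squares_proportion[OF q(3)] unfolding K(1) order_def c_def by simp
qed

lemma tendsto_of_bound:
  fixes f :: "nat \<Rightarrow> real"
  assumes "\<And>q. primepow q \<Longrightarrow> odd q \<Longrightarrow> q > m \<Longrightarrow> \<bar>f q - c\<bar> \<le> a / real q"
  shows "(f \<longlongrightarrow> c) (inf at_top (principal {q. primepow q \<and> odd q}))"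
proof -
  let ?F = "inf at_top (principal {q. primepow q \<and> odd (q::nat)})"
  have z: "((\<lambda>q. a / real q) \<longlongrightarrow> 0) ?F"
    by (rule tendsto_mono[OF inf_le1 lim_const_over_n])
  have "eventually (\<lambda>q. norm (f q - c) \<le> norm (a / real q) * 1) ?F"
    unfolding eventually_inf_principal using eventually_gt_at_top[of m]
  proof eventually_elim
    case (elim q)
    then show ?case using assms[of q] abs_ge_self[of "a / real q"] by fastforce
  qed
  then have "((\<lambda>q. f q - c) \<longlongrightarrow> 0) ?F"
    by (rule tendsto_0_le[OF z])
  then show ?thesis by (simp add: LIM_zero_iff)
qed

theorem proposition5p3:
  fixes n :: nat and \<sigma> :: "nat multiset \<Rightarrow> nat \<Rightarrow> nat"
  assumes "n \<ge> 1"
    and "\<And>\<mu>. \<mu> \<in> partitions n \<Longrightarrow> \<sigma> \<mu> \<in> carrier (sym_group n) \<and> cycle_type n (\<sigma> \<mu>) = \<mu>"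
  shows "((\<lambda>q. real (card (squares (U n q))) / real (order (U n q))) \<longlongrightarrow>
      (\<Sum>\<mu>\<in>partitions n. 1 / (2 ^ size \<mu> * real (card (centralizer (sym_group n) (\<sigma> \<mu>))))))
      (inf at_top (principal {q. primepow q \<and> odd q})) \<and>
    ((\<lambda>q. real (card (squares (GL n (GF q)))) / real (order (GL n (GF q)))) \<longlongrightarrow>
      (\<Sum>\<mu>\<in>partitions n. 1 / (2 ^ size \<mu> * real (card (centralizer (sym_group n) (\<sigma> \<mu>))))))
      (inf at_top (principal {q. primepow q \<and> odd q}))"
proof -
  have eq: "(\<Sum>w | w permutes {..<n}. 1 / 2 ^ card (orbit w ` {..<n})) / fact n
    = (\<Sum>\<mu>\<in>partitions n. 1 / (2 ^ size \<mu> * real (card (centralizer (sym_group n) (\<sigma> \<mu>)))))"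
    by (rule sum_permutations_eq_sum_partitions) (rule assms(2))
  note bounds = squares_proportion_U_GL[of _ n, unfolded eq]
  show ?thesis
    by (intro conjI tendsto_of_bound[where m = "4 * n\<^sup>2" and a = "4 * real n ^ 2"] bounds)
qed

end
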